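(* For the $2dp$-neighbor graph in dimension $d=2$, the critical parameter satisfies $p_c(2) < 1/2$. In particular, the $2$-neighbor graph on $\mathbb{Z}^2$ percolates, i.e., $\theta_{1/2}(2)>0$.
   Context: The $2dp$-neighbor graph on $\mathbb{Z}^d$: for $p\in[0,1]$ put $k:=\lfloor 2dp\rfloor$ and $\varepsilon:=2dp-k\in[0,1)$. Independently over the vertices of $\mathbb{Z}^d$, each vertex chooses uniformly at random $k$ of its $2d$ nearest neighbors, and the directed edges from the vertex to these neighbors are open. Additionally, independently, each vertex throws a coin with success probability $\varepsilon$; in case of success, one further neighbor is chosen uniformly from those not previously chosen and the directed edge towards it is also opened. All other directed edges are closed. The resulting law on $\{0,1\}^{\mathcal{E}}$, with $\mathcal{E}=\{(x,y)\in(\mathbb{Z}^d)^2:\|x-y\|_{1}=1\}$ the set of directed nearest-neighbor edges, is denoted $\mathbb{P}_p$. The event $o\rightsquigarrow\infty$ means that there is an infinite self-avoiding directed open path starting at the origin $o$. Set $\theta_p(d):=\mathbb{P}_p(o\rightsquigarrow\infty)$ and $p_c(d):=\sup\{p\ge 0:\theta_p(d)=0\}$. "Percolates" means $\theta_p>0$. For $d=2$ and $p=1/2$ the model is the $2$-neighbor graph: each vertex of $\mathbb{Z}^2$ independently opens the directed edges to exactly $2$ of its $4$ neighbors, chosen uniformly at random. *)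

theory Defs
  imports "HOL-Probability.Probability"
begin

text \<open>
  The lattice \<open>\<int>\<^sup>d\<close> is the type \<^typ>\<open>int ^ 'd\<close>, with \<open>d = CARD('d)\<close>.
\<close>

definition dir_edges :: "((int ^ 'd::finite) \<times> (int ^ 'd)) set" where
  "dir_edges = {(x, y). (\<Sum>i\<in>UNIV. \<bar>x $ i - y $ i\<bar>) = 1}"

definition nbrs :: "int ^ 'd::finite \<Rightarrow> (int ^ 'd) set" where
  "nbrs x = {y. (x, y) \<in> dir_edges}"

definition base_degree :: "'d::finite itself \<Rightarrow> real \<Rightarrow> nat" where
  "base_degree _ p = nat \<lfloor>2 * real CARD('d) * p\<rfloor>"

definition extra_prob :: "'d::finite itself \<Rightarrow> real \<Rightarrow> real" where
  "extra_prob _ p = frac (2 * real CARD('d) * p)"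

text \<open>
  The law of the set of neighbours chosen by the vertex \<open>x\<close>.  For \<open>p = 1\<close> the set
  \<open>nbrs x - S\<close> is empty, but then the coin has success probability 0, so that the
  (unspecified) value of \<^const>\<open>pmf_of_set\<close> at the empty set is irrelevant.
\<close>

definition choice_pmf :: "real \<Rightarrow> int ^ 'd::finite \<Rightarrow> (int ^ 'd) set pmf" where
  "choice_pmf p x =
     bind_pmf (pmf_of_set {S. S \<subseteq> nbrs x \<and> card S = base_degree TYPE('d) p}) (\<lambda>S.
     bind_pmf (bernoulli_pmf (extra_prob TYPE('d) p)) (\<lambda>success.
       if success then map_pmf (\<lambda>y. insert y S) (pmf_of_set (nbrs x - S))
       else return_pmf S))"

text \<open>
  The law \<open>\<P>\<^sub>p\<close> on \<open>{0,1}\<close>-valued (here: Boolean) configurations of directed edges: the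
  choices are independent over the vertices, and the edge \<open>(x, y)\<close> is open iff \<open>x\<close> has
  chosen \<open>y\<close>.
\<close>

definition edge_law :: "real \<Rightarrow> ((int ^ 'd::finite) \<times> (int ^ 'd) \<Rightarrow> bool) measure" where
  "edge_law p =
     distr (\<Pi>\<^sub>M x\<in>UNIV. measure_pmf (choice_pmf p x))
           (\<Pi>\<^sub>M e\<in>dir_edges. count_space UNIV)
           (\<lambda>c. \<lambda>(x, y)\<in>dir_edges. y \<in> c x)"

definition percolates_from_origin :: "((int ^ 'd::finite) \<times> (int ^ 'd) \<Rightarrow> bool) \<Rightarrow> bool" where
  "percolates_from_origin \<omega> \<longleftrightarrow>
     (\<exists>\<gamma> :: nat \<Rightarrow> int ^ 'd. \<gamma> 0 = 0 \<and> inj \<gamma> \<and>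
        (\<forall>n. (\<gamma> n, \<gamma> (Suc n)) \<in> dir_edges \<and> \<omega> (\<gamma> n, \<gamma> (Suc n))))"

definition theta :: "'d::finite itself \<Rightarrow> real \<Rightarrow> real" where
  "theta _ p =
     (let P = edge_law p :: ((int ^ 'd) \<times> (int ^ 'd) \<Rightarrow> bool) measure
      in measure P {\<omega> \<in> space P. percolates_from_origin \<omega>})"

text \<open>The model is only defined for \<open>p \<in> [0,1]\<close>, hence the restriction \<open>p \<le> 1\<close>.\<close>

definition crit_prob :: "'d::finite itself \<Rightarrow> real" where
  "crit_prob d = Sup {p. 0 \<le> p \<and> p \<le> 1 \<and> theta d p = 0}"

text \<open>In dimension 2 with \<open>p = 1/2\<close>, every vertex chooses exactly 2 of its 4 neighbours.\<close>

lemma choice_pmf_two_neighbour: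
  "choice_pmf (1/2) (x :: int ^ 2) = pmf_of_set {S. S \<subseteq> nbrs x \<and> card S = 2}"
proof -
  have "bernoulli_pmf 0 = return_pmf False"
    by (rule pmf_eqI, rename_tac b, case_tac b) (simp_all add: pmf_return)
  then show ?thesis
    by (simp add: choice_pmf_def base_degree_def extra_prob_def frac_def bind_return_pmf bind_return_pmf')
qed

lemma edge_law_measurable:
  "(\<lambda>c. \<lambda>(x, y)\<in>dir_edges. y \<in> c x) \<in>
     measurable (\<Pi>\<^sub>M x\<in>UNIV. measure_pmf (choice_pmf p (x :: int ^ 'd::finite)))
       (\<Pi>\<^sub>M e\<in>dir_edges. count_space UNIV)"
proof (rule measurable_restrict)
  fix e :: "(int ^ 'd) \<times> (int ^ 'd)"
  have "(\<lambda>S. snd e \<in> S) \<circ> (\<lambda>c. c (fst e)) \<in>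
     measurable (\<Pi>\<^sub>M x\<in>UNIV. measure_pmf (choice_pmf p x)) (count_space UNIV)"
    by (rule measurable_comp[OF measurable_component_singleton]) auto
  then show "(\<lambda>c. case e of (x, y) \<Rightarrow> y \<in> c x) \<in>
     measurable (\<Pi>\<^sub>M x\<in>UNIV. measure_pmf (choice_pmf p x)) (count_space UNIV)"
    by (simp add: comp_def case_prod_beta)
qed

lemma prob_space_edge_law: "prob_space (edge_law p)"
  unfolding edge_law_def
  by (intro prob_space.prob_space_distr edge_law_measurable prob_space_PiM
      measure_pmf.prob_space_axioms)

end

(*
  A finite box is left from the origin iff the origin is joined to its complement by open
  edges whose tails lie in the box, and for this event only the avoidance probabilities
  g(A) = P(S disjoint from A) of the random set S chosen by a vertex matter; lowering g raises
  the probability. For independent edges of density 1/2 one has g(A) = 2^(-|A|), for the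
  2-neighbour graph g = 1/2, 1/6, 0, 0 for |A| = 1, 2, 3, 4: nothing is gained for |A| = 1.

  We interpolate linearly from independent edges (tau = 0) to a law (tau = 1) whose g is still
  above that of the model with p slightly below 1/2. In the derivative of the exit
  probability, pivotal vertices with at least two useful neighbours contribute a positive
  amount and those with one useful neighbour a tiny negative amount. A local rewiring
  of 2x2 blocks shows that the former are at least a constant fraction of all pivotal
  vertices, so the derivative is at least a constant times the expected number of pivotal
  vertices.

  At tau = 0 self-duality bounds the exit probability from a box of size n below by c/n, and
  by monotonicity the same holds for all tau. This excludes exponential decay, so the
  argument of Duminil-Copin and Tassion bounds the number of pivotal vertices below by a
  multiple of the probability of not leaving the box. Hence the exit probability at tau = 1
  is bounded below uniformly in n.
*)

theory Submission
  imports Defs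
begin

subsection \<open>Finite product expectations\<close>

text \<open>The mixture with independent edges is what makes the surgery possible: each of the 16
  possible choices of a vertex keeps weight at least 1/32, so changing a bounded number of vertices
  costs a bounded factor, whereas a vertex of the 2-neighbour graph cannot make most of these
  choices. The margin \<delta> = \<open>small\<close> is fixed afterwards: for p below 1/2 a single
  neighbour is avoided with probability 1 - p > 1/2, which gives a loss of order \<delta> in the
  derivative, and \<open>small\<close> is chosen so that the surgery bound turns this into at most
  half of the gain. The edges out of one vertex are dependent. Exploring the region that cannot
  leave the box therefore conditions choices on avoiding certain neighbours; submultiplicativity,
  g(A \<union> B) \<le> g(A) g(B) for disjoint A and B, shows that this only helps. Exit
  probabilities are treated as finite sums with real weights, because differentiation produces
  signed weights and closing edges produces weights of total at most 1. Planarity enters only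
  through a flux inequality for the primal and dual reachable sets.\<close>

definition wsum :: "'a set \<Rightarrow> ('a \<Rightarrow> 'a set) \<Rightarrow> ('a \<Rightarrow> 'a set \<Rightarrow> real) \<Rightarrow> (('a \<Rightarrow> 'a set) \<Rightarrow> real) \<Rightarrow> real" where
  "wsum V N w f = (\<Sum>c\<in>PiE V (\<lambda>q. Pow (N q)). (\<Prod>q\<in>V. w q (c q)) * f c)"

text \<open>Configurations are total functions here. Values off \<open>A\<close>, in particular the
  \<open>undefined\<close> ones of a \<open>PiE\<close> function, therefore cannot influence
  \<open>f\<close>.\<close>

definition local_on :: "'a set \<Rightarrow> (('a \<Rightarrow> 'b) \<Rightarrow> 'c) \<Rightarrow> bool" where
  "local_on A f \<longleftrightarrow> (\<forall>c c'. (\<forall>q\<in>A. c q = c' q) \<longrightarrow> f c = f c')"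

lemma local_onD: "local_on A f \<Longrightarrow> (\<And>q. q \<in> A \<Longrightarrow> c q = c' q) \<Longrightarrow> f c = f c'"
  unfolding local_on_def by blast

lemma local_on_mono: "local_on A f \<Longrightarrow> A \<subseteq> B \<Longrightarrow> local_on B f"
  unfolding local_on_def by (meson subsetD)

lemma local_on_const [simp]: "local_on A (\<lambda>_. k)"
  unfolding local_on_def by simp

lemma local_on_comp: "local_on A f \<Longrightarrow> local_on A (\<lambda>c. g (f c))"
  unfolding local_on_def by metis

lemma local_on_comp2: "local_on A f \<Longrightarrow> local_on A h \<Longrightarrow> local_on A (\<lambda>c. g (f c) (h c))"
  unfolding local_on_def by metis

lemma wsum_empty [simp]: "wsum {} N w f = f (\<lambda>_. undefined)"
  unfolding wsum_def by simp

lemma wsum_insert: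
  assumes "finite V" "q \<notin> V"
  shows "wsum (insert q V) N w f = (\<Sum>s\<in>Pow (N q). w q s * wsum V N w (\<lambda>c. f (c(q := s))))"
proof -
  let ?X = "\<lambda>q. Pow (N q)"
  have inj: "inj_on (\<lambda>(y, g). g(q := y)) (?X q \<times> PiE V ?X)"
    using inj_combinator[OF assms(2), of ?X] by simp
  have "wsum (insert q V) N w f =
      (\<Sum>(s, c)\<in>?X q \<times> PiE V ?X. (\<Prod>r\<in>insert q V. w r ((c(q := s)) r)) * f (c(q := s)))"
    unfolding wsum_def PiE_insert_eq
    by (subst sum.reindex[OF inj]) (simp add: case_prod_beta' comp_def)
  also have "\<dots> = (\<Sum>(s, c)\<in>?X q \<times> PiE V ?X. w q s * ((\<Prod>r\<in>V. w r (c r)) * f (c(q := s))))"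
  proof (intro sum.cong refl, clarify)
    fix s c
    have "(\<Prod>r\<in>V. w r ((c(q := s)) r)) = (\<Prod>r\<in>V. w r (c r))"
      using assms(2) by (intro prod.cong) auto
    then show "(\<Prod>r\<in>insert q V. w r ((c(q := s)) r)) * f (c(q := s)) =
        w q s * ((\<Prod>r\<in>V. w r (c r)) * f (c(q := s)))"
      using assms by simp
  qed
  also have "\<dots> = (\<Sum>s\<in>?X q. \<Sum>c\<in>PiE V ?X. w q s * ((\<Prod>r\<in>V. w r (c r)) * f (c(q := s))))"
    by (rule sum.cartesian_product[symmetric])
  finally show ?thesis
    unfolding wsum_def by (simp add: sum_distrib_left)
qed

lemma wsum_remove:
  assumes "finite V" "q \<in> V"
  shows "wsum V N w f = (\<Sum>s\<in>Pow (N q). w q s * wsum (V - {q}) N w (\<lambda>c. f (c(q := s))))"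
  using wsum_insert[of "V - {q}" q N w f] assms by (simp add: insert_absorb)

lemma wsum_cong:
  assumes "\<And>c. c \<in> PiE V (\<lambda>q. Pow (N q)) \<Longrightarrow> f c = g c"
  shows "wsum V N w f = wsum V N w g"
  unfolding wsum_def using assms by (intro sum.cong) auto

lemma wsum_cong_weight:
  assumes "\<And>q s. q \<in> V \<Longrightarrow> s \<subseteq> N q \<Longrightarrow> w q s = w' q s"
  shows "wsum V N w f = wsum V N w' f"
  unfolding wsum_def
proof (intro sum.cong refl)
  fix c assume "c \<in> PiE V (\<lambda>q. Pow (N q))"
  then have "(\<Prod>q\<in>V. w q (c q)) = (\<Prod>q\<in>V. w' q (c q))"
    by (intro prod.cong refl assms) (auto simp: PiE_iff)
  then show "(\<Prod>q\<in>V. w q (c q)) * f c = (\<Prod>q\<in>V. w' q (c q)) * f c" by simp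
qed

lemma wsum_mono:
  assumes "\<And>q s. q \<in> V \<Longrightarrow> s \<subseteq> N q \<Longrightarrow> 0 \<le> w q s"
    and "\<And>c. c \<in> PiE V (\<lambda>q. Pow (N q)) \<Longrightarrow> f c \<le> g c"
  shows "wsum V N w f \<le> wsum V N w g"
  unfolding wsum_def
  by (intro sum_mono mult_left_mono prod_nonneg assms) (auto simp: PiE_iff intro!: assms)

lemma wsum_zero [simp]: "wsum V N w (\<lambda>_. 0) = 0"
  unfolding wsum_def by simp

lemma wsum_nonneg:
  assumes "\<And>q s. q \<in> V \<Longrightarrow> s \<subseteq> N q \<Longrightarrow> 0 \<le> w q s"
    and "\<And>c. c \<in> PiE V (\<lambda>q. Pow (N q)) \<Longrightarrow> 0 \<le> f c"
  shows "0 \<le> wsum V N w f"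
  using wsum_mono[of V N w "\<lambda>_. 0" f] assms by simp

lemma wsum_cmult: "wsum V N w (\<lambda>c. k * f c) = k * wsum V N w f"
  unfolding wsum_def by (simp add: sum_distrib_left mult.left_commute)

lemma wsum_add: "wsum V N w (\<lambda>c. f c + g c) = wsum V N w f + wsum V N w g"
  unfolding wsum_def by (simp add: distrib_left sum.distrib)

lemma wsum_diff: "wsum V N w (\<lambda>c. f c - g c) = wsum V N w f - wsum V N w g"
  unfolding wsum_def by (simp add: right_diff_distrib sum_subtractf)

lemma wsum_sum: "wsum V N w (\<lambda>c. \<Sum>i\<in>I. f i c) = (\<Sum>i\<in>I. wsum V N w (f i))"
  unfolding wsum_def by (simp add: sum_distrib_left) (rule sum.swap)

text \<open>Independence over disjoint vertex sets, by expanding the sum one vertex of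
  \<open>A\<close> at a time.\<close>

lemma wsum_mult_local:
  assumes "finite A" "finite B" "A \<inter> B = {}" "local_on A f" "local_on B g"
  shows "wsum (A \<union> B) N w (\<lambda>c. f c * g c) = wsum A N w f * wsum B N w g"
  using assms
proof (induction A arbitrary: f rule: finite_induct)
  case empty
  define k where "k = f (\<lambda>_. undefined)"
  have "f c = k" for c
    unfolding k_def using empty.prems(3) by (rule local_onD) auto
  then show ?case by (simp add: wsum_cmult)
next
  case (insert q A)
  have loc: "local_on A (\<lambda>c. f (c(q := s)))" for s
    unfolding local_on_def
  proof (intro allI impI)
    fix c c' :: "'a \<Rightarrow> 'a set" assume "\<forall>x\<in>A. c x = c' x"
    then show "f (c(q := s)) = f (c'(q := s))"
      by (intro local_onD[OF insert.prems(3)]) auto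
  qed
  have g: "g (c(q := s)) = g c" for c s
    by (rule local_onD[OF insert.prems(4)]) (use insert.prems in auto)
  have "wsum (insert q A \<union> B) N w (\<lambda>c. f c * g c) =
      (\<Sum>s\<in>Pow (N q). w q s * wsum (A \<union> B) N w (\<lambda>c. f (c(q := s)) * g c))"
    using insert by (simp add: wsum_insert g)
  also have "\<dots> = (\<Sum>s\<in>Pow (N q). w q s * (wsum A N w (\<lambda>c. f (c(q := s))) * wsum B N w g))"
    using insert.prems(2) by (subst insert.IH[OF insert.prems(1) _ loc insert.prems(4)]) simp_all
  finally show ?case
    using insert by (simp add: wsum_insert sum_distrib_right mult.assoc)
qed

lemma wsum_const:
  assumes "finite V" "\<And>q. q \<in> V \<Longrightarrow> (\<Sum>s\<in>Pow (N q). w q s) = 1"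
  shows "wsum V N w (\<lambda>_. k) = k"
  using assms by (induction V rule: finite_induct) (simp_all add: wsum_insert flip: sum_distrib_right)

lemma wsum_marginal:
  assumes "finite V" "A \<subseteq> V" "local_on A f" "\<And>q. q \<in> V \<Longrightarrow> (\<Sum>s\<in>Pow (N q). w q s) = 1"
  shows "wsum V N w f = wsum A N w f"
proof -
  have "wsum (A \<union> (V - A)) N w (\<lambda>c. f c * 1) = wsum A N w f * wsum (V - A) N w (\<lambda>_. 1)"
    using assms finite_subset by (intro wsum_mult_local) auto
  moreover have "A \<union> (V - A) = V" using assms by auto
  moreover have "wsum (V - A) N w (\<lambda>_. 1) = 1"
    using assms by (intro wsum_const) auto
  ultimately show ?thesis by simp
qed

lemma wsum_scale:
  assumes "finite V"
  shows "wsum V N (\<lambda>q s. g q * w q s) f = (\<Prod>q\<in>V. g q) * wsum V N w f"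
  unfolding wsum_def by (simp add: prod.distrib sum_distrib_left mult.assoc)

text \<open>Serves both the translations of the lattice and the passage from pairs of integers to
  \<open>int ^ 2\<close>, hence the two types.\<close>

lemma wsum_reindex:
  fixes \<pi> :: "'a \<Rightarrow> 'b"
  assumes "finite V" "bij \<pi>"
    and "\<And>q. q \<in> V \<Longrightarrow> N' (\<pi> q) = \<pi> ` N q"
    and "\<And>q s. q \<in> V \<Longrightarrow> s \<subseteq> N q \<Longrightarrow> w' (\<pi> q) (\<pi> ` s) = w q s"
    and "local_on (\<pi> ` V) f"
  shows "wsum (\<pi> ` V) N' w' f = wsum V N w (\<lambda>c. f (\<lambda>x. \<pi> ` c (inv \<pi> x)))"
  using assms(1,3-)
proof (induction V arbitrary: f rule: finite_induct)
  case empty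
  have "f (\<lambda>_. undefined) = f (\<lambda>x. \<pi> ` undefined)"
    by (rule local_onD[OF empty.prems(3)]) simp
  then show ?case by simp
next
  case (insert q V)
  have inj: "inj \<pi>" using assms(2) by (simp add: bij_def)
  have upd: "(\<lambda>x. \<pi> ` (c(q := s)) (inv \<pi> x)) = (\<lambda>x. \<pi> ` c (inv \<pi> x))(\<pi> q := \<pi> ` s)" for c s
  proof
    fix x
    obtain y where "x = \<pi> y" using bij_is_surj[OF assms(2)] by (metis surjD)
    then show "\<pi> ` (c(q := s)) (inv \<pi> x) = ((\<lambda>x. \<pi> ` c (inv \<pi> x))(\<pi> q := \<pi> ` s)) x"
      using inj by (simp add: inv_f_f[OF inj] inj_eq)
  qed
  have loc: "local_on (\<pi> ` V) (\<lambda>c. f (c(\<pi> q := s)))" for s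
    unfolding local_on_def
  proof (intro allI impI)
    fix c c' :: "'b \<Rightarrow> 'b set" assume "\<forall>x\<in>\<pi> ` V. c x = c' x"
    then show "f (c(\<pi> q := s)) = f (c'(\<pi> q := s))"
      by (intro local_onD[OF insert.prems(3)]) auto
  qed
  have "wsum (\<pi> ` insert q V) N' w' f =
      (\<Sum>s\<in>Pow (\<pi> ` N q). w' (\<pi> q) s * wsum (\<pi> ` V) N' w' (\<lambda>c. f (c(\<pi> q := s))))"
    using insert inj by (simp add: wsum_insert inj_image_mem_iff)
  also have "\<dots> = (\<Sum>s\<in>Pow (N q). w q s * wsum (\<pi> ` V) N' w' (\<lambda>c. f (c(\<pi> q := \<pi> ` s))))"
  proof -
    have "Pow (\<pi> ` N q) = (`) \<pi> ` Pow (N q)"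
      by (rule image_Pow_surj[OF refl, symmetric])
    moreover have "inj_on ((`) \<pi>) (Pow (N q))"
      using inj by (meson inj_image_eq_iff inj_onI)
    ultimately show ?thesis
      using insert.prems(2)[of q] by (simp add: sum.reindex)
  qed
  also have "\<dots> = (\<Sum>s\<in>Pow (N q). w q s *
      wsum V N w (\<lambda>c. f ((\<lambda>x. \<pi> ` c (inv \<pi> x))(\<pi> q := \<pi> ` s))))"
    by (subst insert.IH[OF insert.prems(1,2) loc]) simp_all
  finally show ?case
    by (simp only: wsum_insert[OF insert.hyps] upd)
qed

section \<open>Directed reachability with restricted tails\<close>

text \<open>Only the tails are restricted to \<open>U\<close>. A path may thus leave
  \<open>U\<close>, but only with its last step, which is how leaving a box is expressed.\<close>

definition arcs :: "'a set \<Rightarrow> ('a \<Rightarrow> 'a set) \<Rightarrow> ('a \<times> 'a) set" where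
  "arcs U c = {(x, y). x \<in> U \<and> y \<in> c x}"

definition hits :: "'a set \<Rightarrow> 'a set \<Rightarrow> ('a \<Rightarrow> 'a set) \<Rightarrow> 'a \<Rightarrow> bool" where
  "hits U T c a \<longleftrightarrow> (\<exists>t\<in>T. (a, t) \<in> (arcs U c)\<^sup>*)"

lemma arcs_mono: "U \<subseteq> U' \<Longrightarrow> arcs U c \<subseteq> arcs U' c"
  unfolding arcs_def by auto

lemma arcs_rtrancl_mono: "(a, b) \<in> (arcs U c)\<^sup>* \<Longrightarrow> U \<subseteq> U' \<Longrightarrow> (a, b) \<in> (arcs U' c)\<^sup>*"
  using rtrancl_mono[OF arcs_mono] by blast

lemma arcs_cong: "(\<And>q. q \<in> U \<Longrightarrow> c q = c' q) \<Longrightarrow> arcs U c = arcs U c'"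
  unfolding arcs_def by auto

lemma local_on_arcs: "local_on U (arcs U)"
  unfolding local_on_def using arcs_cong by metis

lemma local_on_reach: "local_on U (\<lambda>c. (a, b) \<in> (arcs U c)\<^sup>*)"
  by (rule local_on_comp[OF local_on_arcs])

lemma local_on_hits: "local_on U (\<lambda>c. hits U T c a)"
  unfolding hits_def by (rule local_on_comp[OF local_on_arcs])

lemma hits_mono: "hits U T c a \<Longrightarrow> U \<subseteq> U' \<Longrightarrow> T \<subseteq> T' \<Longrightarrow> hits U' T' c a"
  unfolding hits_def using arcs_rtrancl_mono by (metis subsetD)

lemma hits_refl: "a \<in> T \<Longrightarrow> hits U T c a"
  unfolding hits_def by blast

lemma hits_source:
  assumes "hits U T c a" shows "a \<in> U \<union> T"
proof -
  obtain t where "t \<in> T" "(a, t) \<in> (arcs U c)\<^sup>*" using assms by (auto simp: hits_def)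
  from this(2,1) show ?thesis by (cases rule: converse_rtranclE) (auto simp: arcs_def)
qed

lemma hits_step: "hits U T c y \<Longrightarrow> x \<in> U \<Longrightarrow> y \<in> c x \<Longrightarrow> hits U T c x"
  unfolding hits_def arcs_def by (auto intro: converse_rtrancl_into_rtrancl)

lemma hits_rtrancl: "(x, y) \<in> (arcs U c)\<^sup>* \<Longrightarrow> hits U T c y \<Longrightarrow> hits U T c x"
  unfolding hits_def by (meson rtrancl_trans)

lemma reach_last_exit:
  assumes "(a, b) \<in> (arcs U c)\<^sup>*"
  shows "(a, b) \<in> (arcs (U - Q) c)\<^sup>* \<or>
    (\<exists>q\<in>Q \<inter> U. \<exists>y\<in>c q. (a, q) \<in> (arcs U c)\<^sup>* \<and> (y, b) \<in> (arcs (U - Q) c)\<^sup>*)"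
  using assms
proof (induction rule: converse_rtrancl_induct)
  case base
  show ?case by simp
next
  case (step x y)
  then have xy: "x \<in> U" "y \<in> c x" by (auto simp: arcs_def)
  from step.IH show ?case
  proof
    assume y: "(y, b) \<in> (arcs (U - Q) c)\<^sup>*"
    show ?thesis
    proof (cases "x \<in> Q")
      case True
      then show ?thesis using xy y by blast
    next
      case False
      then have "(x, y) \<in> arcs (U - Q) c" using xy by (auto simp: arcs_def)
      then show ?thesis using y by (meson converse_rtrancl_into_rtrancl)
    qed
  next
    assume "\<exists>q\<in>Q \<inter> U. \<exists>z\<in>c q. (y, q) \<in> (arcs U c)\<^sup>* \<and> (z, b) \<in> (arcs (U - Q) c)\<^sup>*"
    then show ?thesis using step.hyps(1) by (meson converse_rtrancl_into_rtrancl)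
  qed
qed

lemma reach_first_entry:
  assumes "(a, b) \<in> (arcs U c)\<^sup>*"
  shows "(a, b) \<in> (arcs (U - Q) c)\<^sup>* \<or>
    (\<exists>q\<in>Q \<inter> U. (a, q) \<in> (arcs (U - Q) c)\<^sup>* \<and> (q, b) \<in> (arcs U c)\<^sup>*)"
  using assms
proof (induction rule: rtrancl_induct)
  case base
  show ?case by simp
next
  case (step x y)
  show ?case
  proof (cases "x \<in> Q")
    case True
    then show ?thesis using step by (auto simp: arcs_def intro: rtrancl.rtrancl_into_rtrancl)
  next
    case False
    then have "(x, y) \<in> arcs (U - Q) c" using step by (auto simp: arcs_def)
    then show ?thesis using step by (meson rtrancl.rtrancl_into_rtrancl)
  qed
qed

text \<open>A path stopped at its first visit to \<open>q\<close> uses no arc out of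
  \<open>q\<close>; so reaching \<open>q\<close> does not depend on the choice at
  \<open>q\<close>.\<close>

lemma reach_to_source: "(a, q) \<in> (arcs U c)\<^sup>* \<longleftrightarrow> (a, q) \<in> (arcs (U - {q}) c)\<^sup>*"
  using reach_first_entry[of a q U c "{q}"] arcs_rtrancl_mono[of a q "U - {q}" c U] by auto

text \<open>Cut a path after its last departure from \<open>q\<close> and stop the first piece at
  its first arrival there. The choice at \<open>q\<close> then matters only through whether it meets
  a set determined by the other vertices, which is why avoidance probabilities are all that
  counts.\<close>

lemma hits_iff_vertex:
  assumes "q \<in> U"
  shows "hits U T c a \<longleftrightarrow> hits (U - {q}) T c a \<or>
    (a, q) \<in> (arcs (U - {q}) c)\<^sup>* \<and> (\<exists>y\<in>c q. hits (U - {q}) T c y)"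
proof
  assume "hits U T c a"
  then obtain t where t: "t \<in> T" "(a, t) \<in> (arcs U c)\<^sup>*" by (auto simp: hits_def)
  from reach_last_exit[OF t(2), of "{q}"] show "hits (U - {q}) T c a \<or>
    (a, q) \<in> (arcs (U - {q}) c)\<^sup>* \<and> (\<exists>y\<in>c q. hits (U - {q}) T c y)"
    using t(1) reach_to_source by (fastforce simp: hits_def)
next
  assume "hits (U - {q}) T c a \<or>
    (a, q) \<in> (arcs (U - {q}) c)\<^sup>* \<and> (\<exists>y\<in>c q. hits (U - {q}) T c y)"
  then show "hits U T c a"
    by (metis Diff_subset arcs_rtrancl_mono assms hits_mono hits_rtrancl hits_step subset_refl)
qed

lemma sum_hits_vertex:
  assumes "q \<in> U" "finite (N q)"
  shows "(\<Sum>s\<in>Pow (N q). u s * of_bool (hits U T (c(q := s)) a)) =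
    of_bool (hits (U - {q}) T c a) * (\<Sum>s\<in>Pow (N q). u s) +
    of_bool (\<not> hits (U - {q}) T c a \<and> (a, q) \<in> (arcs (U - {q}) c)\<^sup>*) *
      (\<Sum>s | s \<subseteq> N q \<and> s \<inter> {y. hits (U - {q}) T c y} \<noteq> {}. (u s :: real))"
proof -
  have eq: "arcs (U - {q}) (c(q := s)) = arcs (U - {q}) c" for s
    by (rule arcs_cong) auto
  have eqh: "hits (U - {q}) T (c(q := s)) x = hits (U - {q}) T c x" for s x
    unfolding hits_def eq ..
  have h: "hits U T (c(q := s)) a \<longleftrightarrow> hits (U - {q}) T c a \<or>
    (a, q) \<in> (arcs (U - {q}) c)\<^sup>* \<and> s \<inter> {y. hits (U - {q}) T c y} \<noteq> {}" for s
    using hits_iff_vertex[OF assms(1), of T "c(q := s)" a] unfolding eq eqh by auto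
  have "(\<Sum>s | s \<subseteq> N q \<and> s \<inter> {y. hits (U - {q}) T c y} \<noteq> {}. u s) =
     (\<Sum>s\<in>Pow (N q). u s * of_bool (s \<inter> {y. hits (U - {q}) T c y} \<noteq> {}))"
    by (rule sum.mono_neutral_cong_left) (use assms in auto)
  then show ?thesis
    by (cases "hits (U - {q}) T c a") (auto simp: h)
qed

subsection \<open>One-vertex comparisons and pivotality\<close>

lemma of_bool_mono: "(P \<Longrightarrow> Q) \<Longrightarrow> of_bool P \<le> (of_bool Q :: real)"
  by auto

lemma wsum_remove':
  assumes "finite V" "q \<in> V"
  shows "wsum V N w f = wsum (V - {q}) N w (\<lambda>c. \<Sum>s\<in>Pow (N q). w q s * f (c(q := s)))"
  by (simp add: wsum_remove[OF assms] wsum_sum wsum_cmult)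

lemma wsum_hits_mono_vertex:
  assumes "finite V" "q \<in> V" "finite (N q)"
    and nn: "\<And>r s. r \<in> V \<Longrightarrow> s \<subseteq> N r \<Longrightarrow> 0 \<le> w r s"
    and eq: "\<And>r s. r \<in> V - {q} \<Longrightarrow> w' r s = w r s"
    and tot: "(\<Sum>s\<in>Pow (N q). w q s) = (\<Sum>s\<in>Pow (N q). w' q s)"
    and le: "\<And>A. A \<subseteq> U \<union> T \<Longrightarrow> (\<Sum>s | s \<subseteq> N q \<and> s \<inter> A \<noteq> {}. w q s) \<le> (\<Sum>s | s \<subseteq> N q \<and> s \<inter> A \<noteq> {}. w' q s)"
  shows "wsum V N w (\<lambda>c. of_bool (hits U T c a)) \<le> wsum V N w' (\<lambda>c. of_bool (hits U T c a))"
proof -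
  have "(\<Sum>s\<in>Pow (N q). w q s * of_bool (hits U T (c(q := s)) a)) \<le>
        (\<Sum>s\<in>Pow (N q). w' q s * of_bool (hits U T (c(q := s)) a))" for c
  proof (cases "q \<in> U")
    case True
    show ?thesis
      unfolding sum_hits_vertex[where N = N and q = q, OF True assms(3)] tot
      by (intro add_mono mult_left_mono le subsetI) (auto dest: hits_source)
  next
    case False
    then have "hits U T (c(q := s)) a = hits U T c a" for s
      by (intro local_onD[OF local_on_hits]) auto
    then show ?thesis by (simp add: tot flip: sum_distrib_right)
  qed
  then have "wsum V N w (\<lambda>c. of_bool (hits U T c a)) \<le>
      wsum (V - {q}) N w (\<lambda>c. \<Sum>s\<in>Pow (N q). w' q s * of_bool (hits U T (c(q := s)) a))"
    unfolding wsum_remove'[OF assms(1,2)] by (intro wsum_mono nn) auto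
  also have "\<dots> = wsum V N w' (\<lambda>c. of_bool (hits U T c a))"
    unfolding wsum_remove'[OF assms(1,2)] by (rule wsum_cong_weight) (simp add: eq)
  finally show ?thesis .
qed

text \<open>The law is exchanged at one vertex after the other. Equal totals are required instead of
  total 1 because \<open>wsum_closed_hits\<close> compares weights that are restricted to closed
  edges and not normalised.\<close>

lemma wsum_hits_mono:
  assumes "finite V" "\<And>q. q \<in> V \<Longrightarrow> finite (N q)"
    and nn: "\<And>q s. q \<in> V \<Longrightarrow> s \<subseteq> N q \<Longrightarrow> 0 \<le> w q s" "\<And>q s. q \<in> V \<Longrightarrow> s \<subseteq> N q \<Longrightarrow> 0 \<le> w' q s"
    and tot: "\<And>q. q \<in> V \<Longrightarrow> (\<Sum>s\<in>Pow (N q). w q s) = (\<Sum>s\<in>Pow (N q). w' q s)"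
    and le: "\<And>q A. q \<in> V \<Longrightarrow> A \<subseteq> U \<union> T \<Longrightarrow>
      (\<Sum>s | s \<subseteq> N q \<and> s \<inter> A \<noteq> {}. w q s) \<le> (\<Sum>s | s \<subseteq> N q \<and> s \<inter> A \<noteq> {}. w' q s)"
  shows "wsum V N w (\<lambda>c. of_bool (hits U T c a)) \<le> wsum V N w' (\<lambda>c. of_bool (hits U T c a))"
proof -
  \<comment> \<open>The hybrid law: vertices in \<open>P\<close> already carry the new
    weights.\<close>
  let ?h = "\<lambda>P q. if q \<in> P then w' q else w q"
  have "wsum V N w (\<lambda>c. of_bool (hits U T c a)) \<le> wsum V N (?h P) (\<lambda>c. of_bool (hits U T c a))"
    if "finite P" "P \<subseteq> V" for P
    using that
  proof (induction P rule: finite_induct)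
    case empty
    then show ?case by simp
  next
    case (insert q P)
    have "wsum V N (?h P) (\<lambda>c. of_bool (hits U T c a)) \<le>
        wsum V N (?h (insert q P)) (\<lambda>c. of_bool (hits U T c a))"
      by (rule wsum_hits_mono_vertex[where q = q])
         (use insert.hyps insert.prems assms(1,2) nn tot le in auto)
    with insert show ?case by auto
  qed
  from this[of V] have "wsum V N w (\<lambda>c. of_bool (hits U T c a)) \<le>
      wsum V N (?h V) (\<lambda>c. of_bool (hits U T c a))"
    using assms(1) by simp
  also have "\<dots> = wsum V N w' (\<lambda>c. of_bool (hits U T c a))"
    by (rule wsum_cong_weight) simp
  finally show ?thesis .
qed

section \<open>Derivatives in the weights and pivotal vertices\<close>

text \<open>The product rule: each summand replaces the weight of one vertex by its derivative, a
  signed weight.\<close>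

lemma wsum_has_derivative:
  assumes "finite V"
    and "\<And>q s. ((\<lambda>\<tau>. w \<tau> q s) has_real_derivative u q s) (at t)"
  shows "((\<lambda>\<tau>. wsum V N (w \<tau>) f) has_real_derivative
    (\<Sum>q\<in>V. wsum V N ((w t)(q := u q)) f)) (at t)"
  using assms(1)
proof (induction V arbitrary: f rule: finite_induct)
  case empty
  then show ?case by simp
next
  case (insert q V)
  let ?f = "\<lambda>s c. f (c(q := s))"
  let ?d = "\<lambda>V q f. wsum V N ((w t)(q := u q)) f"
  have eq: "?d V q g = wsum V N (w t) g" for g
    by (rule wsum_cong_weight) (use insert.hyps in auto)
  have ne: "?d (insert q V) r f = (\<Sum>s\<in>Pow (N q). w t q s * ?d V r (?f s))" if "r \<in> V" for r
    using that insert.hyps by (auto simp: wsum_insert)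
  have "((\<lambda>\<tau>. \<Sum>s\<in>Pow (N q). w \<tau> q s * wsum V N (w \<tau>) (?f s)) has_real_derivative
    (\<Sum>s\<in>Pow (N q). u q s * wsum V N (w t) (?f s) + (\<Sum>r\<in>V. ?d V r (?f s)) * w t q s)) (at t)"
    by (intro DERIV_sum DERIV_mult assms insert.IH)
  also have "(\<Sum>s\<in>Pow (N q). u q s * wsum V N (w t) (?f s) + (\<Sum>r\<in>V. ?d V r (?f s)) * w t q s) =
      (\<Sum>s\<in>Pow (N q). u q s * ?d V q (?f s)) +
      (\<Sum>r\<in>V. \<Sum>s\<in>Pow (N q). w t q s * ?d V r (?f s))"
    unfolding sum.distrib eq sum_distrib_right by (subst sum.swap) (simp add: mult.commute)
  also have "\<dots> = (\<Sum>r\<in>insert q V. ?d (insert q V) r f)"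
    using insert.hyps ne by (simp add: wsum_insert)
  finally have "((\<lambda>\<tau>. \<Sum>s\<in>Pow (N q). w \<tau> q s * wsum V N (w \<tau>) (?f s)) has_real_derivative
      (\<Sum>r\<in>insert q V. ?d (insert q V) r f)) (at t)" .
  then show ?case
    by (subst wsum_insert[OF insert.hyps])
qed

text \<open>This does not ask whether \<open>q\<close> has a neighbour from which the target is
  reached. Together with the separate condition that its neighbourhood meets \<open>exits\<close> it
  is pivotality in the usual sense. Neither condition depends on the choice at
  \<open>q\<close>.\<close>

definition piv :: "'a set \<Rightarrow> 'a set \<Rightarrow> 'a \<Rightarrow> 'a \<Rightarrow> ('a \<Rightarrow> 'a set) \<Rightarrow> bool" where
  "piv U T a q c \<longleftrightarrow> \<not> hits (U - {q}) T c a \<and> (a, q) \<in> (arcs (U - {q}) c)\<^sup>*"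

definition exits :: "'a set \<Rightarrow> 'a set \<Rightarrow> 'a \<Rightarrow> ('a \<Rightarrow> 'a set) \<Rightarrow> 'a set" where
  "exits U T q c = {y. hits (U - {q}) T c y}"

lemma local_on_piv: "local_on (U - {q}) (piv U T a q)"
proof -
  have "local_on (U - {q}) (\<lambda>c. \<not> hits (U - {q}) T c a \<and> (a, q) \<in> (arcs (U - {q}) c)\<^sup>*)"
    by (rule local_on_comp2[where g = "\<lambda>x y. \<not> x \<and> y", OF local_on_hits local_on_reach])
  then show ?thesis unfolding piv_def[abs_def] .
qed

lemma local_on_exits: "local_on (U - {q}) (exits U T q)"
  unfolding exits_def[abs_def] hits_def by (rule local_on_comp[OF local_on_arcs])

text \<open>Summing over the choice at \<open>q\<close> first, the configurations that reach the
  target without \<open>q\<close> cancel because \<open>u\<close> has total 0. If \<open>q\<close>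
  is needed, the remaining mass is that of the choices meeting a useful neighbour.\<close>

lemma wsum_hits_signed_vertex:
  assumes "finite V" "q \<in> V" "finite (N q)" "(\<Sum>s\<in>Pow (N q). u s) = 0"
    and tot: "\<And>q. q \<in> V \<Longrightarrow> (\<Sum>s\<in>Pow (N q). w q s) = 1"
  shows "wsum V N (w(q := u)) (\<lambda>c. of_bool (hits V T c a)) =
    wsum V N w (\<lambda>c. of_bool (piv V T a q c) * (\<Sum>s | s \<subseteq> N q \<and> s \<inter> exits V T q c \<noteq> {}. u s))"
proof -
  let ?g = "\<lambda>c. of_bool (piv V T a q c) * (\<Sum>s | s \<subseteq> N q \<and> s \<inter> exits V T q c \<noteq> {}. u s)"
  have "wsum V N (w(q := u)) (\<lambda>c. of_bool (hits V T c a)) = wsum (V - {q}) N (w(q := u)) ?g"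
    unfolding wsum_remove'[OF assms(1,2)]
    by (simp add: sum_hits_vertex[where N = N and q = q, OF assms(2,3)] piv_def exits_def assms(4)
        del: sum_mult_of_bool_eq sum_of_bool_mult_eq)
  also have "\<dots> = wsum (V - {q}) N w ?g"
    by (rule wsum_cong_weight) auto
  also have "\<dots> = wsum V N w ?g"
  proof (rule wsum_marginal[symmetric])
    show "local_on (V - {q}) ?g"
      by (rule local_on_comp2[where g = "\<lambda>P A. of_bool P * (\<Sum>s | s \<subseteq> N q \<and> s \<inter> A \<noteq> {}. u s)",
            OF local_on_piv local_on_exits])
  qed (use assms in auto)
  finally show ?thesis .
qed

section \<open>Finite energy\<close>

text \<open>If some choice at \<open>q\<close> produces \<open>E\<close>, then given all other
  choices \<open>E\<close> has conditional probability at least \<open>\<mu>\<close>.\<close>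

lemma wsum_resample_vertex:
  assumes "finite V" "q \<in> V" "finite (N q)" "0 < \<mu>"
    and w: "\<And>q s. q \<in> V \<Longrightarrow> s \<subseteq> N q \<Longrightarrow> \<mu> \<le> w q s"
    and tot: "(\<Sum>s\<in>Pow (N q). w q s) = 1"
  shows "wsum V N w (\<lambda>c. of_bool (\<exists>s\<subseteq>N q. E (c(q := s)))) \<le> 1 / \<mu> * wsum V N w (\<lambda>c. of_bool (E c))"
proof -
  have nn: "0 \<le> w r s" if "r \<in> V" "s \<subseteq> N r" for r s
    using w[OF that] assms(4) by linarith
  have "of_bool (\<exists>s\<subseteq>N q. E (c(q := s))) \<le> 1 / \<mu> * (\<Sum>s\<in>Pow (N q). w q s * of_bool (E (c(q := s))))" for c
  proof (cases "\<exists>s\<subseteq>N q. E (c(q := s))")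
    case True
    then obtain s where s: "s \<subseteq> N q" "E (c(q := s))" by blast
    have "\<mu> \<le> w q s * of_bool (E (c(q := s)))" using w[OF assms(2) s(1)] s by simp
    also have "\<dots> \<le> (\<Sum>s\<in>Pow (N q). w q s * of_bool (E (c(q := s))))"
      using s assms(2,3) nn by (intro member_le_sum) auto
    finally show ?thesis using True assms(4) by (simp add: field_simps)
  next
    case False
    have "0 \<le> (\<Sum>s\<in>Pow (N q). w q s * of_bool (E (c(q := s))))"
      using nn assms(2) by (intro sum_nonneg) auto
    then show ?thesis using False assms(4) by simp
  qed
  then have "wsum (V - {q}) N w (\<lambda>c. of_bool (\<exists>s\<subseteq>N q. E (c(q := s)))) \<le>
    wsum (V - {q}) N w (\<lambda>c. 1 / \<mu> * (\<Sum>s\<in>Pow (N q). w q s * of_bool (E (c(q := s)))))"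
    by (intro wsum_mono nn) auto
  moreover have "wsum V N w (\<lambda>c. of_bool (\<exists>s\<subseteq>N q. E (c(q := s)))) =
      wsum (V - {q}) N w (\<lambda>c. of_bool (\<exists>s\<subseteq>N q. E (c(q := s))))"
    unfolding wsum_remove'[OF assms(1,2)] by (simp add: tot flip: sum_distrib_right)
  ultimately show ?thesis
    unfolding wsum_cmult by (simp add: wsum_remove'[OF assms(1,2)])
qed

text \<open>Each vertex that may be altered costs a factor \<open>1 / \<mu>\<close>. In the
  induction the freedom at the new vertex is absorbed into the event \<open>E1\<close>.\<close>

lemma wsum_resample:
  assumes "finite V" "\<And>q. q \<in> V \<Longrightarrow> finite (N q)" "0 < \<mu>"
    and w: "\<And>q s. q \<in> V \<Longrightarrow> s \<subseteq> N q \<Longrightarrow> \<mu> \<le> w q s"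
    and tot: "\<And>q. q \<in> V \<Longrightarrow> (\<Sum>s\<in>Pow (N q). w q s) = 1"
    and Q: "finite Q" "Q \<subseteq> V"
  shows "wsum V N w (\<lambda>c. of_bool (\<exists>c'. (\<forall>x. x \<notin> Q \<longrightarrow> c' x = c x) \<and> (\<forall>x\<in>Q. c' x \<subseteq> N x) \<and> E c'))
    \<le> (1 / \<mu>) ^ card Q * wsum V N w (\<lambda>c. of_bool (E c))"
  using Q
proof (induction Q arbitrary: E rule: finite_induct)
  case empty
  have "(\<forall>x. x \<notin> {} \<longrightarrow> c' x = c x) \<longleftrightarrow> c' = c" for c c' :: "'a \<Rightarrow> 'a set"
    by (simp add: fun_eq_iff)
  then show ?case by (simp only:) simp
next
  case (insert q Q)
  have nn: "0 \<le> w r s" if "r \<in> V" "s \<subseteq> N r" for r s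
    using w[OF that] assms(3) by linarith
  define E1 where "E1 c = (\<exists>s\<subseteq>N q. E (c(q := s)))" for c
  have "wsum V N w (\<lambda>c. of_bool (\<exists>c'. (\<forall>x. x \<notin> insert q Q \<longrightarrow> c' x = c x) \<and>
      (\<forall>x\<in>insert q Q. c' x \<subseteq> N x) \<and> E c')) \<le>
    wsum V N w (\<lambda>c. of_bool (\<exists>c'. (\<forall>x. x \<notin> Q \<longrightarrow> c' x = c x) \<and> (\<forall>x\<in>Q. c' x \<subseteq> N x) \<and> E1 c'))"
  proof (intro wsum_mono nn)
    fix c
    have "\<exists>c''. (\<forall>x. x \<notin> Q \<longrightarrow> c'' x = c x) \<and> (\<forall>x\<in>Q. c'' x \<subseteq> N x) \<and> E1 c''"
      if c': "\<forall>x. x \<notin> insert q Q \<longrightarrow> c' x = c x" "\<forall>x\<in>insert q Q. c' x \<subseteq> N x" "E c'" for c'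
    proof (intro exI conjI)
      show "\<forall>x. x \<notin> Q \<longrightarrow> (c'(q := c q)) x = c x" "\<forall>x\<in>Q. (c'(q := c q)) x \<subseteq> N x"
        using c' insert.hyps(2) by auto
      have "(c'(q := c q))(q := c' q) = c'" by simp
      then show "E1 (c'(q := c q))"
        unfolding E1_def using c' by (intro exI[of _ "c' q"]) simp
    qed
    then show "of_bool (\<exists>c'. (\<forall>x. x \<notin> insert q Q \<longrightarrow> c' x = c x) \<and>
        (\<forall>x\<in>insert q Q. c' x \<subseteq> N x) \<and> E c') \<le> (of_bool (\<exists>c'. (\<forall>x. x \<notin> Q \<longrightarrow> c' x = c x) \<and>
        (\<forall>x\<in>Q. c' x \<subseteq> N x) \<and> E1 c') :: real)"
      by (intro of_bool_mono) blast
  qed auto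
  also have "\<dots> \<le> (1 / \<mu>) ^ card Q * wsum V N w (\<lambda>c. of_bool (E1 c))"
    using insert.prems by (intro insert.IH) auto
  also have "\<dots> \<le> (1 / \<mu>) ^ card Q * (1 / \<mu> * wsum V N w (\<lambda>c. of_bool (E c)))"
    unfolding E1_def using insert.prems assms
    by (intro mult_left_mono wsum_resample_vertex) auto
  finally show ?case
    using insert.hyps by (simp add: mult.assoc mult.left_commute)
qed

subsection \<open>Rewiring a block\<close>

definition nb :: "int \<times> int \<Rightarrow> (int \<times> int) set" where
  "nb x = {(fst x + 1, snd x), (fst x - 1, snd x), (fst x, snd x + 1), (fst x, snd x - 1)}"

text \<open>Pairs 2k with 2k + 1, so that the sets \<open>block x\<close> tile the lattice by 2x2
  squares.\<close>

definition flip :: "int \<Rightarrow> int" where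
  "flip a = (if even a then a + 1 else a - 1)"

definition block :: "int \<times> int \<Rightarrow> (int \<times> int) set" where
  "block x = {fst x, flip (fst x)} \<times> {snd x, flip (snd x)}"

text \<open>The vertices that the surgery may rewire. It contains all neighbours of the block, so a
  path that avoids tails in it cannot step into the block.\<close>

definition hood :: "int \<times> int \<Rightarrow> (int \<times> int) set" where
  "hood q = block q \<union> (\<Union>x\<in>block q. nb x)"

lemma finite_nb [simp]: "finite (nb x)"
  by (simp add: nb_def)

lemma card_nb [simp]: "card (nb x) = 4"
  by (simp add: nb_def)

lemma nb_sym: "y \<in> nb x \<longleftrightarrow> x \<in> nb y"
  by (cases x; cases y) (auto simp: nb_def)

lemma nb_irrefl: "x \<notin> nb x"
  by (cases x) (auto simp: nb_def)

lemma self_in_block [simp]: "x \<in> block x"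
  by (cases x) (simp add: block_def)

lemma finite_hood [simp]: "finite (hood q)"
  by (auto simp: hood_def block_def)

lemma flip_flip [simp]: "flip (flip a) = a"
  by (simp add: flip_def)

lemma flip_cases: "flip a = a + 1 \<or> flip a = a - 1"
  by (simp add: flip_def)

lemma flip_neq [simp]: "flip a \<noteq> a" "a \<noteq> flip a"
  using flip_cases[of a] by auto

lemma block_eq:
  assumes "y \<in> block x" shows "block y = block x"
proof -
  have "fst y = fst x \<or> fst y = flip (fst x)" "snd y = snd x \<or> snd y = flip (snd x)"
    using assms by (auto simp: block_def)
  then have "{fst y, flip (fst y)} = {fst x, flip (fst x)}" "{snd y, flip (snd y)} = {snd x, flip (snd x)}"
    by auto
  then show ?thesis by (simp add: block_def)
qed

lemma block_unfold:
  assumes "(a, b) \<in> block q"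
  shows "block q = {(a, b), (a, flip b), (flip a, b), (flip a, flip b)}"
  using block_eq[OF assms] by (auto simp: block_def)

lemma nb_flip:
  "(flip a, b) \<in> nb (a, b)" "(a, flip b) \<in> nb (a, b)" "(a, b) \<in> nb (flip a, b)" "(a, b) \<in> nb (a, flip b)"
  using flip_cases[of a] flip_cases[of b] by (auto simp: nb_def)

lemma block_two_neighbours:
  assumes "s \<in> block q"
  shows "\<exists>r1 r2. r1 \<noteq> r2 \<and> {r1, r2} \<subseteq> nb s \<inter> block q - {s}"
proof -
  obtain a b where s: "s = (a, b)" by (cases s)
  note B = block_unfold[OF assms[unfolded s]]
  have "{(flip a, b), (a, flip b)} \<subseteq> nb s \<inter> block q - {s}"
    unfolding B s using nb_flip[of a b] by simp
  moreover have "(flip a, b) \<noteq> (a, flip b)" by simp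
  ultimately show ?thesis by (intro exI conjI)
qed

lemma block_minus_connected:
  assumes "s \<in> block q" "i \<in> block q - {s}" "r \<in> block q - {s}"
  shows "r = i \<or> i \<in> nb r \<or> (\<exists>m\<in>block q - {s}. m \<in> nb r \<and> i \<in> nb m)"
proof -
  obtain a b where s: "s = (a, b)" by (cases s)
  define m where "m = (flip a, flip b)"
  have B: "block q - {s} = {(a, flip b), (flip a, b), m}"
    unfolding block_unfold[OF assms(1)[unfolded s]] s m_def by auto
  have *: "m \<in> block q - {s}" "m \<in> nb (a, flip b)" "m \<in> nb (flip a, b)"
    "(flip a, b) \<in> nb m" "(a, flip b) \<in> nb m"
    unfolding B m_def using nb_flip[of a "flip b"] nb_flip[of "flip a" b] by simp_all
  have "i = (a, flip b) \<or> i = (flip a, b) \<or> i = m" "r = (a, flip b) \<or> r = (flip a, b) \<or> r = m"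
    using assms(2,3) unfolding B by simp_all
  then show ?thesis by (elim disjE; simp only: *; use * in fast)
qed

text \<open>The points \<open>i\<close>, \<open>v\<close>, \<open>v2\<close>, \<open>c2\<close> are
  the corners of a unit square attached to a side of the block. It gives a second way from the block
  to \<open>v\<close> that does not pass through \<open>i\<close>.\<close>

lemma block_side:
  assumes "i \<in> block q" "v \<in> nb i" "v \<notin> block q"
  shows "\<exists>c2 v2. c2 \<in> block q \<and> c2 \<noteq> i \<and> c2 \<in> nb i \<and> v2 \<notin> block q \<and> v2 \<in> nb c2 \<and> v \<in> nb v2"
proof -
  obtain a b where i: "i = (a, b)" by (cases i)
  have B: "block q = {(a, b), (a, flip b), (flip a, b), (flip a, flip b)}"
    by (rule block_unfold[OF assms(1)[unfolded i]])
  \<comment> \<open>The reflections of \<open>flip a\<close> at \<open>a\<close> and of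
    \<open>flip b\<close> at \<open>b\<close>: the directions pointing out of the block.\<close>
  define h where "h = 2 * a - flip a"
  define k where "k = 2 * b - flip b"
  have out: "h \<noteq> a" "h \<noteq> flip a" "k \<noteq> b" "k \<noteq> flip b"
    using flip_cases[of a] flip_cases[of b] unfolding h_def k_def by linarith+
  have nh: "(h, y) \<in> nb (a, y)" for y
    using flip_cases[of a] by (auto simp: nb_def h_def)
  have nk: "(y, k) \<in> nb (y, b)" for y
    using flip_cases[of b] by (auto simp: nb_def k_def)
  have "flip a = a + 1 \<and> h = a - 1 \<or> flip a = a - 1 \<and> h = a + 1"
    "flip b = b + 1 \<and> k = b - 1 \<or> flip b = b - 1 \<and> k = b + 1"
    using flip_cases[of a] flip_cases[of b] unfolding h_def k_def by linarith+
  moreover have "v = (a + 1, b) \<or> v = (a - 1, b) \<or> v = (a, b + 1) \<or> v = (a, b - 1)"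
    using assms(2) by (simp add: nb_def i)
  moreover have "v \<noteq> (flip a, b)" "v \<noteq> (a, flip b)"
    using assms(3) unfolding B by simp_all
  ultimately have "v = (h, b) \<or> v = (a, k)"
    by metis
  then show ?thesis
  proof
    assume v: "v = (h, b)"
    have "(h, flip b) \<notin> block q" unfolding B using out by simp
    moreover have "(a, flip b) \<in> block q" "(a, flip b) \<noteq> i" unfolding B i by simp_all
    ultimately show ?thesis
      using nh[of "flip b"] nb_flip[of a b] nb_flip[of h b] i v
      by (intro exI[of _ "(a, flip b)"] exI[of _ "(h, flip b)"]) simp
  next
    assume v: "v = (a, k)"
    have "(flip a, k) \<notin> block q" unfolding B using out by simp
    moreover have "(flip a, b) \<in> block q" "(flip a, b) \<noteq> i" unfolding B i by simp_all
    ultimately show ?thesis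
      using nk[of "flip a"] nb_flip[of a b] nb_flip[of a k] i v
      by (intro exI[of _ "(flip a, b)"] exI[of _ "(flip a, k)"]) simp
  qed
qed

text \<open>\<open>F\<close> is what \<open>a\<close> reaches before using an arc out of
  \<open>Q\<close>, so rewiring \<open>Q\<close> leaves it unchanged. Afterwards the vertices of
  \<open>F\<close> in \<open>Q\<close> lead at most to \<open>s\<close>; without the arcs of
  \<open>s\<close>, nothing beyond \<open>F\<close> and \<open>s\<close> is reached from
  \<open>a\<close>.\<close>

lemma piv_rewire:
  fixes c :: "'a \<Rightarrow> 'a set"
  assumes F: "F = {x. (a, x) \<in> (arcs (V - Q) c)\<^sup>*}"
    and off: "\<And>x. x \<notin> Q \<Longrightarrow> c' x = c x"
    and flow: "\<And>x. x \<in> F \<inter> Q \<Longrightarrow> x \<noteq> s \<Longrightarrow> c' x \<subseteq> {s}"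
    and u: "u \<in> F \<inter> Q" "u = s \<or> s \<in> c' u"
    and "F \<subseteq> V" "s \<in> V" "s \<in> Q"
  shows "piv V (- V) a s c'"
proof -
  have eq: "arcs (V - Q) c' = arcs (V - Q) c"
    by (rule arcs_cong) (simp add: off)
  have au: "(a, u) \<in> (arcs (V - {s}) c')\<^sup>*"
  proof (rule arcs_rtrancl_mono)
    show "(a, u) \<in> (arcs (V - Q) c')\<^sup>*" using u(1) unfolding eq F by simp
    show "V - Q \<subseteq> V - {s}" using \<open>s \<in> Q\<close> by blast
  qed
  have as: "(a, s) \<in> (arcs (V - {s}) c')\<^sup>*"
  proof (cases "u = s")
    case False
    then have "(u, s) \<in> arcs (V - {s}) c'"
      using u \<open>F \<subseteq> V\<close> by (auto simp: arcs_def)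
    with au show ?thesis by (rule rtrancl.rtrancl_into_rtrancl)
  qed (use au in simp)
  have inv: "x \<in> F \<union> {s}" if "(a, x) \<in> (arcs (V - {s}) c')\<^sup>*" for x
    using that
  proof (induction rule: rtrancl_induct)
    case base
    show ?case by (simp add: F)
  next
    case (step x y)
    then have xy: "x \<in> F" "x \<in> V" "x \<noteq> s" "y \<in> c' x" by (auto simp: arcs_def)
    show ?case
    proof (cases "x \<in> Q")
      case True
      then show ?thesis using flow[of x] xy by auto
    next
      case False
      then have "(x, y) \<in> arcs (V - Q) c" using xy off by (auto simp: arcs_def)
      then show ?thesis using xy(1) by (auto simp: F intro: rtrancl.rtrancl_into_rtrancl)
    qed
  qed
  have "\<not> hits (V - {s}) (- V) c' a"
    using inv \<open>F \<subseteq> V\<close> \<open>s \<in> V\<close> by (auto simp: hits_def)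
  with as show ?thesis by (simp add: piv_def)
qed

text \<open>Inside the hood the incoming path is led to a block vertex \<open>s\<close>, and an
  outgoing path from some \<open>v\<close> beside a block vertex \<open>i\<close> is kept. If the
  incoming path can be attached at some \<open>s\<close> other than \<open>i\<close>, the three
  remaining block vertices are wired together and to \<open>v\<close> through \<open>i\<close>, so
  both block neighbours of \<open>s\<close> are useful. Otherwise \<open>s = i\<close>, whose useful
  neighbours are \<open>v\<close> and, around the square of \<open>block_side\<close>,
  \<open>c2\<close>.\<close>

lemma corner_surgery:
  fixes V :: "(int \<times> int) set" and c :: "int \<times> int \<Rightarrow> (int \<times> int) set"
  assumes V: "\<And>x. x \<in> V \<Longrightarrow> block x \<subseteq> V" "q \<in> V"
    and c: "\<And>x. x \<in> V \<Longrightarrow> c x \<subseteq> nb x"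
    and piv: "piv V (- V) a q c"
    and ex: "nb q \<inter> exits V (- V) q c \<noteq> {}"
  obtains c' s where "\<And>x. x \<notin> hood q \<inter> V \<Longrightarrow> c' x = c x" "\<And>x. x \<in> hood q \<inter> V \<Longrightarrow> c' x \<subseteq> nb x"
    "s \<in> block q" "piv V (- V) a s c'" "2 \<le> card (nb s \<inter> exits V (- V) s c')"
proof -
  note result = that
  define I where "I = block q"
  define Q where "Q = hood q"
  define F where "F = {x. (a, x) \<in> (arcs (V - Q) c)\<^sup>*}"
  have I: "I \<subseteq> V" "I \<subseteq> Q" "q \<in> I"
    using V(1)[OF V(2)] unfolding I_def Q_def hood_def by simp_all
  have nbI: "nb x \<subseteq> Q" if "x \<in> I" for x using that unfolding I_def Q_def hood_def by blast
  have qQ: "q \<in> Q" using I(2,3) by blast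
  have mono: "(x, y) \<in> (arcs (V - {q}) c)\<^sup>*" if "(x, y) \<in> (arcs (V - Q) c)\<^sup>*" for x y
    using that by (rule arcs_rtrancl_mono) (use qQ in blast)
  have FV: "F \<subseteq> V"
  proof
    fix x assume "x \<in> F"
    then have "(a, x) \<in> (arcs (V - {q}) c)\<^sup>*"
      using mono[of a x] by (simp add: F_def)
    then show "x \<in> V" using piv unfolding piv_def hits_def by fast
  qed
  \<comment> \<open>A path without tails in \<open>Q\<close> can be at a block vertex only if it
    starts there. Then \<open>a\<close> itself lies in \<open>Q\<close> and reaches nothing
    else.\<close>
  have FI: "F = {a}" if x: "x \<in> F" "x \<in> I" for x
  proof -
    have "x = a"
    proof (rule ccontr)
      assume "x \<noteq> a"
      moreover have "(a, x) \<in> (arcs (V - Q) c)\<^sup>*" using x(1) by (simp add: F_def)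
      ultimately obtain z where "(z, x) \<in> arcs (V - Q) c"
        by (metis rtranclE)
      then have "z \<in> V - Q" "x \<in> c z" by (simp_all add: arcs_def)
      then have "z \<in> V - Q" "x \<in> nb z" using c[of z] by blast+
      then show False using nbI[OF x(2)] nb_sym by blast
    qed
    then have aQ: "a \<in> Q" using x I by blast
    have "y = a" if "(a, y) \<in> (arcs (V - Q) c)\<^sup>*" for y
      using that by (cases rule: converse_rtranclE) (use aQ in \<open>auto simp: arcs_def\<close>)
    then show ?thesis by (auto simp: F_def)
  qed
  have "V - {q} - Q = V - Q" using qQ by blast
  moreover have "(a, q) \<in> (arcs (V - {q}) c)\<^sup>*" using piv by (simp add: piv_def)
  ultimately have "\<exists>u\<in>Q. u \<in> F"
    using reach_first_entry[of a q "V - {q}" c Q] qQ by (auto simp: F_def)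
  then obtain u0 where u0: "u0 \<in> Q" "u0 \<in> F" by blast
  \<comment> \<open>The start of the outgoing path: a vertex outside \<open>V\<close>, or the last
    vertex of \<open>Q\<close> on a path from a useful neighbour of \<open>q\<close> to the
    complement. In the second case it is not in the block, since its successor leaves
    \<open>Q\<close>, and not in \<open>F\<close>, since otherwise \<open>a\<close> would escape
    without \<open>q\<close>.\<close>
  have "\<exists>v. v \<in> Q - I \<and> v \<notin> F \<and> (v \<in> V \<longrightarrow> (\<exists>v'\<in>nb v. hits (V - Q) (- V) c v'))"
  proof (cases "Q \<subseteq> V")
    case False
    then show ?thesis using I FV by blast
  next
    case True
    from ex obtain y t where y: "y \<in> nb q" "t \<notin> V" "(y, t) \<in> (arcs (V - {q}) c)\<^sup>*"
      unfolding exits_def hits_def by blast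
    have "y \<in> Q" using y(1) nbI[OF I(3)] by blast
    have stay: "x \<in> V - Q \<or> x = t" if "(x, t) \<in> (arcs (V - {q} - Q) c)\<^sup>*" for x
      using that by (cases rule: converse_rtranclE) (auto simp: arcs_def)
    have "(y, t) \<notin> (arcs (V - {q} - Q) c)\<^sup>*"
      using stay[of y] \<open>y \<in> Q\<close> True y(2) by blast
    with reach_last_exit[OF y(3), of Q] obtain v v' where v: "v \<in> Q" "v \<in> V - {q}" "v' \<in> c v"
      "(v', t) \<in> (arcs (V - {q} - Q) c)\<^sup>*" by blast
    have v't: "(v', t) \<in> (arcs (V - Q) c)\<^sup>*"
      using v(4) by (rule arcs_rtrancl_mono) auto
    have "v' \<notin> Q" using stay[OF v(4)] True y(2) by blast
    moreover have "v' \<in> nb v" using c[of v] v(2,3) by blast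
    ultimately have "v \<notin> I" using nbI[of v] by blast
    have "v \<notin> F"
    proof
      assume "v \<in> F"
      then have "(a, v) \<in> (arcs (V - {q}) c)\<^sup>*"
        using mono[of a v] by (simp add: F_def)
      moreover have "(v, v') \<in> arcs (V - {q}) c" using v by (simp add: arcs_def)
      moreover have "(v', t) \<in> (arcs (V - {q}) c)\<^sup>*"
        using v't by (rule mono)
      ultimately have "(a, t) \<in> (arcs (V - {q}) c)\<^sup>*" by (meson rtrancl.rtrancl_into_rtrancl rtrancl_trans)
      then show False using piv y(2) unfolding piv_def hits_def by fast
    qed
    then show ?thesis
      using v \<open>v \<notin> I\<close> \<open>v' \<in> nb v\<close> v't y(2) unfolding hits_def by fast
  qed
  then obtain v v' where v: "v \<in> Q" "v \<notin> I" "v \<notin> F"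
    and v': "v \<in> V \<Longrightarrow> v' \<in> nb v \<and> hits (V - Q) (- V) c v'" by blast
  obtain i where i: "i \<in> I" "v \<in> nb i"
    using v unfolding Q_def I_def hood_def by blast
  define att where "att x s \<longleftrightarrow> s \<in> I \<and> (x = s \<or> x \<notin> I \<and> s \<in> nb x)" for x s
  have att_ex: "\<exists>s. att x s" if xQ: "x \<in> Q" for x
  proof (cases "x \<in> I")
    case False
    then obtain s where "s \<in> I" "x \<in> nb s" using xQ unfolding Q_def I_def hood_def by blast
    then show ?thesis using False nb_sym[of s x] unfolding att_def by blast
  next
    case True
    then show ?thesis by (intro exI[of _ x]) (simp add: att_def)
  qed
  have finish: thesis
    if c': "\<And>x. x \<in> Q \<inter> V \<Longrightarrow> c' x \<subseteq> nb x" "\<And>x. x \<notin> Q \<inter> V \<Longrightarrow> c' x = c x"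
      and "s \<in> I" "\<And>x. x \<in> F \<inter> Q \<Longrightarrow> x \<noteq> s \<Longrightarrow> c' x \<subseteq> {s}" "u \<in> F \<inter> Q" "u = s \<or> s \<in> c' u"
      and r: "r1 \<noteq> r2" "{r1, r2} \<subseteq> nb s \<inter> exits V (- V) s c'" for c' s u r1 r2
  proof -
    have "piv V (- V) a s c'"
    proof (rule piv_rewire[where F = F and Q = Q and c = c and u = u])
      show "F = {x. (a, x) \<in> (arcs (V - Q) c)\<^sup>*}" by (rule F_def)
      show "c' x = c x" if "x \<notin> Q" for x using c'(2)[of x] that by blast
    qed (use \<open>s \<in> I\<close> I FV that in blast)+
    moreover have "card {r1, r2} \<le> card (nb s \<inter> exits V (- V) s c')"
      using r by (intro card_mono) auto
    ultimately show thesis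
      using c' \<open>s \<in> I\<close> r(1) unfolding Q_def I_def by (intro result[of c' s]) simp_all
  qed
  have hits_off: "hits (V - {s}) (- V) c' v'"
    if "s \<in> Q" "\<And>x. x \<notin> Q \<inter> V \<Longrightarrow> c' x = c x" "hits (V - Q) (- V) c v'" for c' s
  proof -
    have "hits (V - Q) (- V) c' v'"
      using that(3) local_onD[OF local_on_hits, of "V - Q" c' c "- V" v'] that(2) by auto
    then show ?thesis using that(1) by (auto intro: hits_mono)
  qed
  show thesis
  proof (cases "\<exists>u\<in>F \<inter> Q. \<exists>s. att u s \<and> s \<noteq> i")
    case True
    then obtain u s where u: "u \<in> F" "u \<in> Q" "att u s" "s \<noteq> i" by blast
    have s: "s \<in> I" using u by (simp add: att_def)
    have FIs: "x = s" if "x \<in> F" "x \<in> I" for x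
      using FI[OF that] u that unfolding att_def by blast
    define k where "k x = (if x = s then {} else if x = u then {s}
      else if x \<in> I then nb x \<inter> (I - {s} \<union> (if x = i then {v} else {}))
      else if x = v then {v'} else {})" for x
    define c' where "c' x = (if x \<in> Q \<inter> V then k x else c x)" for x
    have off: "c' x = c x" if "x \<notin> Q \<inter> V" for x using that by (simp only: c'_def if_False)
    have uI: "u \<in> I \<Longrightarrow> u = s" using FIs[of u] u by blast
    have c'k: "c' x = k x" if "x \<in> I" for x
    proof -
      have "x \<in> Q \<inter> V" using that I by blast
      then show ?thesis by (simp add: c'_def)
    qed
    have hv: "hits (V - {s}) (- V) c' v"
    proof (cases "v \<in> V")
      case True
      have "v \<noteq> s" "v \<noteq> u" using v s u by blast+
      then have "v' \<in> c' v" using v True by (simp add: c'_def k_def)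
      moreover have "hits (V - {s}) (- V) c' v'"
      proof (rule hits_off[OF _ off])
        show "s \<in> Q" using s I by blast
        show "hits (V - Q) (- V) c v'" using v'[OF True] by simp
      qed
      moreover have "v \<in> V - {s}" using True \<open>v \<noteq> s\<close> by simp
      ultimately show ?thesis using hits_step[of "V - {s}" "- V" c' v' v] by simp
    qed (simp add: hits_refl)
    have hi: "hits (V - {s}) (- V) c' i"
    proof (rule hits_step[OF hv])
      show "i \<in> V - {s}" using i I u by blast
      have "i \<noteq> u" using uI i u by blast
      then show "v \<in> c' i" using i u by (simp add: c'k k_def)
    qed
    have step: "y \<in> c' x" if "x \<in> I - {s}" "y \<in> I - {s}" "y \<in> nb x" for x y
    proof -
      have "x \<noteq> u" using that uI by blast
      then show ?thesis using that by (simp add: c'k k_def)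
    qed
    have hr: "hits (V - {s}) (- V) c' r" if r: "r \<in> I - {s}" for r
    proof -
      have i_s: "i \<in> I - {s}" using i u by blast
      have one: "hits (V - {s}) (- V) c' x" if "x \<in> I - {s}" "i \<in> nb x" for x
      proof (rule hits_step[OF hi _ step[OF that(1) i_s that(2)]])
        show "x \<in> V - {s}" using that(1) I by blast
      qed
      consider "r = i" | "i \<in> nb r" | m where "m \<in> I - {s}" "m \<in> nb r" "i \<in> nb m"
        using block_minus_connected[of s q i r] r s i_s unfolding I_def by blast
      then show ?thesis
      proof cases
        case 3
        have "r \<in> V - {s}" using r I by blast
        then show ?thesis by (rule hits_step[OF one[OF 3(1,3)] _ step[OF r 3(1,2)]])
      next
        case 2
        with r show ?thesis by (rule one)
      qed (simp add: hi)
    qed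
    obtain r1 r2 where r: "r1 \<noteq> r2" "{r1, r2} \<subseteq> nb s \<inter> I - {s}"
      using block_two_neighbours[of s q] s unfolding I_def by blast
    show thesis
    proof (rule finish[of c' s u r1 r2])
      show "c' x \<subseteq> nb x" if "x \<in> Q \<inter> V" for x
      proof -
        have "s \<in> nb u \<or> u = s" using u(3) unfolding att_def by blast
        then have "k x \<subseteq> nb x"
          using i v v' that unfolding k_def by (cases "x = s"; cases "x = u"; cases "x = v"; cases "x = i") simp_all
        then show ?thesis using that by (simp add: c'_def)
      qed
      show "c' x \<subseteq> {s}" if "x \<in> F \<inter> Q" "x \<noteq> s" for x
      proof -
        have "x \<in> Q \<inter> V" "x \<notin> I" "x \<noteq> v" using that FIs[of x] v FV by blast+
        then show ?thesis by (simp add: c'_def k_def)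
      qed
      show "u = s \<or> s \<in> c' u"
      proof -
        have "u \<in> Q \<inter> V" using u FV by blast
        then show ?thesis by (simp add: c'_def k_def)
      qed
      show "{r1, r2} \<subseteq> nb s \<inter> exits V (- V) s c'" using r hr unfolding exits_def by blast
    qed (use off s u r in blast)+
  next
    case False
    then have all: "s = i" if "x \<in> F" "x \<in> Q" "att x s" for x s using that by blast
    obtain s0 where "att u0 s0" using att_ex u0 by blast
    then have u0i: "att u0 i" using all u0 by blast
    obtain c2 v2 where c2: "c2 \<in> I" "c2 \<noteq> i" "c2 \<in> nb i" and v2: "v2 \<notin> I" "v2 \<in> nb c2" "v \<in> nb v2"
      using block_side[of i q v] i v unfolding I_def by blast
    have v2Q: "v2 \<in> Q" using nbI[OF c2(1)] v2(2) by blast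
    \<comment> \<open>Either vertex could be attached to \<open>c2\<close>, which differs from
      \<open>i\<close>; so neither belongs to the incoming side.\<close>
    have nF: "c2 \<notin> F" "v2 \<notin> F"
      using all[of c2 c2] all[of v2 c2] c2 v2 v2Q I nb_sym[of v2 c2] unfolding att_def by blast+
    have ne: "v \<noteq> v2" using v2 nb_irrefl by blast
    define k where "k x = (if x = i then {} else if x = u0 then {i} else if x = c2 then {v2}
      else if x = v2 then {v} else if x = v then {v'} else {})" for x
    define c' where "c' x = (if x \<in> Q \<inter> V then k x else c x)" for x
    have off: "c' x = c x" if "x \<notin> Q \<inter> V" for x using that by (simp only: c'_def if_False)
    have iQ: "i \<in> Q" "i \<in> V" using i I by blast+
    have hv: "hits (V - {i}) (- V) c' v"
    proof (cases "v \<in> V")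
      case True
      have "v \<noteq> i" "v \<noteq> u0" "v \<noteq> c2" "v \<noteq> v2" using v i u0 c2 ne by blast+
      then have "v' \<in> c' v" using v True by (simp add: c'_def k_def)
      moreover have "hits (V - {i}) (- V) c' v'"
      proof (rule hits_off[OF _ off])
        show "i \<in> Q" using iQ by blast
        show "hits (V - Q) (- V) c v'" using v'[OF True] by simp
      qed
      moreover have "v \<in> V - {i}" using True \<open>v \<noteq> i\<close> by simp
      ultimately show ?thesis using hits_step[of "V - {i}" "- V" c' v' v] by simp
    qed (simp add: hits_refl)
    have hv2: "hits (V - {i}) (- V) c' v2"
    proof (cases "v2 \<in> V")
      case True
      have "v2 \<noteq> i" "v2 \<noteq> u0" "v2 \<noteq> c2" using v2 i nF u0 c2 by blast+
      then have "v \<in> c' v2" using v2Q True by (simp add: c'_def k_def)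
      then show ?thesis
        using True \<open>v2 \<noteq> i\<close> by (intro hits_step[OF hv]) simp_all
    qed (simp add: hits_refl)
    have hc2: "hits (V - {i}) (- V) c' c2"
    proof (rule hits_step[OF hv2])
      show "c2 \<in> V - {i}" using c2 I by blast
      have "c2 \<noteq> u0" "c2 \<in> Q \<inter> V" using nF u0 c2 I by blast+
      then show "v2 \<in> c' c2" using c2 by (simp add: c'_def k_def)
    qed
    show thesis
    proof (rule finish[of c' i u0 v c2])
      show "c' x \<subseteq> nb x" if "x \<in> Q \<inter> V" for x
      proof -
        have "i \<in> nb u0 \<or> u0 = i" using u0i unfolding att_def by blast
        then have "k x \<subseteq> nb x"
          using i v2 v' that unfolding k_def
          by (cases "x = i"; cases "x = u0"; cases "x = c2"; cases "x = v2"; cases "x = v") simp_all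
        then show ?thesis using that by (simp add: c'_def)
      qed
      show "c' x \<subseteq> {i}" if "x \<in> F \<inter> Q" "x \<noteq> i" for x
      proof -
        have "x \<in> Q \<inter> V" "x \<noteq> v" "x \<noteq> c2" "x \<noteq> v2" using that v FV nF by blast+
        then show ?thesis by (simp add: c'_def k_def)
      qed
      show "u0 = i \<or> i \<in> c' u0"
      proof -
        have "u0 \<in> Q \<inter> V" using u0 FV by blast
        then show ?thesis by (simp add: c'_def k_def)
      qed
      show "{v, c2} \<subseteq> nb i \<inter> exits V (- V) i c'" using i c2 hv hc2 unfolding exits_def by blast
    qed (use off i u0 c2 v in blast)+
  qed
qed

subsection \<open>Exploration of the trapped set\<close>

text \<open>Closing edges is absorbed into the weights, which keeps the product form at the price of
  normalisation.\<close>

lemma wsum_closed: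
  assumes "finite S"
  shows "wsum S N w (\<lambda>c. of_bool (\<forall>x\<in>S. c x \<inter> Z x = {}) * f c) =
    wsum S N (\<lambda>q s. of_bool (s \<inter> Z q = {}) * w q s) f"
  unfolding wsum_def
proof (intro sum.cong refl)
  fix c
  have "(\<Prod>q\<in>S. of_bool (c q \<inter> Z q = {}) :: real) = of_bool (\<forall>x\<in>S. c x \<inter> Z x = {})"
    using assms by (induction S rule: finite_induct) auto
  then show "(\<Prod>q\<in>S. w q (c q)) * (of_bool (\<forall>x\<in>S. c x \<inter> Z x = {}) * f c) =
      (\<Prod>q\<in>S. of_bool (c q \<inter> Z q = {}) * w q (c q)) * f c"
    by (simp only: prod.distrib mult.assoc mult.commute mult.left_commute)
qed

lemma wsum_closed_one:
  assumes "finite S"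
  shows "wsum S N w (\<lambda>c. of_bool (\<forall>x\<in>S. c x \<inter> Z x = {})) =
    (\<Prod>q\<in>S. \<Sum>s\<in>Pow (N q). of_bool (s \<inter> Z q = {}) * w q s)"
proof -
  have "wsum S N u (\<lambda>_. 1) = (\<Prod>q\<in>S. \<Sum>s\<in>Pow (N q). u q s)" for u
    using assms by (induction S rule: finite_induct) (simp_all add: wsum_insert sum_distrib_right)
  then show ?thesis
    using wsum_closed[OF assms, of N w Z "\<lambda>_. 1"] by simp
qed

text \<open>Submultiplicativity of the avoidance probabilities at each vertex makes closing
  edges to \<open>Z\<close> favourable for connections along the other edges.\<close>

lemma wsum_closed_hits:
  assumes S: "finite S" "\<And>q. q \<in> S \<Longrightarrow> finite (N q)"
    and nn: "\<And>q s. q \<in> S \<Longrightarrow> s \<subseteq> N q \<Longrightarrow> 0 \<le> w q s"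
    and tot: "\<And>q. q \<in> S \<Longrightarrow> (\<Sum>s\<in>Pow (N q). w q s) = 1"
    and sub: "\<And>q A B. q \<in> S \<Longrightarrow> A \<inter> B = {} \<Longrightarrow> (\<Sum>s\<in>Pow (N q). of_bool (s \<inter> (A \<union> B) = {}) * w q s) \<le>
      (\<Sum>s\<in>Pow (N q). of_bool (s \<inter> A = {}) * w q s) * (\<Sum>s\<in>Pow (N q). of_bool (s \<inter> B = {}) * w q s)"
    and Z: "\<And>x. x \<in> S \<Longrightarrow> (U \<union> T) \<inter> Z x = {}"
  shows "wsum S N w (\<lambda>c. of_bool (\<forall>x\<in>S. c x \<inter> Z x = {})) * wsum S N w (\<lambda>c. of_bool (hits U T c a))
    \<le> wsum S N w (\<lambda>c. of_bool (\<forall>x\<in>S. c x \<inter> Z x = {}) * of_bool (hits U T c a))"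
proof -
  define g where "g q = (\<Sum>s\<in>Pow (N q). of_bool (s \<inter> Z q = {}) * w q s)" for q
  have g0: "0 \<le> g q" if "q \<in> S" for q
    unfolding g_def using nn[OF that] by (intro sum_nonneg) auto
  have cmpl: "(\<Sum>s | s \<subseteq> N q \<and> s \<inter> A \<noteq> {}. u s) =
      (\<Sum>s\<in>Pow (N q). u s) - (\<Sum>s\<in>Pow (N q). of_bool (s \<inter> A = {}) * u s)"
    if "q \<in> S" for q A and u :: "'a set \<Rightarrow> real"
  proof -
    have "(\<Sum>s | s \<subseteq> N q \<and> s \<inter> A \<noteq> {}. u s) = (\<Sum>s\<in>Pow (N q). u s - of_bool (s \<inter> A = {}) * u s)"
      by (rule sum.mono_neutral_cong_left) (use S(2)[OF that] in auto)
    then show ?thesis by (simp only: sum_subtractf)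
  qed
  \<comment> \<open>The original law, scaled by the probability \<open>g q\<close> of closing the
    edges at \<open>q\<close>, is compared with the law restricted to closed edges. The totals
    agree, and by \<open>sub\<close> the restricted weights avoid a set disjoint from
    \<open>Z q\<close> with no larger mass.\<close>
  have "wsum S N (\<lambda>q s. g q * w q s) (\<lambda>c. of_bool (hits U T c a)) \<le>
      wsum S N (\<lambda>q s. of_bool (s \<inter> Z q = {}) * w q s) (\<lambda>c. of_bool (hits U T c a))"
  proof (rule wsum_hits_mono[OF S])
    show "0 \<le> g q * w q s" "0 \<le> of_bool (s \<inter> Z q = {}) * w q s" if "q \<in> S" "s \<subseteq> N q" for q s
      using nn[OF that] g0[OF that(1)] by simp_all
    show eq: "(\<Sum>s\<in>Pow (N q). g q * w q s) = (\<Sum>s\<in>Pow (N q). of_bool (s \<inter> Z q = {}) * w q s)"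
      if "q \<in> S" for q
      using tot[OF that] by (simp only: g_def mult_1_right flip: sum_distrib_left)
    show "(\<Sum>s | s \<subseteq> N q \<and> s \<inter> A \<noteq> {}. g q * w q s) \<le>
        (\<Sum>s | s \<subseteq> N q \<and> s \<inter> A \<noteq> {}. of_bool (s \<inter> Z q = {}) * w q s)"
      if q: "q \<in> S" and A: "A \<subseteq> U \<union> T" for q A
    proof -
      have "(\<Sum>s\<in>Pow (N q). of_bool (s \<inter> A = {}) * (of_bool (s \<inter> Z q = {}) * w q s)) =
          (\<Sum>s\<in>Pow (N q). of_bool (s \<inter> (A \<union> Z q) = {}) * w q s)"
        by (intro sum.cong refl) (simp add: Int_Un_distrib)
      also have "\<dots> \<le> (\<Sum>s\<in>Pow (N q). of_bool (s \<inter> A = {}) * w q s) * g q"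
        unfolding g_def by (rule sub[OF q]) (use Z[OF q] A in blast)
      also have "\<dots> = (\<Sum>s\<in>Pow (N q). of_bool (s \<inter> A = {}) * (g q * w q s))"
        unfolding sum_distrib_right by (intro sum.cong refl) (simp only: mult.assoc mult.commute mult.left_commute)
      finally show ?thesis
        unfolding cmpl[OF q] eq[OF q] by linarith
    qed
  qed
  then show ?thesis
    by (simp only: wsum_scale[OF S(1)] wsum_closed[OF S(1)] wsum_closed_one[OF S(1)] g_def)
qed

section \<open>The Duminil-Copin--Tassion inequalities\<close>

definition trapped :: "'a set \<Rightarrow> ('a \<Rightarrow> 'a set) \<Rightarrow> 'a set" where
  "trapped V c = {x \<in> V. \<not> hits V (- V) c x}"

text \<open>The event splits into a condition on choices in \<open>S\<close> and one on choices in
  \<open>V - S\<close>, so it factorises. All that is learnt about \<open>S\<close> is that its arcs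
  to the complement are closed.\<close>

lemma trapped_eq_iff:
  assumes "S \<subseteq> V"
  shows "trapped V c = S \<longleftrightarrow> (\<forall>x\<in>S. c x \<inter> - S = {}) \<and> (\<forall>y\<in>V - S. hits (V - S) (- V) c y)"
proof
  assume eq: "trapped V c = S"
  show "(\<forall>x\<in>S. c x \<inter> - S = {}) \<and> (\<forall>y\<in>V - S. hits (V - S) (- V) c y)"
  proof (intro conjI ballI)
    fix x assume x: "x \<in> S"
    then have nx: "x \<in> V" "\<not> hits V (- V) c x" using eq by (auto simp: trapped_def)
    have "y \<in> S" if "y \<in> c x" for y
    proof (rule ccontr)
      assume "y \<notin> S"
      then have "hits V (- V) c y"
        using eq hits_refl[of y "- V" V c] unfolding trapped_def by blast
      then show False using hits_step[of V "- V" c y x] nx that by blast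
    qed
    then show "c x \<inter> - S = {}" by blast
  next
    fix y assume y: "y \<in> V - S"
    then have "hits V (- V) c y" using eq by (auto simp: trapped_def)
    then obtain t where t: "t \<notin> V" "(y, t) \<in> (arcs V c)\<^sup>*" by (auto simp: hits_def)
    have "\<not> (\<exists>q\<in>S \<inter> V. \<exists>z\<in>c q. (y, q) \<in> (arcs V c)\<^sup>* \<and> (z, t) \<in> (arcs (V - S) c)\<^sup>*)"
    proof
      assume "\<exists>q\<in>S \<inter> V. \<exists>z\<in>c q. (y, q) \<in> (arcs V c)\<^sup>* \<and> (z, t) \<in> (arcs (V - S) c)\<^sup>*"
      then obtain q z where q: "q \<in> S" "q \<in> V" "z \<in> c q" "(z, t) \<in> (arcs (V - S) c)\<^sup>*" by blast
      have "hits V (- V) c z"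
        using t(1) arcs_rtrancl_mono[OF q(4), of V] unfolding hits_def by blast
      then have "hits V (- V) c q" using q(2,3) by (rule hits_step)
      then show False using q(1) eq unfolding trapped_def by blast
    qed
    then have "(y, t) \<in> (arcs (V - S) c)\<^sup>*" using reach_last_exit[OF t(2), of S] by blast
    then show "hits (V - S) (- V) c y" using t(1) by (auto simp: hits_def)
  qed
next
  assume R: "(\<forall>x\<in>S. c x \<inter> - S = {}) \<and> (\<forall>y\<in>V - S. hits (V - S) (- V) c y)"
  have stay: "y \<in> S" if "(x, y) \<in> (arcs V c)\<^sup>*" "x \<in> S" for x y
    using that(1)
  proof (induction rule: rtrancl_induct)
    case (step y z)
    then have "y \<in> S" "z \<in> c y" by (simp_all add: arcs_def)
    then show ?case using R by blast
  qed (rule that(2))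
  have "\<not> hits V (- V) c x" if "x \<in> S" for x
    using stay[OF _ that] assms unfolding hits_def by blast
  moreover have "hits V (- V) c y" if "y \<in> V - S" for y
    using hits_mono[of "V - S" "- V" c y V "- V"] R that by blast
  ultimately show "trapped V c = S" using assms unfolding trapped_def by blast
qed

text \<open>The functional that Duminil-Copin and Tassion attach to a finite set, with boundary
  vertices in place of boundary edges.\<close>

definition bdry_conn :: "('a \<Rightarrow> 'a set) \<Rightarrow> ('a \<Rightarrow> 'a set \<Rightarrow> real) \<Rightarrow> 'a \<Rightarrow> 'a set \<Rightarrow> real" where
  "bdry_conn N w a S =
    (\<Sum>q | q \<in> S \<and> \<not> N q \<subseteq> S. wsum S N w (\<lambda>c. of_bool ((a, q) \<in> (arcs (S - {q}) c)\<^sup>*)))"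

text \<open>Let the trapped set be \<open>S\<close> and contain \<open>a\<close>. Every boundary
  vertex of \<open>S\<close> that \<open>a\<close> reaches inside \<open>S\<close> is pivotal with a
  useful neighbour, as each neighbour outside \<open>S\<close> escapes without it. Conditioning on
  \<open>S\<close> closes the arcs leaving \<open>S\<close>, which by
  \<open>wsum_closed_hits\<close> does not lower the chance of reaching that vertex.\<close>

lemma wsum_piv_ge:
  fixes N :: "'a \<Rightarrow> 'a set"
  assumes V: "finite V" "\<And>q. q \<in> V \<Longrightarrow> finite (N q)" "a \<in> V"
    and nn: "\<And>q s. q \<in> V \<Longrightarrow> s \<subseteq> N q \<Longrightarrow> 0 \<le> w q s"
    and tot: "\<And>q. q \<in> V \<Longrightarrow> (\<Sum>s\<in>Pow (N q). w q s) = 1"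
    and sub: "\<And>q A B. q \<in> V \<Longrightarrow> A \<inter> B = {} \<Longrightarrow> (\<Sum>s\<in>Pow (N q). of_bool (s \<inter> (A \<union> B) = {}) * w q s) \<le>
      (\<Sum>s\<in>Pow (N q). of_bool (s \<inter> A = {}) * w q s) * (\<Sum>s\<in>Pow (N q). of_bool (s \<inter> B = {}) * w q s)"
    and \<kappa>: "\<And>S. S \<subseteq> V \<Longrightarrow> a \<in> S \<Longrightarrow> \<kappa> \<le> bdry_conn N w a S"
  shows "\<kappa> * (1 - wsum V N w (\<lambda>c. of_bool (hits V (- V) c a))) \<le>
    (\<Sum>q\<in>V. wsum V N w (\<lambda>c. of_bool (piv V (- V) a q c \<and> N q \<inter> exits V (- V) q c \<noteq> {})))"
proof -
  define SS where "SS = {S. S \<subseteq> V \<and> a \<in> S}"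
  define bd where "bd S = {q. q \<in> S \<and> \<not> N q \<subseteq> S}" for S
  have fin: "finite SS" "finite S" "finite (bd S)" if "S \<in> SS" for S
    using that V(1) finite_subset[of S V] by (auto simp: SS_def bd_def)
  have finSS: "finite SS" using V(1) by (simp add: SS_def)
  let ?tr = "\<lambda>S c. of_bool (trapped V c = S) :: real"
  let ?cl = "\<lambda>S c. of_bool (\<forall>x\<in>S. c x \<inter> - S = {}) :: real"
  let ?G = "\<lambda>S c. of_bool (\<forall>y\<in>V - S. hits (V - S) (- V) c y) :: real"
  let ?re = "\<lambda>S q c. of_bool (hits (S - {q}) {q} c a) :: real"
  have locG: "local_on (V - S) (?G S)" for S
    unfolding local_on_def
  proof (intro allI impI)
    fix c c' :: "'a \<Rightarrow> 'a set" assume "\<forall>q\<in>V - S. c q = c' q"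
    then have "arcs (V - S) c = arcs (V - S) c'" by (intro arcs_cong) simp
    then show "?G S c = ?G S c'" by (simp only: hits_def)
  qed
  have loccl: "local_on S (?cl S)" for S
    unfolding local_on_def by (simp cong: ball_cong)
  have locre: "local_on S (?re S q)" for S q
    by (rule local_on_comp[where g = of_bool, OF local_on_mono[OF local_on_hits]]) auto
  have tr: "?tr S c = ?cl S c * ?G S c" if "S \<in> SS" for S c
  proof -
    have "S \<subseteq> V" using that by (simp add: SS_def)
    from trapped_eq_iff[OF this, of c] show ?thesis by (simp only: of_bool_conj)
  qed
  have split: "wsum V N w (\<lambda>c. f c * ?G S c) = wsum S N w f * wsum (V - S) N w (?G S)"
    if "S \<in> SS" "local_on S f" for S f
  proof -
    have "S \<union> (V - S) = V" using that by (auto simp: SS_def)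
    moreover have "wsum (S \<union> (V - S)) N w (\<lambda>c. f c * ?G S c) = wsum S N w f * wsum (V - S) N w (?G S)"
      using fin(2)[OF that(1)] V(1) that(2) locG by (intro wsum_mult_local) auto
    ultimately show ?thesis by (simp only:)
  qed
  have key: "wsum V N w (?tr S) * wsum S N w (?re S q) \<le> wsum V N w (\<lambda>c. ?tr S c * ?re S q c)"
    if S: "S \<in> SS" and q: "q \<in> bd S" for S q
  proof -
    have qS: "q \<in> S" using q by (simp add: bd_def)
    have SV: "S \<subseteq> V" using S by (simp add: SS_def)
    have "wsum V N w (?tr S) * wsum S N w (?re S q) =
        (wsum S N w (?cl S) * wsum S N w (?re S q)) * wsum (V - S) N w (?G S)"
      using split[OF S loccl[of S]] by (simp add: tr[OF S])
    also have "\<dots> \<le> wsum S N w (\<lambda>c. ?cl S c * ?re S q c) * wsum (V - S) N w (?G S)"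
    proof (rule mult_right_mono)
      show "0 \<le> wsum (V - S) N w (?G S)"
        using nn by (intro wsum_nonneg) auto
      show "wsum S N w (?cl S) * wsum S N w (?re S q) \<le> wsum S N w (\<lambda>c. ?cl S c * ?re S q c)"
        by (rule wsum_closed_hits) (use fin[OF S] SV V nn tot sub qS in blast)+
    qed
    also have "\<dots> = wsum V N w (\<lambda>c. (?cl S c * ?re S q c) * ?G S c)"
      by (rule split[symmetric, OF S]) (rule local_on_comp2[OF loccl locre])
    also have "\<dots> = wsum V N w (\<lambda>c. ?tr S c * ?re S q c)"
      by (intro wsum_cong) (simp add: tr[OF S] mult_ac)
    finally show ?thesis .
  qed
  have reach: "hits (S - {q}) {q} c a \<longleftrightarrow> (a, q) \<in> (arcs (S - {q}) c)\<^sup>*" for S q c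
    by (simp add: hits_def)
  have pw: "(\<Sum>S\<in>SS. \<Sum>q\<in>bd S. ?tr S c * ?re S q c) \<le>
      (\<Sum>q\<in>V. of_bool (piv V (- V) a q c \<and> N q \<inter> exits V (- V) q c \<noteq> {}))" for c
  proof (cases "trapped V c \<in> SS")
    case False
    then have "(\<Sum>S\<in>SS. \<Sum>q\<in>bd S. ?tr S c * ?re S q c) = 0"
      by (intro sum.neutral ballI) auto
    also have "0 \<le> (\<Sum>q\<in>V. of_bool (piv V (- V) a q c \<and> N q \<inter> exits V (- V) q c \<noteq> {}) :: real)"
      by (intro sum_nonneg) simp
    finally show ?thesis .
  next
    case True
    define S where "S = trapped V c"
    have S: "S \<in> SS" "S \<subseteq> V" "a \<in> S" using True by (auto simp: S_def SS_def)
    have TS: "trapped V c = S" by (simp add: S_def)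
    note R = TS[unfolded trapped_eq_iff[OF S(2)]]
    have "(\<Sum>S'\<in>SS. \<Sum>q\<in>bd S'. ?tr S' c * ?re S' q c) = (\<Sum>q\<in>bd S. ?tr S c * ?re S q c)"
      by (rule sum.remove[OF finSS S(1), THEN trans]) (auto simp: S_def intro!: sum.neutral)
    also have "\<dots> = (\<Sum>q\<in>bd S. ?re S q c)" by (simp add: S_def)
    also have "\<dots> \<le> (\<Sum>q\<in>bd S. of_bool (piv V (- V) a q c \<and> N q \<inter> exits V (- V) q c \<noteq> {}))"
    proof (intro sum_mono of_bool_mono)
      fix q assume q: "q \<in> bd S" and "hits (S - {q}) {q} c a"
      then have aq: "(a, q) \<in> (arcs (S - {q}) c)\<^sup>*" by (simp add: hits_def)
      have "\<not> hits V (- V) c a" using S TS by (auto simp: trapped_def)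
      then have "\<not> hits (V - {q}) (- V) c a" using hits_mono[of "V - {q}" "- V" c a V] by auto
      moreover have "(a, q) \<in> (arcs (V - {q}) c)\<^sup>*"
        using aq by (rule arcs_rtrancl_mono) (use S in auto)
      moreover obtain y where y: "y \<in> N q" "y \<notin> S" using q by (auto simp: bd_def)
      have "hits (V - {q}) (- V) c y"
      proof (cases "y \<in> V")
        case True
        then have "hits (V - S) (- V) c y" using R y by auto
        then show ?thesis using q by (rule_tac hits_mono) (auto simp: bd_def)
      qed (simp add: hits_refl)
      ultimately show "piv V (- V) a q c \<and> N q \<inter> exits V (- V) q c \<noteq> {}"
        using y(1) by (auto simp: piv_def exits_def)
    qed
    also have "\<dots> \<le> (\<Sum>q\<in>V. of_bool (piv V (- V) a q c \<and> N q \<inter> exits V (- V) q c \<noteq> {}))"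
      using S V(1) by (intro sum_mono2) (auto simp: bd_def)
    finally show ?thesis .
  qed
  have tot1: "(\<Sum>S\<in>SS. ?tr S c) = 1 - of_bool (hits V (- V) c a)" for c
  proof -
    have "(\<Sum>S\<in>SS. ?tr S c) = (\<Sum>S\<in>SS. if S = trapped V c then 1 else 0)"
      by (intro sum.cong refl) (simp add: of_bool_def)
    also have "\<dots> = of_bool (trapped V c \<in> SS)"
      using finSS by simp
    also have "trapped V c \<in> SS \<longleftrightarrow> \<not> hits V (- V) c a"
      using V(3) by (auto simp: SS_def trapped_def)
    finally show ?thesis by simp
  qed
  have "\<kappa> * (1 - wsum V N w (\<lambda>c. of_bool (hits V (- V) c a))) = \<kappa> * wsum V N w (\<lambda>c. \<Sum>S\<in>SS. ?tr S c)"
    unfolding tot1 wsum_diff using V tot by (simp add: wsum_const)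
  also have "\<dots> = (\<Sum>S\<in>SS. wsum V N w (?tr S) * \<kappa>)"
    by (simp only: wsum_sum sum_distrib_left mult.commute)
  also have "\<dots> \<le> (\<Sum>S\<in>SS. wsum V N w (?tr S) * bdry_conn N w a S)"
    using nn \<kappa> by (intro sum_mono mult_left_mono wsum_nonneg) (auto simp: SS_def)
  also have "\<dots> = (\<Sum>S\<in>SS. \<Sum>q\<in>bd S. wsum V N w (?tr S) * wsum S N w (?re S q))"
    unfolding bdry_conn_def bd_def[symmetric] reach sum_distrib_left ..
  also have "\<dots> \<le> (\<Sum>S\<in>SS. \<Sum>q\<in>bd S. wsum V N w (\<lambda>c. ?tr S c * ?re S q c))"
    by (intro sum_mono key)
  also have "\<dots> = wsum V N w (\<lambda>c. \<Sum>S\<in>SS. \<Sum>q\<in>bd S. ?tr S c * ?re S q c)"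
    by (simp only: wsum_sum)
  also have "\<dots> \<le> wsum V N w (\<lambda>c. \<Sum>q\<in>V. of_bool (piv V (- V) a q c \<and> N q \<inter> exits V (- V) q c \<noteq> {}))"
    using nn pw by (intro wsum_mono) auto
  finally show ?thesis by (simp only: wsum_sum)
qed

text \<open>Explore the set \<open>C\<close> that \<open>a\<close> reaches inside \<open>S\<close>.
  An escaping path leaves \<open>C\<close> for the last time from some \<open>q\<close> to a
  neighbour \<open>y\<close> outside \<open>S\<close> and continues without tails in
  \<open>C\<close>, hence independently of the exploration and with probability at most
  \<open>M\<close>.\<close>

lemma wsum_hits_le_bdry:
  fixes N :: "'a \<Rightarrow> 'a set"
  assumes V: "finite V" "\<And>q. q \<in> V \<Longrightarrow> finite (N q)" "\<And>q. q \<in> V \<Longrightarrow> card (N q) \<le> d" "S \<subseteq> V" "a \<in> S"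
    and nn: "\<And>q s. q \<in> V \<Longrightarrow> s \<subseteq> N q \<Longrightarrow> 0 \<le> w q s"
    and tot: "\<And>q. q \<in> V \<Longrightarrow> (\<Sum>s\<in>Pow (N q). w q s) = 1"
    and M: "0 \<le> M" "\<And>q y. q \<in> S \<Longrightarrow> y \<in> N q \<Longrightarrow> wsum V N w (\<lambda>c. of_bool (hits V (- V) c y)) \<le> M"
  shows "wsum V N w (\<lambda>c. of_bool (hits V (- V) c a)) \<le> real d * M * bdry_conn N w a S"
proof -
  define cl where "cl c = {x \<in> S. (a, x) \<in> (arcs S c)\<^sup>*}" for c
  define bd where "bd C = {q \<in> C. \<not> N q \<subseteq> S}" for C
  have finS: "finite S" using V finite_subset by blast
  \<comment> \<open>The right-hand side looks only at choices in \<open>C\<close>; this makes the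
    exploration event local.\<close>
  have cl_iff: "cl c = C \<longleftrightarrow> a \<in> C \<and> (\<forall>x\<in>C. (a, x) \<in> (arcs C c)\<^sup>* \<and> c x \<inter> S \<subseteq> C)"
    if C: "C \<subseteq> S" for c C
  proof
    assume eq: "cl c = C"
    have "(a, x) \<in> (arcs C c)\<^sup>*" if "(a, x) \<in> (arcs S c)\<^sup>*" for x
      using that
    proof (induction rule: rtrancl_induct)
      case (step x y)
      then have "(x, y) \<in> arcs C c" using eq by (auto simp: arcs_def cl_def)
      with step.IH show ?case by (rule rtrancl.rtrancl_into_rtrancl)
    qed simp
    moreover have "y \<in> C" if "x \<in> C" "y \<in> c x" "y \<in> S" for x y
    proof -
      have "(a, x) \<in> (arcs S c)\<^sup>*" "(x, y) \<in> arcs S c" using that eq C by (auto simp: cl_def arcs_def)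
      then have "(a, y) \<in> (arcs S c)\<^sup>*" by (rule rtrancl.rtrancl_into_rtrancl)
      then show ?thesis using eq that by (auto simp: cl_def)
    qed
    ultimately show "a \<in> C \<and> (\<forall>x\<in>C. (a, x) \<in> (arcs C c)\<^sup>* \<and> c x \<inter> S \<subseteq> C)"
      using eq \<open>a \<in> S\<close> by (auto simp: cl_def)
  next
    assume R: "a \<in> C \<and> (\<forall>x\<in>C. (a, x) \<in> (arcs C c)\<^sup>* \<and> c x \<inter> S \<subseteq> C)"
    have "x \<in> S \<longrightarrow> x \<in> C" if "(a, x) \<in> (arcs S c)\<^sup>*" for x
      using that R by (induction rule: rtrancl_induct) (auto simp: arcs_def)
    then have "cl c \<subseteq> C" by (auto simp: cl_def)
    moreover have "C \<subseteq> cl c"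
    proof
      fix x assume "x \<in> C"
      then have "(a, x) \<in> (arcs C c)\<^sup>*" using R by simp
      then have "(a, x) \<in> (arcs S c)\<^sup>*" using C by (rule arcs_rtrancl_mono)
      then show "x \<in> cl c" using \<open>x \<in> C\<close> C by (auto simp: cl_def)
    qed
    ultimately show "cl c = C" by simp
  qed
  have loc: "local_on C (\<lambda>c. of_bool (cl c = C) :: real)" if "C \<subseteq> S" for C
    unfolding local_on_def cl_iff[OF that]
  proof (intro allI impI)
    fix c c' :: "'a \<Rightarrow> 'a set" assume eq: "\<forall>q\<in>C. c q = c' q"
    then have "arcs C c = arcs C c'" by (intro arcs_cong) simp
    then show "(of_bool (a \<in> C \<and> (\<forall>x\<in>C. (a, x) \<in> (arcs C c)\<^sup>* \<and> c x \<inter> S \<subseteq> C)) :: real) =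
        of_bool (a \<in> C \<and> (\<forall>x\<in>C. (a, x) \<in> (arcs C c')\<^sup>* \<and> c' x \<inter> S \<subseteq> C))"
      using eq by simp
  qed
  have pw: "of_bool (hits V (- V) c a) \<le>
      (\<Sum>C\<in>Pow S. \<Sum>q\<in>bd C. \<Sum>y\<in>N q. of_bool (cl c = C) * of_bool (hits (V - C) (- V) c y) :: real)"
    if c: "c \<in> PiE V (\<lambda>q. Pow (N q))" for c
  proof (cases "hits V (- V) c a")
    case True
    then obtain t where t: "t \<notin> V" "(a, t) \<in> (arcs V c)\<^sup>*" by (auto simp: hits_def)
    define C where "C = cl c"
    have C: "C \<subseteq> S" "a \<in> C" using \<open>a \<in> S\<close> by (auto simp: C_def cl_def)
    have stop: "x \<notin> C" if "(x, t) \<in> (arcs (V - C) c)\<^sup>*" for x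
      using that C V(4) t(1) by (cases rule: converse_rtranclE) (auto simp: arcs_def)
    from reach_last_exit[OF t(2), of C] stop[of a] C obtain q y where
      q: "q \<in> C" "y \<in> c q" "(y, t) \<in> (arcs (V - C) c)\<^sup>*" by blast
    have qV: "q \<in> V" using q C V(4) by auto
    have "y \<notin> S"
    proof
      assume "y \<in> S"
      have "(q, y) \<in> arcs S c" using q C by (auto simp: arcs_def)
      moreover have "(a, q) \<in> (arcs S c)\<^sup>*" using q by (auto simp: C_def cl_def)
      ultimately have "y \<in> C" using \<open>y \<in> S\<close> by (auto simp: C_def cl_def)
      then show False using stop[OF q(3)] by simp
    qed
    moreover have yN: "y \<in> N q" using c q qV by (auto simp: PiE_iff)
    ultimately have qb: "q \<in> bd C" using q by (auto simp: bd_def)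
    have hy: "hits (V - C) (- V) c y" using q t by (auto simp: hits_def)
    have "(1::real) \<le> of_bool (cl c = C) * of_bool (hits (V - C) (- V) c y)" using hy by (simp add: C_def)
    also have "\<dots> \<le> (\<Sum>y\<in>N q. of_bool (cl c = C) * of_bool (hits (V - C) (- V) c y))"
      using yN V(2)[OF qV] by (intro member_le_sum) auto
    also have "\<dots> \<le> (\<Sum>q\<in>bd C. \<Sum>y\<in>N q. of_bool (cl c = C) * of_bool (hits (V - C) (- V) c y))"
      using qb finite_subset[OF C(1) finS]
      by (intro member_le_sum[where f = "\<lambda>q. \<Sum>y\<in>N q. of_bool (cl c = C) * of_bool (hits (V - C) (- V) c y)"])
         (auto simp: bd_def intro!: sum_nonneg)
    also have "\<dots> \<le> (\<Sum>C\<in>Pow S. \<Sum>q\<in>bd C. \<Sum>y\<in>N q. of_bool (cl c = C) * of_bool (hits (V - C) (- V) c y))"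
      using C finS
      by (intro member_le_sum[where f = "\<lambda>C. \<Sum>q\<in>bd C. \<Sum>y\<in>N q. of_bool (cl c = C) * of_bool (hits (V - C) (- V) c y)"])
         (auto intro!: sum_nonneg)
    finally show ?thesis using True by simp
  next
    case False
    then show ?thesis by (auto intro!: sum_nonneg)
  qed
  have nnw: "0 \<le> wsum V N w (\<lambda>c. of_bool (P c))" for P
    using nn by (intro wsum_nonneg) auto
  have one: "wsum V N w (\<lambda>c. of_bool (cl c = C) * of_bool (hits (V - C) (- V) c y)) \<le>
      wsum V N w (\<lambda>c. of_bool (cl c = C)) * M" if C: "C \<subseteq> S" "q \<in> bd C" "y \<in> N q" for C q y
  proof -
    have CV: "C \<subseteq> V" "C \<union> (V - C) = V" using C V(4) by auto
    have finC: "finite C" using CV V(1) finite_subset by blast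
    have loch: "local_on (V - C) (\<lambda>c. of_bool (hits (V - C) (- V) c y) :: real)"
      by (rule local_on_comp[OF local_on_hits])
    have "wsum V N w (\<lambda>c. of_bool (cl c = C) * of_bool (hits (V - C) (- V) c y)) =
        wsum C N w (\<lambda>c. of_bool (cl c = C)) * wsum (V - C) N w (\<lambda>c. of_bool (hits (V - C) (- V) c y))"
      using wsum_mult_local[OF finC _ _ loc[OF C(1)] loch, of N w] V(1) CV(2) by auto
    also have "\<dots> = wsum V N w (\<lambda>c. of_bool (cl c = C)) * wsum V N w (\<lambda>c. of_bool (hits (V - C) (- V) c y))"
      using wsum_marginal[OF V(1) CV(1) loc[OF C(1)] tot] wsum_marginal[OF V(1) _ loch tot] by simp
    also have "\<dots> \<le> wsum V N w (\<lambda>c. of_bool (cl c = C)) * wsum V N w (\<lambda>c. of_bool (hits V (- V) c y))"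
      using nn by (intro mult_left_mono nnw wsum_mono of_bool_mono) (auto intro: hits_mono)
    also have "\<dots> \<le> wsum V N w (\<lambda>c. of_bool (cl c = C)) * M"
      using C by (intro mult_left_mono nnw M(2)[of q]) (auto simp: bd_def)
    finally show ?thesis .
  qed
  \<comment> \<open>Summed over the possible \<open>C\<close>, the boundary vertices of
    \<open>C\<close> are exactly those counted by \<open>bdry_conn\<close>.\<close>
  have cnt: "(\<Sum>C\<in>Pow S. of_bool (cl c = C) * real (card (bd C))) =
      (\<Sum>q | q \<in> S \<and> \<not> N q \<subseteq> S. of_bool ((a, q) \<in> (arcs (S - {q}) c)\<^sup>*))" for c
  proof -
    have "(\<Sum>C\<in>Pow S. of_bool (cl c = C) * real (card (bd C))) =
        (\<Sum>C\<in>Pow S. if C = cl c then real (card (bd C)) else 0)"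
      by (intro sum.cong refl) (simp add: of_bool_def)
    also have "\<dots> = real (card (bd (cl c)))"
    proof -
      have "cl c \<in> Pow S" by (simp add: cl_def)
      then show ?thesis using finS by (simp only: sum.delta finite_Pow_iff if_True)
    qed
    also have "bd (cl c) = {q. (q \<in> S \<and> \<not> N q \<subseteq> S) \<and> (a, q) \<in> (arcs (S - {q}) c)\<^sup>*}"
      unfolding bd_def cl_def using reach_to_source[of a _ S c] by blast
    also have "real (card \<dots>) = (\<Sum>q | q \<in> S \<and> \<not> N q \<subseteq> S. of_bool ((a, q) \<in> (arcs (S - {q}) c)\<^sup>*))"
      using finS by (simp add: Int_def)
    finally show ?thesis .
  qed
  have "wsum V N w (\<lambda>c. of_bool (hits V (- V) c a)) \<le>
      (\<Sum>C\<in>Pow S. \<Sum>q\<in>bd C. \<Sum>y\<in>N q. wsum V N w (\<lambda>c. of_bool (cl c = C) * of_bool (hits (V - C) (- V) c y)))"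
    using wsum_mono[OF nn pw] by (simp only: wsum_sum)
  also have "\<dots> \<le> (\<Sum>C\<in>Pow S. \<Sum>q\<in>bd C. \<Sum>y\<in>N q. wsum V N w (\<lambda>c. of_bool (cl c = C)) * M)"
    by (intro sum_mono one) auto
  also have "\<dots> \<le> (\<Sum>C\<in>Pow S. \<Sum>q\<in>bd C. real d * (wsum V N w (\<lambda>c. of_bool (cl c = C)) * M))"
  proof (intro sum_mono)
    fix C q assume "C \<in> Pow S" "q \<in> bd C"
    then have "card (N q) \<le> d" using V(3,4) by (auto simp: bd_def)
    then show "(\<Sum>y\<in>N q. wsum V N w (\<lambda>c. of_bool (cl c = C)) * M) \<le> real d * (wsum V N w (\<lambda>c. of_bool (cl c = C)) * M)"
      using nnw M(1) by (simp add: mult_right_mono)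
  qed
  also have "\<dots> = real d * M * wsum V N w (\<lambda>c. \<Sum>C\<in>Pow S. real (card (bd C)) * of_bool (cl c = C))"
    by (simp add: wsum_sum wsum_cmult sum_distrib_left mult_ac)
  also have "\<dots> = real d * M * (\<Sum>q | q \<in> S \<and> \<not> N q \<subseteq> S. wsum V N w (\<lambda>c. of_bool ((a, q) \<in> (arcs (S - {q}) c)\<^sup>*)))"
    using cnt by (simp add: wsum_sum mult.commute)
  also have "\<dots> = real d * M * bdry_conn N w a S"
  proof -
    have "wsum V N w (\<lambda>c. of_bool ((a, q) \<in> (arcs (S - {q}) c)\<^sup>*)) =
        wsum S N w (\<lambda>c. of_bool ((a, q) \<in> (arcs (S - {q}) c)\<^sup>*))" for q
    proof (rule wsum_marginal[OF V(1) V(4) _ tot])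
      show "local_on S (\<lambda>c. of_bool ((a, q) \<in> (arcs (S - {q}) c)\<^sup>*) :: real)"
        by (rule local_on_comp[where g = of_bool, OF local_on_mono[OF local_on_reach]]) auto
    qed
    then show ?thesis by (simp add: bdry_conn_def)
  qed
  finally show ?thesis .
qed

subsection \<open>The interpolation\<close>

text \<open>Gives the avoidance probabilities when all sets of size \<open>k\<close> have weight
  \<open>m k\<close>. The argument counts the neighbours outside the avoided set, so for degree 4
  the value at 3 concerns a single avoided neighbour.\<close>

definition avoid :: "(nat \<Rightarrow> real) \<Rightarrow> nat \<Rightarrow> real" where
  "avoid m n = (\<Sum>k\<le>n. real (n choose k) * m k)"

lemma avoid_numerals:
  "avoid m 0 = m 0"
  "avoid m (Suc 0) = m 0 + m 1"
  "avoid m 2 = m 0 + 2 * m 1 + m 2"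
  "avoid m 3 = m 0 + 3 * m 1 + 3 * m 2 + m 3"
  "avoid m 4 = m 0 + 4 * m 1 + 6 * m 2 + 4 * m 3 + m 4"
  by (simp_all add: avoid_def numeral_eq_Suc)

lemma sum_Pow_card:
  assumes "finite F"
  shows "(\<Sum>s\<in>Pow F. m (card s)) = avoid m (card F)"
proof -
  have "(\<Sum>s\<in>Pow F. m (card s)) = (\<Sum>k\<le>card F. \<Sum>s | s \<in> Pow F \<and> card s = k. m (card s))"
    using assms by (intro sum.group[symmetric]) (auto intro: card_mono)
  also have "\<dots> = (\<Sum>k\<le>card F. real (card F choose k) * m k)"
    using n_subsets[OF assms] by (intro sum.cong refl) simp
  finally show ?thesis by (simp add: avoid_def)
qed

lemma sum_Pow_card_avoid:
  assumes "finite F"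
  shows "(\<Sum>s\<in>Pow F. of_bool (s \<inter> A = {}) * m (card s)) = avoid m (card (F - A))"
proof -
  have "(\<Sum>s\<in>Pow F. of_bool (s \<inter> A = {}) * m (card s)) = (\<Sum>s\<in>Pow (F - A). m (card s))"
    using assms by (intro sum.mono_neutral_cong_right) auto
  with assms show ?thesis by (simp add: sum_Pow_card)
qed

lemma sum_Pow_card_hit:
  assumes "finite F"
  shows "(\<Sum>s | s \<subseteq> F \<and> s \<inter> A \<noteq> {}. m (card s)) = avoid m (card F) - avoid m (card (F - A))"
proof -
  have "(\<Sum>s | s \<subseteq> F \<and> s \<inter> A \<noteq> {}. m (card s)) =
      (\<Sum>s\<in>Pow F. m (card s) - of_bool (s \<inter> A = {}) * m (card s))"
    using assms by (intro sum.mono_neutral_cong_left) auto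
  also have "\<dots> = (\<Sum>s\<in>Pow F. m (card s)) - (\<Sum>s\<in>Pow F. of_bool (s \<inter> A = {}) * m (card s))"
    by (rule sum_subtractf)
  finally show ?thesis using assms by (simp only: sum_Pow_card sum_Pow_card_avoid)
qed

text \<open>Half the difference, per set of size \<open>k\<close>, between the law with one
  neighbour with probability \<delta> and two with probability 1 - \<delta>, and the uniform law
  1/16 on all sets.\<close>

definition bump :: "real \<Rightarrow> nat \<Rightarrow> real" where
  "bump \<delta> k = (if k = 1 then \<delta> / 8 else if k = 2 then (1 - \<delta>) / 12 else 0) - 1 / 32"

text \<open>For \<open>\<tau> = 0\<close> this is independent bond percolation at density \<open>1/2\<close>; for \<open>\<tau> = 1\<close> it is
  an equal mixture of the latter and of the model with \<open>p = 1/2 - \<delta>/4\<close>.\<close>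

definition mix :: "real \<Rightarrow> real \<Rightarrow> nat \<Rightarrow> real" where
  "mix \<delta> \<tau> k = 1 / 16 + \<tau> * bump \<delta> k"

text \<open>For small \<delta> only the value at 3 grows with \<tau>, by at most \<delta>/8. This is
  the price for staying below p = 1/2.\<close>

lemma avoid_mix:
  "avoid (mix \<delta> \<tau>) 4 = 1"
  "avoid (mix \<delta> \<tau>) 3 = 1 / 2 + \<tau> * \<delta> / 8"
  "avoid (mix \<delta> \<tau>) 2 = 1 / 4 - \<tau> * (1 / 24 - \<delta> / 6)"
  "avoid (mix \<delta> \<tau>) (Suc 0) = 1 / 8 - \<tau> * (1 / 16 - \<delta> / 8)"
  "avoid (mix \<delta> \<tau>) 0 = 1 / 16 - \<tau> / 32"
  unfolding avoid_numerals mix_def bump_def by (simp_all add: field_simps)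

lemma avoid_bump:
  "avoid (bump \<delta>) 4 = 0"
  "avoid (bump \<delta>) 3 = \<delta> / 8"
  "avoid (bump \<delta>) 2 = \<delta> / 6 - 1 / 24"
  "avoid (bump \<delta>) (Suc 0) = \<delta> / 8 - 1 / 16"
  "avoid (bump \<delta>) 0 = - (1 / 32)"
  unfolding avoid_numerals bump_def by (simp_all add: field_simps)

text \<open>The half of the mixture that stays independent keeps every choice possible; this is the
  bound used for resampling.\<close>

lemma mix_ge:
  assumes "0 \<le> \<delta>" "\<delta> \<le> 1" "0 \<le> \<tau>" "\<tau> \<le> 1"
  shows "1 / 32 \<le> mix \<delta> \<tau> k"
proof -
  have "- (1 / 32) \<le> bump \<delta> k" using assms by (simp add: bump_def)
  then have "\<tau> * - (1 / 32) \<le> \<tau> * bump \<delta> k" by (rule mult_left_mono[OF _ assms(3)])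
  then show ?thesis using assms(4) by (simp add: mix_def)
qed

text \<open>If \<open>a\<close> and \<open>b\<close> of the 4 neighbours lie outside two disjoint
  sets, then a + b - 4 lie outside both. At \<tau> = 0 all cases are equalities, so the first-order
  terms in \<tau> have to be compared.\<close>

lemma avoid_mix_submult:
  assumes \<delta>: "0 \<le> \<delta>" "\<delta> \<le> 1 / 100" and \<tau>: "0 \<le> \<tau>" "\<tau> \<le> 1"
    and ab: "a \<le> 4" "b \<le> 4" "4 \<le> a + b"
  shows "avoid (mix \<delta> \<tau>) (a + b - 4) \<le> avoid (mix \<delta> \<tau>) a * avoid (mix \<delta> \<tau>) b"
proof -
  let ?g = "avoid (mix \<delta> \<tau>)"
  have td: "0 \<le> \<tau> * \<delta>" "\<tau> * \<delta> \<le> \<tau> / 100"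
    using \<delta> \<tau> mult_left_mono[OF \<delta>(2) \<tau>(1)] by simp_all
  have g3: "1 / 2 \<le> ?g 3" using td by (simp add: avoid_mix)
  have g2: "1 / 4 - \<tau> / 24 \<le> ?g 2" "?g 2 \<le> 1 / 4"
    using td \<tau> by (simp_all add: avoid_mix field_simps)
  have g1: "1 / 8 - \<tau> / 16 \<le> ?g (Suc 0)" "?g (Suc 0) \<le> 1 / 8 - \<tau> / 17"
    using td \<tau> by (simp_all add: avoid_mix field_simps)
  have g0: "?g 0 = 1 / 16 - \<tau> / 32" by (rule avoid_mix)
  have 33: "?g 2 \<le> ?g 3 * ?g 3"
    using mult_mono[OF g3 g3] g3 g2 by linarith
  have 32: "?g (Suc 0) \<le> ?g 3 * ?g 2"
    using mult_mono[OF g3 g2(1)] g3 g2 g1 \<tau> by (simp add: field_simps)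
  have 31: "?g 0 \<le> ?g 3 * ?g (Suc 0)"
    using mult_mono[OF g3 g1(1)] g3 g1 g0 \<tau> by (simp add: field_simps)
  have "(1 / 4 - \<tau> / 24) * (1 / 4 - \<tau> / 24) \<le> ?g 2 * ?g 2"
    using g2 \<tau> by (intro mult_mono) auto
  moreover have "(1 / 4 - \<tau> / 24) * (1 / 4 - \<tau> / 24) = 1 / 16 - \<tau> / 48 + (\<tau> / 24) * (\<tau> / 24)"
    by (simp add: field_simps)
  moreover have "0 \<le> (\<tau> / 24) * (\<tau> / 24)" by simp
  ultimately have 22: "?g 0 \<le> ?g 2 * ?g 2"
    using g0 \<tau> by linarith
  have "a = 4 \<or> a = 3 \<or> a = 2 \<or> a = 1 \<or> a = 0" "b = 4 \<or> b = 3 \<or> b = 2 \<or> b = 1 \<or> b = 0"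
    using ab by auto
  then show ?thesis
    using ab(3) 33 32 31 22 avoid_mix(1)[of \<delta> \<tau>]
    by (elim disjE) (simp_all add: mult.commute)
qed

section \<open>Exit probabilities of boxes and their derivative\<close>

text \<open>Half-open with even ends, so that the box is a union of 2x2 blocks.\<close>

definition boxn :: "nat \<Rightarrow> (int \<times> int) set" where
  "boxn n = {- 2 * int n..<2 * int n} \<times> {- 2 * int n..<2 * int n}"

lemma finite_boxn [simp]: "finite (boxn n)"
  by (simp add: boxn_def)

lemma block_boxn: "x \<in> boxn n \<Longrightarrow> block x \<subseteq> boxn n"
proof -
  have *: "flip a \<in> {- 2 * int n..<2 * int n}" if "a \<in> {- 2 * int n..<2 * int n}" for a
    using that unfolding flip_def by (simp split: if_split) presburger
  assume "x \<in> boxn n"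
  then show ?thesis using * by (auto simp: block_def boxn_def)
qed

definition conn :: "real \<Rightarrow> real \<Rightarrow> (int \<times> int) set \<Rightarrow> int \<times> int \<Rightarrow> real" where
  "conn \<delta> \<tau> V a = wsum V nb (\<lambda>_ s. mix \<delta> \<tau> (card s)) (\<lambda>c. of_bool (hits V (- V) c a))"

lemma mix_total: "(\<Sum>s\<in>Pow (nb q). mix \<delta> \<tau> (card s)) = 1"
  by (simp add: sum_Pow_card avoid_mix)

text \<open>Here 32 is the inverse of the bound in \<open>mix_ge\<close>, 20 bounds the number of
  resampled vertices, and 4 the number of vertices whose surgery can end at the same place.\<close>

definition surgery_const :: real where
  "surgery_const = 4 * 32 ^ 20"

text \<open>Makes \<open>small / 8 * surgery_const\<close> equal to 1/64, half of the gain 1/32 of a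
  pivotal vertex with two useful neighbours.\<close>

definition small :: real where
  "small = 1 / (8 * surgery_const)"

lemma small_bounds: "0 < small" "small \<le> 1 / 100" "small \<le> 1"
  by (simp_all add: small_def surgery_const_def)

lemma card_block: "card (block x) \<le> 4"
  unfolding block_def card_cartesian_product by simp

lemma card_hood: "card (hood q) \<le> 20"
proof -
  note b = card_block
  have "card (\<Union>x\<in>block q. nb x) \<le> (\<Sum>x\<in>block q. card (nb x))"
    by (rule card_UN_le) (simp add: block_def)
  also have "\<dots> \<le> 16" using b[of q] by simp
  finally have "card (block q) + card (\<Union>x\<in>block q. nb x) \<le> 20" using b[of q] by simp
  then show ?thesis
    unfolding hood_def using card_Un_le[of "block q" "\<Union>x\<in>block q. nb x"] by linarith
qed

text \<open>Surgery followed by resampling bounds each term by the vertices of its own block;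
  exchanging the sums counts every vertex at most 4 times.\<close>

lemma sum_piv_le:
  assumes V: "finite V" "\<And>x. x \<in> V \<Longrightarrow> block x \<subseteq> V"
    and \<delta>: "0 \<le> \<delta>" "\<delta> \<le> 1" and \<tau>: "0 \<le> \<tau>" "\<tau> \<le> 1"
  defines "w \<equiv> \<lambda>_ s. mix \<delta> \<tau> (card s)"
  shows "(\<Sum>q\<in>V. wsum V nb w (\<lambda>c. of_bool (piv V (- V) a q c \<and> nb q \<inter> exits V (- V) q c \<noteq> {}))) \<le>
    surgery_const * (\<Sum>q\<in>V. wsum V nb w (\<lambda>c. of_bool (piv V (- V) a q c \<and> 2 \<le> card (nb q \<inter> exits V (- V) q c))))"
proof -
  let ?P2 = "\<lambda>q c. piv V (- V) a q c \<and> 2 \<le> card (nb q \<inter> exits V (- V) q c)"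
  have w: "1 / 32 \<le> w q s" for q s unfolding w_def using mix_ge[OF \<delta> \<tau>] .
  have w0: "0 \<le> w q s" for q s using w[of q s] by linarith
  have tot: "(\<Sum>s\<in>Pow (nb q). w q s) = 1" for q by (simp only: w_def mix_total)
  have one: "wsum V nb w (\<lambda>c. of_bool (piv V (- V) a q c \<and> nb q \<inter> exits V (- V) q c \<noteq> {})) \<le>
      32 ^ 20 * (\<Sum>s\<in>block q. wsum V nb w (\<lambda>c. of_bool (?P2 s c)))" if q: "q \<in> V" for q
  proof -
    define Q where "Q = hood q \<inter> V"
    define E where "E c \<longleftrightarrow> (\<exists>s\<in>block q. ?P2 s c)" for c
    have "wsum V nb w (\<lambda>c. of_bool (piv V (- V) a q c \<and> nb q \<inter> exits V (- V) q c \<noteq> {})) \<le>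
      wsum V nb w (\<lambda>c. of_bool (\<exists>c'. (\<forall>x. x \<notin> Q \<longrightarrow> c' x = c x) \<and> (\<forall>x\<in>Q. c' x \<subseteq> nb x) \<and> E c'))"
    proof (intro wsum_mono w0 of_bool_mono)
      fix c assume c: "c \<in> PiE V (\<lambda>q. Pow (nb q))" and p: "piv V (- V) a q c \<and> nb q \<inter> exits V (- V) q c \<noteq> {}"
      have "\<And>x. x \<in> V \<Longrightarrow> c x \<subseteq> nb x" using c by (simp add: PiE_iff)
      with V(2) q obtain c' s where
        "\<And>x. x \<notin> hood q \<inter> V \<Longrightarrow> c' x = c x" "\<And>x. x \<in> hood q \<inter> V \<Longrightarrow> c' x \<subseteq> nb x"
        "s \<in> block q" "?P2 s c'"
        using p corner_surgery[of V q c a] by metis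
      then show "\<exists>c'. (\<forall>x. x \<notin> Q \<longrightarrow> c' x = c x) \<and> (\<forall>x\<in>Q. c' x \<subseteq> nb x) \<and> E c'"
        unfolding Q_def E_def by blast
    qed
    also have "\<dots> \<le> (1 / (1 / 32)) ^ card Q * wsum V nb w (\<lambda>c. of_bool (E c))"
      using V(1) w tot by (intro wsum_resample) (auto simp: Q_def)
    also have "\<dots> \<le> 32 ^ 20 * wsum V nb w (\<lambda>c. of_bool (E c))"
    proof (rule mult_right_mono)
      have "card Q \<le> 20"
        using card_mono[of "hood q" Q] card_hood[of q] by (simp add: Q_def)
      then show "(1 / (1 / 32)) ^ card Q \<le> (32 ^ 20 :: real)"
        by (simp add: power_increasing del: power_numeral)
    qed (use w0 in \<open>auto intro!: wsum_nonneg\<close>)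
    also have "\<dots> \<le> 32 ^ 20 * wsum V nb w (\<lambda>c. \<Sum>s\<in>block q. of_bool (?P2 s c))"
    proof (intro mult_left_mono wsum_mono w0)
      fix c
      show "of_bool (E c) \<le> (\<Sum>s\<in>block q. of_bool (?P2 s c) :: real)"
      proof (cases "E c")
        case True
        then obtain s where s: "s \<in> block q" "?P2 s c" unfolding E_def by blast
        have "of_bool (?P2 s c) \<le> (\<Sum>s\<in>block q. of_bool (?P2 s c) :: real)"
          using s(1) by (intro member_le_sum) (simp_all add: block_def)
        with s(2) True show ?thesis by simp
      qed (simp add: sum_nonneg)
    qed simp
    finally show ?thesis by (simp only: wsum_sum)
  qed
  have "(\<Sum>q\<in>V. wsum V nb w (\<lambda>c. of_bool (piv V (- V) a q c \<and> nb q \<inter> exits V (- V) q c \<noteq> {}))) \<le>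
     (\<Sum>q\<in>V. 32 ^ 20 * (\<Sum>s\<in>block q. wsum V nb w (\<lambda>c. of_bool (?P2 s c))))"
    by (intro sum_mono one)
  also have "\<dots> = 32 ^ 20 * (\<Sum>q\<in>V. \<Sum>s | s \<in> V \<and> s \<in> block q. wsum V nb w (\<lambda>c. of_bool (?P2 s c)))"
  proof -
    have "{s. s \<in> V \<and> s \<in> block q} = block q" if "q \<in> V" for q using V(2)[OF that] by blast
    then show ?thesis by (simp only: sum_distrib_left cong: sum.cong)
  qed
  also have "\<dots> = 32 ^ 20 * (\<Sum>s\<in>V. \<Sum>q | q \<in> V \<and> s \<in> block q. wsum V nb w (\<lambda>c. of_bool (?P2 s c)))"
    by (subst sum.swap_restrict[OF V(1) V(1)]) (rule refl)
  also have "\<dots> \<le> 32 ^ 20 * (\<Sum>s\<in>V. 4 * wsum V nb w (\<lambda>c. of_bool (?P2 s c)))"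
  proof (intro mult_left_mono sum_mono)
    fix s
    have "{q. q \<in> V \<and> s \<in> block q} \<subseteq> block s"
    proof
      fix q assume "q \<in> {q. q \<in> V \<and> s \<in> block q}"
      then have "block s = block q" using block_eq by blast
      then show "q \<in> block s" by simp
    qed
    moreover have "finite (block s)" by (simp add: block_def)
    ultimately have "card {q. q \<in> V \<and> s \<in> block q} \<le> 4"
      using card_mono card_block[of s] le_trans by blast
    then have "real (card {q. q \<in> V \<and> s \<in> block q}) \<le> 4" by linarith
    moreover have "0 \<le> wsum V nb w (\<lambda>c. of_bool (?P2 s c))" using w0 by (intro wsum_nonneg) auto
    ultimately show "(\<Sum>q | q \<in> V \<and> s \<in> block q. wsum V nb w (\<lambda>c. of_bool (?P2 s c))) \<le>
        4 * wsum V nb w (\<lambda>c. of_bool (?P2 s c))"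
      by (simp add: mult_right_mono)
  qed simp
  finally show ?thesis
    by (simp add: surgery_const_def flip: sum_distrib_left)
qed

lemma conn_has_derivative:
  assumes V: "finite V" "\<And>x. x \<in> V \<Longrightarrow> block x \<subseteq> V" and \<tau>: "0 \<le> \<tau>" "\<tau> \<le> 1"
  obtains D where "((\<lambda>\<tau>. conn small \<tau> V a) has_real_derivative D) (at \<tau>)"
    "(\<Sum>q\<in>V. wsum V nb (\<lambda>_ s. mix small \<tau> (card s))
      (\<lambda>c. of_bool (piv V (- V) a q c \<and> nb q \<inter> exits V (- V) q c \<noteq> {}))) \<le> 64 * surgery_const * D"
proof -
  define w where "w = (\<lambda>\<tau> (_::int \<times> int) s. mix small \<tau> (card (s :: (int \<times> int) set)))"
  define u where "u = (\<lambda>(_::int \<times> int) s. bump small (card (s :: (int \<times> int) set)))"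
  let ?P1 = "\<lambda>q c. piv V (- V) a q c \<and> nb q \<inter> exits V (- V) q c \<noteq> {}"
  let ?P2 = "\<lambda>q c. piv V (- V) a q c \<and> 2 \<le> card (nb q \<inter> exits V (- V) q c)"
  let ?S1 = "\<Sum>q\<in>V. wsum V nb (w \<tau>) (\<lambda>c. of_bool (?P1 q c))"
  let ?S2 = "\<Sum>q\<in>V. wsum V nb (w \<tau>) (\<lambda>c. of_bool (?P2 q c))"
  define D where "D = (\<Sum>q\<in>V. wsum V nb ((w \<tau>)(q := u q)) (\<lambda>c. of_bool (hits V (- V) c a)))"
  have der: "((\<lambda>\<tau>. conn small \<tau> V a) has_real_derivative D) (at \<tau>)"
  proof -
    have "(\<lambda>\<tau>. conn small \<tau> V a) = (\<lambda>\<tau>. wsum V nb (w \<tau>) (\<lambda>c. of_bool (hits V (- V) c a)))"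
      by (simp add: conn_def w_def)
    then show ?thesis
      unfolding D_def
      by (simp only:)
         (rule wsum_has_derivative[OF V(1)], auto simp: w_def u_def mix_def intro!: derivative_eq_intros)
  qed
  have w0: "0 \<le> w \<tau> q s" for q s
    using mix_ge[of small \<tau> "card s"] small_bounds \<tau> by (simp add: w_def)
  \<comment> \<open>With j useful neighbours the sum is \<open>- avoid (bump small) (4 - j)\<close>:
    it is \<open>- small / 8\<close> for j = 1 and at least \<open>1 / 32 - small / 8\<close> for
    larger j.\<close>
  have pt: "1 / 32 * of_bool (2 \<le> card (nb q \<inter> A)) - small / 8 * of_bool (nb q \<inter> A \<noteq> {}) \<le>
      (\<Sum>s | s \<subseteq> nb q \<and> s \<inter> A \<noteq> {}. u q s)" for q A
  proof -
    have j: "card (nb q - A) = 4 - card (nb q \<inter> A)" "card (nb q \<inter> A) \<le> 4"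
      using card_Diff_subset_Int[of "nb q" A] card_mono[of "nb q" "nb q \<inter> A"] by auto
    have ne: "nb q \<inter> A \<noteq> {} \<longleftrightarrow> card (nb q \<inter> A) \<noteq> 0" by simp
    have "(\<Sum>s | s \<subseteq> nb q \<and> s \<inter> A \<noteq> {}. u q s) = - avoid (bump small) (card (nb q - A))"
      unfolding u_def by (simp add: sum_Pow_card_hit avoid_bump)
    then have S: "(\<Sum>s | s \<subseteq> nb q \<and> s \<inter> A \<noteq> {}. u q s) = - avoid (bump small) (4 - card (nb q \<inter> A))"
      unfolding j(1) .
    have "card (nb q \<inter> A) = 0 \<or> card (nb q \<inter> A) = 1 \<or> card (nb q \<inter> A) = 2 \<or>
        card (nb q \<inter> A) = 3 \<or> card (nb q \<inter> A) = 4"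
      using j(2) by arith
    then show ?thesis
      unfolding ne S using small_bounds by (elim disjE; simp only:; simp add: avoid_bump)
  qed
  have "1 / 32 * ?S2 - small / 8 * ?S1 = (\<Sum>q\<in>V. wsum V nb (w \<tau>) (\<lambda>c.
      1 / 32 * of_bool (?P2 q c) - small / 8 * of_bool (?P1 q c)))"
    by (simp only: wsum_diff wsum_cmult sum_subtractf sum_distrib_left)
  also have "\<dots> \<le> (\<Sum>q\<in>V. wsum V nb (w \<tau>) (\<lambda>c. of_bool (piv V (- V) a q c) *
      (\<Sum>s | s \<subseteq> nb q \<and> s \<inter> exits V (- V) q c \<noteq> {}. u q s)))"
  proof (intro sum_mono wsum_mono w0)
    fix q c
    show "1 / 32 * of_bool (?P2 q c) - small / 8 * of_bool (?P1 q c) \<le> of_bool (piv V (- V) a q c) *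
      (\<Sum>s | s \<subseteq> nb q \<and> s \<inter> exits V (- V) q c \<noteq> {}. u q s)"
      using pt[of q "exits V (- V) q c"] by (cases "piv V (- V) a q c") simp_all
  qed
  also have "\<dots> = D"
    unfolding D_def
  proof (intro sum.cong refl wsum_hits_signed_vertex[symmetric])
    show "(\<Sum>s\<in>Pow (nb q). u q s) = 0" for q by (simp add: u_def sum_Pow_card avoid_bump)
    show "(\<Sum>s\<in>Pow (nb q). w \<tau> q s) = 1" for q by (simp only: w_def mix_total)
  qed (use V in auto)
  finally have D: "1 / 32 * ?S2 - small / 8 * ?S1 \<le> D" .
  have "?S1 \<le> surgery_const * ?S2"
    unfolding w_def using V \<tau> small_bounds by (intro sum_piv_le) auto
  moreover have "0 < surgery_const" by (simp add: surgery_const_def)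
  \<comment> \<open>The loss \<open>small / 8 * ?S1\<close> is at most \<open>?S2 / 64\<close>, so
    \<open>D\<close> is at least \<open>?S2 / 64\<close>.\<close>
  ultimately have "?S1 \<le> 64 * surgery_const * D"
    using D by (simp add: small_def field_simps)
  then show thesis
    using that[OF der] unfolding w_def by simp
qed

subsection \<open>Absence of decay along the interpolation\<close>

lemma arcs_reindex:
  assumes "bij \<pi>"
  shows "(\<pi> x, \<pi> y) \<in> (arcs (\<pi> ` V) (\<lambda>z. \<pi> ` c (inv \<pi> z)))\<^sup>* \<longleftrightarrow> (x, y) \<in> (arcs V c)\<^sup>*"
proof -
  have inj: "inj \<pi>" using assms by (simp add: bij_def)
  let ?R = "arcs (\<pi> ` V) (\<lambda>z. \<pi> ` c (inv \<pi> z))"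
  have edge: "(\<pi> u, \<pi> v) \<in> ?R \<longleftrightarrow> (u, v) \<in> arcs V c" for u v
    unfolding arcs_def using inj by (simp add: inj_image_mem_iff inv_f_f)
  show ?thesis
  proof
    assume "(x, y) \<in> (arcs V c)\<^sup>*"
    then show "(\<pi> x, \<pi> y) \<in> ?R\<^sup>*"
    proof (induction rule: rtrancl_induct)
      case (step y z)
      from step.IH edge[THEN iffD2, OF step.hyps(2)] show ?case by (rule rtrancl.rtrancl_into_rtrancl)
    qed simp
  next
    assume "(\<pi> x, \<pi> y) \<in> ?R\<^sup>*"
    then have "(x, inv \<pi> (\<pi> y)) \<in> (arcs V c)\<^sup>*"
    proof (induction rule: rtrancl_induct)
      case base
      show ?case by (simp add: inv_f_f[OF inj])
    next
      case (step y z)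
      have "y = \<pi> (inv \<pi> y)" "z = \<pi> (inv \<pi> z)"
        using bij_is_surj[OF assms] by (simp_all add: surj_f_inv_f)
      then have "(inv \<pi> y, inv \<pi> z) \<in> arcs V c" using step.hyps(2) edge by metis
      with step.IH show ?case by (rule rtrancl.rtrancl_into_rtrancl)
    qed
    then show "(x, y) \<in> (arcs V c)\<^sup>*" by (simp add: inv_f_f[OF inj])
  qed
qed

lemma hits_reindex:
  assumes "bij \<pi>"
  shows "hits (\<pi> ` V) (- \<pi> ` V) (\<lambda>z. \<pi> ` c (inv \<pi> z)) (\<pi> x) \<longleftrightarrow> hits V (- V) c x"
proof -
  have "- \<pi> ` V = \<pi> ` (- V)" by (rule bij_image_Compl_eq[OF assms, symmetric])
  then show ?thesis by (simp add: hits_def arcs_reindex[OF assms])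
qed

lemma wsum_hits_reindex:
  assumes "finite V" "bij \<pi>"
    and "\<And>q. q \<in> V \<Longrightarrow> N' (\<pi> q) = \<pi> ` N q"
    and "\<And>q s. q \<in> V \<Longrightarrow> s \<subseteq> N q \<Longrightarrow> w' (\<pi> q) (\<pi> ` s) = w q s"
  shows "wsum (\<pi> ` V) N' w' (\<lambda>c. of_bool (hits (\<pi> ` V) (- \<pi> ` V) c (\<pi> a))) =
    wsum V N w (\<lambda>c. of_bool (hits V (- V) c a))"
proof -
  have "local_on (\<pi> ` V) (\<lambda>c. of_bool (hits (\<pi> ` V) (- \<pi> ` V) c (\<pi> a)) :: real)"
    by (rule local_on_comp[where g = of_bool, OF local_on_hits])
  then show ?thesis
    by (subst wsum_reindex[where N = N and w = w]) (use assms in \<open>auto simp: hits_reindex\<close>)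
qed

lemma nb_translate: "nb (x + y) = (\<lambda>z. z + y) ` nb x"
  by (cases x; cases y) (simp add: nb_def algebra_simps)

lemma conn_translate: "finite V \<Longrightarrow> conn \<delta> \<tau> ((\<lambda>z. z + y) ` V) (a + y) = conn \<delta> \<tau> V a"
  unfolding conn_def
proof (rule wsum_hits_reindex)
  show "bij (\<lambda>z. z + y)"
    by (rule bij_betw_byWitness[where f' = "\<lambda>z. z - y"]) auto
  show "mix \<delta> \<tau> (card ((\<lambda>z. z + y) ` s)) = mix \<delta> \<tau> (card s)" for s
    by (subst card_image) (auto simp: inj_on_def)
qed (simp_all add: nb_translate)

text \<open>A path that leaves the larger set leaves the smaller one on its way.\<close>

lemma hits_subregion:
  assumes "hits V (- V) c a" "W \<subseteq> V"
  shows "hits W (- W) c a"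
proof -
  obtain t where t: "t \<notin> V" "(a, t) \<in> (arcs V c)\<^sup>*" using assms(1) by (auto simp: hits_def)
  have "V - - W = W" using assms(2) by blast
  with reach_first_entry[OF t(2), of "- W"] show ?thesis
    using t(1) assms(2) unfolding hits_def by auto
qed

lemma conn_subregion:
  assumes "finite V" "W \<subseteq> V" "0 \<le> \<delta>" "\<delta> \<le> 1" "0 \<le> \<tau>" "\<tau> \<le> 1"
  shows "conn \<delta> \<tau> V a \<le> conn \<delta> \<tau> W a"
proof -
  have w0: "0 \<le> mix \<delta> \<tau> k" for k using mix_ge[OF assms(3-6), of k] by linarith
  have "conn \<delta> \<tau> V a \<le> wsum V nb (\<lambda>_ s. mix \<delta> \<tau> (card s)) (\<lambda>c. of_bool (hits W (- W) c a))"
    unfolding conn_def by (intro wsum_mono w0 of_bool_mono) (rule hits_subregion[OF _ assms(2)])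
  also have "\<dots> = conn \<delta> \<tau> W a"
    unfolding conn_def
    by (rule wsum_marginal[OF assms(1,2)])
       (auto simp: mix_total intro: local_on_comp[where g = of_bool, OF local_on_hits])
  finally show ?thesis .
qed

lemma conn_bounds:
  assumes "finite V" "0 \<le> \<delta>" "\<delta> \<le> 1" "0 \<le> \<tau>" "\<tau> \<le> 1"
  shows "0 \<le> conn \<delta> \<tau> V a" "conn \<delta> \<tau> V a \<le> 1"
proof -
  have w0: "0 \<le> mix \<delta> \<tau> k" for k using mix_ge[OF assms(2-), of k] by linarith
  show "0 \<le> conn \<delta> \<tau> V a" unfolding conn_def by (intro wsum_nonneg w0) simp
  have "conn \<delta> \<tau> V a \<le> wsum V nb (\<lambda>_ s. mix \<delta> \<tau> (card s)) (\<lambda>c. 1)"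
    unfolding conn_def by (intro wsum_mono w0) simp
  then show "conn \<delta> \<tau> V a \<le> 1" using assms(1) by (simp add: wsum_const mix_total)
qed

lemma boxn_translate:
  assumes "q \<in> boxn L" "y \<in> nb q"
  shows "(\<lambda>z. z + y) ` boxn n \<subseteq> boxn (n + Suc L)"
proof -
  have "\<bar>fst y - fst q\<bar> \<le> 1" "\<bar>snd y - snd q\<bar> \<le> 1"
    using assms(2) by (auto simp: nb_def)
  moreover have "\<bar>fst q\<bar> \<le> 2 * int L" "\<bar>snd q\<bar> \<le> 2 * int L"
    using assms(1) by (auto simp: boxn_def mem_Times_iff)
  ultimately have "\<bar>fst y\<bar> \<le> 2 * int L + 1" "\<bar>snd y\<bar> \<le> 2 * int L + 1"
    by linarith+
  then show ?thesis by (cases y) (auto simp: boxn_def)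
qed

lemma finite_subset_boxn:
  assumes "finite S" obtains L where "S \<subseteq> boxn L"
proof -
  define B where "B = Max (insert 0 ((\<lambda>x. \<bar>fst x\<bar> + \<bar>snd x\<bar>) ` S))"
  have "\<bar>fst x\<bar> + \<bar>snd x\<bar> \<le> B" if "x \<in> S" for x
    unfolding B_def using assms that by (intro Max_ge) auto
  moreover have "0 \<le> B" unfolding B_def using assms by (intro Max_ge) auto
  ultimately have "S \<subseteq> boxn (nat B + 1)"
    by (force simp: boxn_def)
  then show thesis by (rule that)
qed

text \<open>A neighbour of \<open>S\<close> may lie one step outside \<open>boxn L\<close>, hence
  \<open>Suc L\<close>: the translate of \<open>boxn n\<close> to that neighbour still fits into the
  large box. The 4 is the degree.\<close>

lemma conn_step:
  assumes "(0, 0) \<in> S" "S \<subseteq> boxn L" "0 \<le> \<delta>" "\<delta> \<le> 1" "0 \<le> \<tau>" "\<tau> \<le> 1"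
  shows "conn \<delta> \<tau> (boxn (n + Suc L)) (0, 0) \<le>
    4 * conn \<delta> \<tau> (boxn n) (0, 0) * bdry_conn nb (\<lambda>_ s. mix \<delta> \<tau> (card s)) (0, 0) S"
proof -
  define V where "V = boxn (n + Suc L)"
  have w0: "0 \<le> mix \<delta> \<tau> k" for k using mix_ge[OF assms(3-), of k] by linarith
  have SV: "S \<subseteq> V" using assms(2) by (auto simp: V_def boxn_def)
  have "wsum V nb (\<lambda>_ s. mix \<delta> \<tau> (card s)) (\<lambda>c. of_bool (hits V (- V) c (0, 0))) \<le>
     real 4 * conn \<delta> \<tau> (boxn n) (0, 0) * bdry_conn nb (\<lambda>_ s. mix \<delta> \<tau> (card s)) (0, 0) S"
  proof (rule wsum_hits_le_bdry)
    fix q y assume q: "q \<in> S" "y \<in> nb q"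
    have "(\<lambda>z. z + y) ` boxn n \<subseteq> V"
      unfolding V_def using q assms(2) by (intro boxn_translate[of q]) blast+
    then have "conn \<delta> \<tau> V y \<le> conn \<delta> \<tau> ((\<lambda>z. z + y) ` boxn n) y"
      using assms by (intro conn_subregion) (simp_all add: V_def)
    also have "\<dots> = conn \<delta> \<tau> (boxn n) (0, 0)"
      using conn_translate[of "boxn n" \<delta> \<tau> y "(0, 0)"] by (cases y) simp
    finally show "wsum V nb (\<lambda>_ s. mix \<delta> \<tau> (card s)) (\<lambda>c. of_bool (hits V (- V) c y)) \<le>
        conn \<delta> \<tau> (boxn n) (0, 0)"
      by (simp add: conn_def)
  qed (use SV assms w0 conn_bounds in \<open>simp_all add: V_def mix_total\<close>)
  then show ?thesis by (simp add: conn_def V_def)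
qed

text \<open>If the value were below 1/8, \<open>conn_step\<close> would at least halve the exit
  probability whenever the box grows by \<open>Suc L\<close>. This exponential decay contradicts the
  bound of order 1/n.\<close>

lemma bdry_conn_ge:
  assumes lower: "\<And>n. 1 / (4 * real n + 1) \<le> conn \<delta> \<tau> (boxn n) (0, 0)"
    and \<delta>\<tau>: "0 \<le> \<delta>" "\<delta> \<le> 1" "0 \<le> \<tau>" "\<tau> \<le> 1"
    and S: "finite S" "(0, 0) \<in> S"
  shows "1 / 8 \<le> bdry_conn nb (\<lambda>_ s. mix \<delta> \<tau> (card s)) (0, 0) S" (is "_ \<le> ?\<phi>")
proof (rule ccontr)
  assume "\<not> 1 / 8 \<le> ?\<phi>"
  then have phi: "4 * ?\<phi> \<le> 1 / 2" by simp
  obtain L where L: "S \<subseteq> boxn L" using finite_subset_boxn[OF S(1)] .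
  let ?\<theta> = "\<lambda>n. conn \<delta> \<tau> (boxn n) (0, 0)"
  have decay: "?\<theta> (k * Suc L) \<le> (1 / 2) ^ k" for k
  proof (induction k)
    case 0
    show ?case using conn_bounds[of "boxn 0" \<delta> \<tau> "(0, 0)"] \<delta>\<tau> by simp
  next
    case (Suc k)
    have "?\<theta> (k * Suc L + Suc L) \<le> ?\<theta> (k * Suc L) * (4 * ?\<phi>)"
      using conn_step[OF S(2) L \<delta>\<tau>, of "k * Suc L"] by (simp only: mult_ac)
    also have "\<dots> \<le> ?\<theta> (k * Suc L) * (1 / 2)"
      using phi conn_bounds[of "boxn (k * Suc L)" \<delta> \<tau> "(0, 0)"] \<delta>\<tau> by (intro mult_left_mono) auto
    also have "\<dots> \<le> (1 / 2) ^ k * (1 / 2)" using Suc by simp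
    finally have "?\<theta> (k * Suc L + Suc L) \<le> (1 / 2) ^ Suc k" by simp
    moreover have "k * Suc L + Suc L = Suc k * Suc L" by simp
    ultimately show ?case by (simp only:)
  qed
  have "(\<lambda>k. real k * (1 / 2) ^ k) \<longlonglongrightarrow> (0::real)"
    by (rule powser_times_n_limit_0) simp
  then have "(\<lambda>k. 4 * real (Suc L) * (real k * (1 / 2) ^ k) + (1 / 2) ^ k) \<longlonglongrightarrow> 4 * real (Suc L) * 0 + (0::real)"
    by (intro tendsto_intros LIMSEQ_realpow_zero) auto
  then have "\<forall>\<^sub>F k in sequentially. 4 * real (Suc L) * (real k * (1 / 2) ^ k) + (1 / 2) ^ k < (1::real)"
    by (rule order_tendstoD) simp
  then obtain k where k: "4 * real (Suc L) * (real k * (1 / 2) ^ k) + (1 / 2) ^ k < (1::real)"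
    by (meson eventually_sequentially le_refl)
  have "1 / (4 * real (k * Suc L) + 1) \<le> (1 / 2) ^ k"
    using lower[of "k * Suc L"] decay[of k] by linarith
  moreover have "0 < 4 * real (k * Suc L) + 1" by (rule add_nonneg_pos) simp_all
  ultimately have "1 \<le> (1 / 2) ^ k * (4 * real (k * Suc L) + 1)" by (simp only: pos_divide_le_eq)
  also have "\<dots> = 4 * real (Suc L) * (real k * (1 / 2) ^ k) + (1 / 2) ^ k"
    by (simp only: of_nat_mult distrib_left mult_1_right mult_ac)
  finally show False using k by simp
qed

text \<open>Either the value at \<tau> = 1 is at least 1/2, or by monotonicity all values are below
  1/2. Then the pivotal sum is at least 1/16 at every \<tau>, the derivative at least 1/16 divided
  by \<open>64 * surgery_const\<close>, and the mean value theorem gives the constant.\<close>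

lemma conn_one_ge:
  assumes lower: "\<And>n. 1 / (4 * real n + 1) \<le> conn small 0 (boxn n) (0, 0)"
    and n: "0 < n"
  shows "1 / (1024 * surgery_const) \<le> conn small 1 (boxn n) (0, 0)"
proof -
  have K: "1 \<le> surgery_const" by (simp add: surgery_const_def)
  define S1 where "S1 V \<tau> = (\<Sum>q\<in>V. wsum V nb (\<lambda>_ s. mix small \<tau> (card s))
      (\<lambda>c. of_bool (piv V (- V) (0, 0) q c \<and> nb q \<inter> exits V (- V) q c \<noteq> {})))" for V \<tau>
  have S1_nonneg: "0 \<le> S1 V \<tau>" if "0 \<le> \<tau>" "\<tau> \<le> 1" for V \<tau>
  proof -
    have "0 \<le> mix small \<tau> k" for k
      using mix_ge[of small \<tau> k] small_bounds that by linarith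
    then show ?thesis
      unfolding S1_def by (intro sum_nonneg wsum_nonneg) simp_all
  qed
  have ex: "\<exists>D. ((\<lambda>\<tau>. conn small \<tau> (boxn n) (0, 0)) has_real_derivative D) (at \<tau>) \<and>
      S1 (boxn n) \<tau> \<le> 64 * surgery_const * D" if "0 \<le> \<tau>" "\<tau> \<le> 1" for n \<tau>
    using conn_has_derivative[where V = "boxn n" and a = "(0, 0)", OF finite_boxn block_boxn that]
    unfolding S1_def by blast
  have mono: "conn small \<sigma> (boxn n) (0, 0) \<le> conn small \<tau> (boxn n) (0, 0)"
    if "0 \<le> \<sigma>" "\<sigma> \<le> \<tau>" "\<tau> \<le> 1" for n \<sigma> \<tau>
  proof (rule DERIV_nonneg_imp_nondecreasing[OF that(2)])
    fix x assume x: "\<sigma> \<le> x" "x \<le> \<tau>"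
    then have x': "0 \<le> x" "x \<le> 1" using that by auto
    from ex[OF x', of n] obtain D where
      D: "((\<lambda>\<tau>. conn small \<tau> (boxn n) (0, 0)) has_real_derivative D) (at x)"
        "S1 (boxn n) x \<le> 64 * surgery_const * D" by blast
    have "0 \<le> 64 * surgery_const * D" using S1_nonneg[OF x', of "boxn n"] D(2) by linarith
    then have "0 \<le> D" using K by (simp add: zero_le_mult_iff)
    with D(1) show "\<exists>y. ((\<lambda>\<tau>. conn small \<tau> (boxn n) (0, 0)) has_real_derivative y) (at x) \<and> 0 \<le> y"
      by blast
  qed
  have piv_ge: "1 / 8 * (1 - conn small \<tau> (boxn n) (0, 0)) \<le> S1 (boxn n) \<tau>" if \<tau>: "0 \<le> \<tau>" "\<tau> \<le> 1" for \<tau>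
    unfolding S1_def conn_def
  proof (rule wsum_piv_ge)
    show "(0, 0) \<in> boxn n" using n by (simp add: boxn_def)
    show "0 \<le> mix small \<tau> (card s)" for s :: "(int \<times> int) set"
      using mix_ge[of small \<tau> "card s"] small_bounds \<tau> by linarith
    show "(\<Sum>s\<in>Pow (nb q). of_bool (s \<inter> (A \<union> B) = {}) * mix small \<tau> (card s)) \<le>
        (\<Sum>s\<in>Pow (nb q). of_bool (s \<inter> A = {}) * mix small \<tau> (card s)) *
        (\<Sum>s\<in>Pow (nb q). of_bool (s \<inter> B = {}) * mix small \<tau> (card s))" if "A \<inter> B = {}" for q A B
    proof -
      have e: "nb q - (A \<union> B) = (nb q - A) \<inter> (nb q - B)" "(nb q - A) \<union> (nb q - B) = nb q"
        using that by blast+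
      have "card (nb q - A) + card (nb q - B) = 4 + card (nb q - (A \<union> B))"
        using card_Un_Int[of "nb q - A" "nb q - B"] e by simp
      moreover have "card (nb q - A) \<le> 4" "card (nb q - B) \<le> 4"
        using card_mono[of "nb q" "nb q - A"] card_mono[of "nb q" "nb q - B"] by auto
      ultimately show ?thesis
        unfolding sum_Pow_card_avoid[OF finite_nb]
        using avoid_mix_submult[of small \<tau> "card (nb q - A)" "card (nb q - B)"] small_bounds \<tau>
        by simp
    qed
    fix S assume S: "S \<subseteq> boxn n" "(0, 0) \<in> S"
    show "1 / 8 \<le> bdry_conn nb (\<lambda>_ s. mix small \<tau> (card s)) (0, 0) S"
    proof (rule bdry_conn_ge)
      show "1 / (4 * real m + 1) \<le> conn small \<tau> (boxn m) (0, 0)" for m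
        using lower[of m] mono[of 0 \<tau> m] \<tau> by linarith
    qed (use S small_bounds \<tau> finite_subset[OF S(1)] in auto)
  qed (simp_all add: mix_total)
  show ?thesis
  proof (cases "conn small 1 (boxn n) (0, 0) \<ge> 1 / 2")
    case True
    have "1 / (1024 * surgery_const) \<le> 1 / 2" using K by (simp add: field_simps)
    then show ?thesis using True by linarith
  next
    case False
    \<comment> \<open>The mean value theorem asks for the derivative as a function of
      \<tau>.\<close>
    define D where "D \<tau> = (SOME D. ((\<lambda>\<tau>. conn small \<tau> (boxn n) (0, 0)) has_real_derivative D) (at \<tau>) \<and>
      S1 (boxn n) \<tau> \<le> 64 * surgery_const * D)" for \<tau>
    have D: "((\<lambda>\<tau>. conn small \<tau> (boxn n) (0, 0)) has_real_derivative D \<tau>) (at \<tau>)"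
      "S1 (boxn n) \<tau> \<le> 64 * surgery_const * D \<tau>" if "0 \<le> \<tau>" "\<tau> \<le> 1" for \<tau>
      using someI_ex[OF ex[OF that, of n]] unfolding D_def by blast+
    obtain z where z: "0 < z" "z < 1"
      "conn small 1 (boxn n) (0, 0) - conn small 0 (boxn n) (0, 0) = (1 - 0) * D z"
      using MVT2[of 0 1 "\<lambda>\<tau>. conn small \<tau> (boxn n) (0, 0)" D] D(1) by auto
    have "conn small z (boxn n) (0, 0) < 1 / 2" using mono[of z 1 n] z False by linarith
    then have "1 / 16 \<le> 1 / 8 * (1 - conn small z (boxn n) (0, 0))" by simp
    also have "\<dots> \<le> S1 (boxn n) z" using z by (intro piv_ge) auto
    also have "\<dots> \<le> 64 * surgery_const * D z" using z by (intro D(2)) auto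
    finally have "1 / 16 \<le> 64 * surgery_const * D z" .
    then have "1 / (1024 * surgery_const) \<le> D z" using K by (simp add: field_simps)
    also have "D z \<le> conn small 1 (boxn n) (0, 0)"
      using z(3) conn_bounds(1)[of "boxn n" small 0 "(0, 0)"] small_bounds by simp
    finally show ?thesis .
  qed
qed

subsection \<open>Self-duality\<close>

definition uni :: "'a \<Rightarrow> 'b set \<Rightarrow> real" where
  "uni = (\<lambda>_ _. 1 / 16)"

text \<open>The midpoint of the crossed edge plus half the direction turned to the left;
  \<open>right_of\<close> subtracts it instead. For neighbouring faces the numerators are even, so
  \<open>div\<close> is exact.\<close>

definition left_of :: "int \<times> int \<Rightarrow> int \<times> int \<Rightarrow> int \<times> int" where
  "left_of f g = (let dx = fst g - fst f; dy = snd g - snd f in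
     (fst f + (1 + dx - dy) div 2, snd f + (1 + dx + dy) div 2))"

definition right_of :: "int \<times> int \<Rightarrow> int \<times> int \<Rightarrow> int \<times> int" where
  "right_of f g = (let dx = fst g - fst f; dy = snd g - snd f in
     (fst f + (1 + dx + dy) div 2, snd f + (1 - dx + dy) div 2))"

text \<open>The face with centre \<open>(i + 1/2, j + 1/2)\<close> is identified with \<open>(i, j)\<close>. The dual edge from
  \<open>f\<close> to \<open>g\<close> is open iff the directed edge crossing it from left to right is closed.\<close>

definition dual :: "(int \<times> int \<Rightarrow> (int \<times> int) set) \<Rightarrow> int \<times> int \<Rightarrow> (int \<times> int) set" where
  "dual c f = {g \<in> nb f. right_of f g \<notin> c (left_of f g)}"

lemma crossing_simps:
  "left_of (i, j) (i, j + 1) = (i, j + 1)" "right_of (i, j) (i, j + 1) = (i + 1, j + 1)"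
  "left_of (i, j) (i, j - 1) = (i + 1, j)" "right_of (i, j) (i, j - 1) = (i, j)"
  "left_of (i, j) (i + 1, j) = (i + 1, j + 1)" "right_of (i, j) (i + 1, j) = (i + 1, j)"
  "left_of (i, j) (i - 1, j) = (i, j)" "right_of (i, j) (i - 1, j) = (i, j + 1)"
  by (simp_all add: left_of_def right_of_def)

lemma nbE:
  assumes "g \<in> nb (i, j)"
  obtains "g = (i + 1, j)" | "g = (i - 1, j)" | "g = (i, j + 1)" | "g = (i, j - 1)"
  using assms by (auto simp: nb_def)

lemma right_of_nb: "g \<in> nb f \<Longrightarrow> right_of f g \<in> nb (left_of f g)"
  by (cases f) (auto elim!: nbE simp: crossing_simps, auto simp: nb_def)

lemma left_of_near: "g \<in> nb f \<Longrightarrow> fst (left_of f g) \<in> {fst f, fst f + 1} \<and> snd (left_of f g) \<in> {snd f, snd f + 1}"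
  by (cases f) (auto elim!: nbE simp: crossing_simps)

text \<open>The vector from the left to the right endpoint is the direction of the dual edge turned
  clockwise, so both faces can be recovered. Distinct dual edges therefore use distinct, independent
  directed edges.\<close>

lemma inj_on_crossing: "inj_on (\<lambda>(f, g). (left_of f g, right_of f g)) (Sigma V nb)"
proof (rule inj_on_inverseI)
  let ?h = "\<lambda>(u, v). let dx = snd u - snd v; dy = fst v - fst u;
     f = (fst u - (1 + dx - dy) div 2, snd u - (1 + dx + dy) div 2) in (f, (fst f + dx, snd f + dy))"
  fix e assume "e \<in> Sigma V nb"
  then obtain i j g where e: "e = ((i, j), g)" "g \<in> nb (i, j)" by (metis SigmaE prod.exhaust)
  from e(2) show "?h ((\<lambda>(f, g). (left_of f g, right_of f g)) e) = e"
    unfolding e(1) by (cases rule: nbE) (simp_all add: crossing_simps)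
qed

lemma card_Sigma_nb: "finite V \<Longrightarrow> card (Sigma V nb) = 4 * card V"
  by (simp add: card_SigmaI)

lemma wsum_uni_edges:
  assumes "finite V" "local_on V f"
  shows "2 ^ card (Sigma V nb) * wsum V nb uni f = (\<Sum>\<omega>\<in>Pow (Sigma V nb). f (\<lambda>q. \<omega> `` {q}))"
proof -
  have "wsum V nb uni f = (1 / 16) ^ card V * (\<Sum>c\<in>PiE V (\<lambda>q. Pow (nb q)). f c)"
    unfolding wsum_def uni_def by (simp add: sum_distrib_left)
  moreover have "(2::real) ^ card (Sigma V nb) * (1 / 16) ^ card V = 1"
    unfolding card_Sigma_nb[OF assms(1)] by (simp add: power_mult power_one_over)
  moreover have "(\<Sum>c\<in>PiE V (\<lambda>q. Pow (nb q)). f c) = (\<Sum>\<omega>\<in>Pow (Sigma V nb). f (\<lambda>q. \<omega> `` {q}))"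
  proof (rule sum.reindex_bij_witness[where i = "\<lambda>\<omega>. restrict (\<lambda>q. \<omega> `` {q}) V" and j = "\<lambda>c. Sigma V c"])
    fix c assume c: "c \<in> PiE V (\<lambda>q. Pow (nb q))"
    show "restrict (\<lambda>q. Sigma V c `` {q}) V = c"
      using c by (intro ext) (auto simp: PiE_iff extensional_def)
    show "Sigma V c \<in> Pow (Sigma V nb)" using c by (auto simp: PiE_iff)
    show "f (\<lambda>q. Sigma V c `` {q}) = f c"
      by (rule local_onD[OF assms(2)]) auto
  next
    fix \<omega> assume \<omega>: "\<omega> \<in> Pow (Sigma V nb)"
    show "Sigma V (restrict (\<lambda>q. \<omega> `` {q}) V) = \<omega>" using \<omega> by (auto simp: restrict_def split: if_splits)
    show "restrict (\<lambda>q. \<omega> `` {q}) V \<in> PiE V (\<lambda>q. Pow (nb q))" using \<omega> by auto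
  qed
  ultimately show ?thesis by (metis (no_types, lifting) mult.assoc mult_1)
qed

text \<open>A uniform subset of \<open>A\<close>, pulled back along an injection and complemented,
  is a uniform subset of \<open>B\<close>. The elements of \<open>A\<close> outside the image are
  free and give the power of 2.\<close>

lemma sum_Pow_complement:
  fixes F :: "'a set \<Rightarrow> real"
  assumes "finite A" "inj_on \<phi> B" "\<phi> ` B \<subseteq> A"
  shows "(\<Sum>\<omega>\<in>Pow A. F {e \<in> B. \<phi> e \<notin> \<omega>}) * 2 ^ card B = 2 ^ card A * (\<Sum>\<omega>\<in>Pow B. F \<omega>)"
proof -
  define R where "R = A - \<phi> ` B"
  have "(\<Sum>\<omega>\<in>Pow A. F {e \<in> B. \<phi> e \<notin> \<omega>}) = (\<Sum>(\<omega>, \<rho>)\<in>Pow B \<times> Pow R. F \<omega>)"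
  proof (rule sum.reindex_bij_witness[where j = "\<lambda>\<omega>. ({e \<in> B. \<phi> e \<notin> \<omega>}, \<omega> - \<phi> ` B)"
        and i = "\<lambda>(\<omega>, \<rho>). \<phi> ` (B - \<omega>) \<union> \<rho>"])
    fix p assume "p \<in> Pow B \<times> Pow R"
    then obtain \<omega> \<rho> where p: "p = (\<omega>, \<rho>)" "\<omega> \<subseteq> B" "\<rho> \<subseteq> R" by auto
    have "{e \<in> B. \<phi> e \<notin> \<phi> ` (B - \<omega>) \<union> \<rho>} = \<omega>"
      using p inj_onD[OF assms(2)] by (auto simp: R_def)
    moreover have "\<phi> ` (B - \<omega>) \<union> \<rho> - \<phi> ` B = \<rho>" using p by (auto simp: R_def)
    ultimately show "({e \<in> B. \<phi> e \<notin> (case p of (\<omega>, \<rho>) \<Rightarrow> \<phi> ` (B - \<omega>) \<union> \<rho>)},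
        (case p of (\<omega>, \<rho>) \<Rightarrow> \<phi> ` (B - \<omega>) \<union> \<rho>) - \<phi> ` B) = p"
      by (simp add: p(1))
    show "(case p of (\<omega>, \<rho>) \<Rightarrow> \<phi> ` (B - \<omega>) \<union> \<rho>) \<in> Pow A"
      using p assms(3) by (auto simp: R_def)
  qed (auto simp: R_def)
  also have "\<dots> = (\<Sum>\<omega>\<in>Pow B. \<Sum>\<rho>\<in>Pow R. F \<omega>)" by (rule sum.cartesian_product[symmetric])
  also have "\<dots> = 2 ^ card R * (\<Sum>\<omega>\<in>Pow B. F \<omega>)"
    using assms(1) by (simp add: card_Pow R_def sum_distrib_left)
  finally have "(\<Sum>\<omega>\<in>Pow A. F {e \<in> B. \<phi> e \<notin> \<omega>}) = 2 ^ card R * (\<Sum>\<omega>\<in>Pow B. F \<omega>)" .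
  moreover have "card A = card R + card B"
    unfolding R_def card_image[OF assms(2), symmetric]
    using assms(1,3) finite_subset[OF assms(3,1)] by (simp add: card_Diff_subset card_mono)
  ultimately show ?thesis by (simp add: power_add)
qed

text \<open>Self-duality: at density 1/2 closed edges are distributed like open ones, so the dual
  configuration has the law of the primal one.\<close>

lemma wsum_uni_dual:
  assumes W: "finite W" and V: "finite V" "\<And>f g. f \<in> V \<Longrightarrow> g \<in> nb f \<Longrightarrow> left_of f g \<in> W"
    and G: "local_on V G"
  shows "wsum W nb uni (\<lambda>c. G (dual c)) = wsum V nb uni G"
proof -
  let ?\<phi> = "\<lambda>(f, g). (left_of f g, right_of f g)"
  let ?A = "Sigma W nb" and ?B = "Sigma V nb"
  have loc: "local_on W (\<lambda>c. G (dual c))"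
    unfolding local_on_def
  proof (intro allI impI)
    fix c c' :: "int \<times> int \<Rightarrow> (int \<times> int) set" assume "\<forall>q\<in>W. c q = c' q"
    then show "G (dual c) = G (dual c')"
      using V(2) by (intro local_onD[OF G]) (auto simp: dual_def)
  qed
  have "2 ^ card ?A * wsum W nb uni (\<lambda>c. G (dual c)) = (\<Sum>\<omega>\<in>Pow ?A. G (dual (\<lambda>q. \<omega> `` {q})))"
    by (rule wsum_uni_edges[OF W loc])
  also have "\<dots> = (\<Sum>\<omega>\<in>Pow ?A. G (\<lambda>q. {e \<in> ?B. ?\<phi> e \<notin> \<omega>} `` {q}))"
  proof (rule sum.cong[OF refl])
    fix \<omega>
    show "G (dual (\<lambda>q. \<omega> `` {q})) = G (\<lambda>q. {e \<in> ?B. ?\<phi> e \<notin> \<omega>} `` {q})"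
      by (rule local_onD[OF G]) (auto simp: dual_def)
  qed
  finally have 1: "2 ^ card ?A * wsum W nb uni (\<lambda>c. G (dual c)) =
    (\<Sum>\<omega>\<in>Pow ?A. G (\<lambda>q. {e \<in> ?B. ?\<phi> e \<notin> \<omega>} `` {q}))" .
  have "?\<phi> ` ?B \<subseteq> ?A" using V(2) right_of_nb by auto
  then have "(\<Sum>\<omega>\<in>Pow ?A. G (\<lambda>q. {e \<in> ?B. ?\<phi> e \<notin> \<omega>} `` {q})) * 2 ^ card ?B =
      2 ^ card ?A * (\<Sum>\<omega>\<in>Pow ?B. G (\<lambda>q. \<omega> `` {q}))"
    using W by (intro sum_Pow_complement[where F = "\<lambda>\<omega>. G (\<lambda>q. \<omega> `` {q})"] inj_on_crossing) auto
  also have "(\<Sum>\<omega>\<in>Pow ?B. G (\<lambda>q. \<omega> `` {q})) = 2 ^ card ?B * wsum V nb uni G"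
    by (rule wsum_uni_edges[OF V(1) G, symmetric])
  finally show ?thesis unfolding 1[symmetric] by simp
qed

section \<open>Planarity by a discrete flux, and the bound for independent edges\<close>

text \<open>Summation by parts: the interior terms are those assumed nonpositive, and only the
  boundary term at \<open>m\<close> remains.\<close>

lemma abel_le:
  fixes g \<xi> :: "nat \<Rightarrow> int"
  assumes "g 0 = 0" "\<And>i. 0 < i \<Longrightarrow> i < m \<Longrightarrow> g i * (\<xi> i - \<xi> (i - 1)) \<le> 0" "0 < m"
  shows "(\<Sum>i<m. (g i - g (Suc i)) * \<xi> i) \<le> - (g m * \<xi> (m - 1))"
  using assms(3,2)
proof (induction m rule: nat_induct_non_zero)
  case 1
  then show ?case using assms(1) by simp
next
  case (Suc m)
  have "(\<Sum>i<m. (g i - g (Suc i)) * \<xi> i) \<le> - (g m * \<xi> (m - 1))" using Suc by simp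
  moreover have "g m * (\<xi> m - \<xi> (m - 1)) \<le> 0" using Suc by simp
  ultimately show ?case by (simp add: algebra_simps)
qed

text \<open>The flux of dual edges out of the faces that are reachable from below is the discrete
  replacement for planarity.\<close>

lemma crossing_or_dual_crossing:
  fixes A B :: nat
  assumes A: "0 < A"
  defines "R \<equiv> {0..int A} \<times> {0..int B}" and "D \<equiv> {0..<int A} \<times> {- 1..<int B}"
  shows "(\<exists>j\<in>{0..int B}. \<exists>j'\<in>{0..int B}. ((0, j), (int A, j')) \<in> (arcs R c)\<^sup>*) \<or>
    (\<exists>i\<in>{0..<int A}. \<exists>i'\<in>{0..<int A}. ((i, - 1), (i', int B)) \<in> (arcs D (dual c))\<^sup>*)"
proof (rule ccontr)
  assume no: "\<not> ?thesis"
  define F where "F = {x. x \<in> R \<and> (\<exists>j\<in>{0..int B}. ((0, j), x) \<in> (arcs R c)\<^sup>*)}"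
  define X where "X = {f. \<exists>i\<in>{0..<int A}. ((i, - 1), f) \<in> (arcs D (dual c))\<^sup>*}"
  define \<phi> where "\<phi> i j = (of_bool ((int i, int j) \<in> F) :: int)" for i j
  define \<xi> where "\<xi> i j = (of_bool ((int i, j) \<in> X) :: int)" for i j
  have F0: "\<phi> 0 j = 1" if "j \<le> B" for j using that by (auto simp: \<phi>_def F_def R_def)
  have FA: "\<phi> A j = 0" if "j \<le> B" for j using that no by (auto simp: \<phi>_def F_def R_def)
  have X0: "\<xi> i (- 1) = 1" if "i < A" for i using that by (auto simp: \<xi>_def X_def)
  have XB: "\<xi> i (int B) = 0" if "i < A" for i using that no by (auto simp: \<xi>_def X_def)
  have closed: "y \<notin> c x" if xF: "x \<in> F" "y \<in> R" "y \<notin> F" for x y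
  proof
    assume "y \<in> c x"
    obtain j where j: "j \<in> {0..int B}" "((0, j), x) \<in> (arcs R c)\<^sup>*" using xF unfolding F_def by blast
    have "(x, y) \<in> arcs R c" using that(1) \<open>y \<in> c x\<close> by (simp add: F_def arcs_def)
    with j(2) have "((0, j), y) \<in> (arcs R c)\<^sup>*" by (rule rtrancl.rtrancl_into_rtrancl)
    then show False using that j(1) unfolding F_def by blast
  qed
  have Xstep: "g \<in> X" if fX: "f \<in> X" "f \<in> D" "g \<in> nb f" "left_of f g \<in> F" "right_of f g \<in> R" "right_of f g \<notin> F" for f g
  proof -
    obtain i where i: "i \<in> {0..<int A}" "((i, - 1), f) \<in> (arcs D (dual c))\<^sup>*" using fX unfolding X_def by blast
    have "(f, g) \<in> arcs D (dual c)" using closed[OF that(4-6)] that(2,3) by (simp add: arcs_def dual_def)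
    with i(2) have "((i, - 1), g) \<in> (arcs D (dual c))\<^sup>*" by (rule rtrancl.rtrancl_into_rtrancl)
    then show ?thesis using i(1) unfolding X_def by blast
  qed
  \<comment> \<open>A horizontal edge leaving \<open>F\<close> to the right is closed, so the dual
    step upwards across it is open; one leaving \<open>F\<close> to the left opens the step
    downwards. In both cases evaluating \<open>\<xi>\<close> at the upper instead of the lower face
    cannot decrease the signed term.\<close>
  have up: "(\<phi> i j - \<phi> (Suc i) j) * \<xi> i (int j - 1) \<le> (\<phi> i j - \<phi> (Suc i) j) * \<xi> i (int j)"
    if "i < A" "j \<le> B" for i j
  proof -
    have R: "(int i, int j) \<in> R" "(int i + 1, int j) \<in> R" using that by (auto simp: R_def)
    have "(int i, int j) \<in> X" if "(int i, int j - 1) \<in> X" "(int i, int j) \<in> F" "(int i + 1, int j) \<notin> F"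
      using Xstep[of "(int i, int j - 1)" "(int i, int j)"] crossing_simps(1,2)[of "int i" "int j - 1"]
        that R \<open>i < A\<close> \<open>j \<le> B\<close> by (simp add: D_def nb_def)
    moreover have "(int i, int j - 1) \<in> X" if "(int i, int j) \<in> X" "(int i, int j) \<notin> F" "(int i + 1, int j) \<in> F"
    proof -
      have "j \<noteq> B" using XB[OF \<open>i < A\<close>] that(1) by (auto simp: \<xi>_def)
      then show ?thesis
        using Xstep[of "(int i, int j)" "(int i, int j - 1)"] crossing_simps(3,4)[of "int i" "int j"]
        that R \<open>i < A\<close> \<open>j \<le> B\<close> by (simp add: D_def nb_def)
    qed
    ultimately show ?thesis by (auto simp: \<phi>_def \<xi>_def add.commute)
  qed
  \<comment> \<open>The same faces are kept while the row of edges moves from below to above them.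
    By summation by parts the change is carried by the vertical edges between these faces, where
    open dual steps to the left and right fix the sign.\<close>
  have side: "(\<Sum>i<A. (\<phi> i j - \<phi> (Suc i) j) * \<xi> i (int j)) \<le>
      (\<Sum>i<A. (\<phi> i (Suc j) - \<phi> (Suc i) (Suc j)) * \<xi> i (int j))" if j: "j < B" for j
  proof -
    define g where "g i = \<phi> i j - \<phi> i (Suc j)" for i
    have "(\<Sum>i<A. (g i - g (Suc i)) * \<xi> i (int j)) \<le> - (g A * \<xi> (A - 1) (int j))"
    proof (rule abel_le[OF _ _ A])
      show "g 0 = 0" using F0 j by (simp add: g_def)
      fix i assume i: "0 < i" "i < A"
      have ii: "int (i - Suc 0) = int i - 1" using i by simp
      have R: "(int i, int j) \<in> R" "(int i, int j + 1) \<in> R" using i j by (auto simp: R_def)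
      have "(int i - 1, int j) \<in> X" if "(int i, int j) \<in> X" "(int i, int j) \<in> F" "(int i, int j + 1) \<notin> F"
        using Xstep[of "(int i, int j)" "(int i - 1, int j)"] crossing_simps(7,8)[of "int i" "int j"]
          that R i j by (simp add: D_def nb_def)
      moreover have "(int i, int j) \<in> X" if "(int i - 1, int j) \<in> X" "(int i, int j) \<notin> F" "(int i, int j + 1) \<in> F"
        using Xstep[of "(int i - 1, int j)" "(int i, int j)"] crossing_simps(5,6)[of "int i - 1" "int j"]
          that R i j by (simp add: D_def nb_def)
      ultimately show "g i * (\<xi> i (int j) - \<xi> (i - 1) (int j)) \<le> 0"
        by (auto simp: g_def \<phi>_def \<xi>_def ii add.commute)
    qed
    also have "g A = 0" using FA j by (simp add: g_def)
    finally show ?thesis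
      by (simp add: g_def sum_subtractf sum.distrib algebra_simps)
  qed
  \<comment> \<open>At the bottom all faces are reached and the sum telescopes to 1; it never
    decreases on the way up. In the top row no face is reached, so it would have to be 0.\<close>
  have flux: "1 \<le> (\<Sum>i<A. (\<phi> i j - \<phi> (Suc i) j) * \<xi> i (int j))" if "j \<le> B" for j
    using that
  proof (induction j)
    case 0
    have "(\<Sum>i<A. (\<phi> i 0 - \<phi> (Suc i) 0) * \<xi> i (- 1)) = (\<Sum>i<A. \<phi> i 0 - \<phi> (Suc i) 0)"
      by (intro sum.cong refl) (simp add: X0)
    also have "\<dots> = 1" using sum_lessThan_telescope'[of "\<lambda>i. \<phi> i 0" A] F0 FA by simp
    finally have "1 = (\<Sum>i<A. (\<phi> i 0 - \<phi> (Suc i) 0) * \<xi> i (int 0 - 1))" by simp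
    also have "\<dots> \<le> (\<Sum>i<A. (\<phi> i 0 - \<phi> (Suc i) 0) * \<xi> i (int 0))"
      by (intro sum_mono up) auto
    finally show ?case .
  next
    case (Suc j)
    then have "1 \<le> (\<Sum>i<A. (\<phi> i j - \<phi> (Suc i) j) * \<xi> i (int j))" by simp
    also have "\<dots> \<le> (\<Sum>i<A. (\<phi> i (Suc j) - \<phi> (Suc i) (Suc j)) * \<xi> i (int j))"
      using Suc.prems by (intro side) simp
    also have "\<dots> = (\<Sum>i<A. (\<phi> i (Suc j) - \<phi> (Suc i) (Suc j)) * \<xi> i (int (Suc j) - 1))"
      by simp
    also have "\<dots> \<le> (\<Sum>i<A. (\<phi> i (Suc j) - \<phi> (Suc i) (Suc j)) * \<xi> i (int (Suc j)))"
      using Suc.prems by (intro sum_mono up) auto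
    finally show ?case .
  qed
  have "(\<Sum>i<A. (\<phi> i B - \<phi> (Suc i) B) * \<xi> i (int B)) = 0"
    by (intro sum.neutral) (simp add: XB)
  with flux[of B] show False by simp
qed

lemma hits_of_exit:
  assumes "(a, t) \<in> (arcs R c)\<^sup>*" "t \<notin> V"
  shows "hits V (- V) c a"
  using hits_subregion[of "R \<union> V" c a V] reach_first_entry[OF assms(1), of "- V"] assms(2)
  by (auto simp: hits_def intro: arcs_rtrancl_mono)

text \<open>A union bound over the 2n + 1 starting points of a horizontal crossing of a square of
  side 2n and the 2n starting points of a dual vertical one. A crossing moves by at least 2n in the
  positive direction of one coordinate and thus leaves the half-open box centred at its
  start.\<close>

lemma conn_zero_ge: "1 / (4 * real n + 1) \<le> conn \<delta> 0 (boxn n) (0, 0)"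
proof (cases "n = 0")
  case True
  then have "boxn n = {}" by (simp add: boxn_def)
  then show ?thesis using True by (simp add: conn_def hits_refl)
next
  case False
  \<comment> \<open>Large enough for all translated boxes and for the left endpoints of the edges
    crossed in the dual ones.\<close>
  define W where "W = boxn (2 * n + 2)"
  define \<theta> where "\<theta> = conn \<delta> 0 (boxn n) (0, 0)"
  define A where "A = 2 * n"
  define T where "T y = (\<lambda>z. z + y) ` boxn n" for y :: "int \<times> int"
  have uni: "conn \<delta> 0 V a = wsum V nb uni (\<lambda>c. of_bool (hits V (- V) c a))" for V a
    by (simp add: conn_def uni_def mix_def)
  have tot: "(\<Sum>s\<in>Pow (nb q). uni q s) = 1" for q :: "int \<times> int"
    by (simp add: uni_def card_Pow)
  have finT: "finite (T y)" for y by (simp add: T_def)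
  have T: "wsum (T y) nb uni (\<lambda>c. of_bool (hits (T y) (- T y) c y)) = \<theta>" for y
    using conn_translate[of "boxn n" \<delta> 0 y "(0, 0)"] uni by (cases y) (simp add: T_def \<theta>_def)
  have memT: "(x1, x2) \<in> T (y1, y2) \<longleftrightarrow> x1 - y1 \<in> {- 2 * int n..<2 * int n} \<and> x2 - y2 \<in> {- 2 * int n..<2 * int n}"
    for x1 x2 y1 y2
  proof -
    have "z \<in> T y \<longleftrightarrow> z - y \<in> boxn n" for z y
      unfolding T_def by (metis (no_types, lifting) add_diff_cancel diff_add_cancel image_iff)
    then show ?thesis by (simp add: boxn_def)
  qed
  have loc: "local_on (T y) (\<lambda>c. of_bool (hits (T y) (- T y) c y) :: real)" for y
    by (rule local_on_comp[where g = of_bool, OF local_on_hits])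
  have primal: "wsum W nb uni (\<lambda>c. of_bool (hits (T (0, j)) (- T (0, j)) c (0, j))) = \<theta>"
    if "j \<in> {0..int A}" for j
  proof -
    have "T (0, j) \<subseteq> W" using that by (auto simp: memT W_def boxn_def A_def)
    then show ?thesis
      using wsum_marginal[OF _ _ loc tot, of W "(0, j)"] T[of "(0, j)"] by (simp add: W_def)
  qed
  have dual: "wsum W nb uni (\<lambda>c. of_bool (hits (T (i, - 1)) (- T (i, - 1)) (dual c) (i, - 1))) = \<theta>"
    if "i \<in> {0..<int A}" for i
    unfolding T[of "(i, - 1)", symmetric]
  proof (rule wsum_uni_dual)
    fix f g assume f: "f \<in> T (i, - 1)" "g \<in> nb f"
    obtain f1 f2 where f12: "f = (f1, f2)" by (cases f)
    have "fst (left_of f g) \<in> {f1, f1 + 1}" "snd (left_of f g) \<in> {f2, f2 + 1}"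
      using left_of_near[OF f(2)] by (simp_all add: f12)
    then show "left_of f g \<in> W"
      using f(1) that unfolding f12 memT W_def boxn_def A_def by (auto simp: mem_Times_iff)
  qed (simp_all add: W_def finT loc)
  have cover: "1 \<le> (\<Sum>j\<in>{0..int A}. of_bool (hits (T (0, j)) (- T (0, j)) c (0, j))) +
      (\<Sum>i\<in>{0..<int A}. of_bool (hits (T (i, - 1)) (- T (i, - 1)) (dual c) (i, - 1)) :: real)"
    (is "1 \<le> ?P + ?D") for c
  proof -
    have nn: "0 \<le> ?P" "0 \<le> ?D" by (auto intro!: sum_nonneg)
    have "0 < A" using False by (simp add: A_def)
    from crossing_or_dual_crossing[OF this, of A c] show ?thesis
    proof
      assume "\<exists>j\<in>{0..int A}. \<exists>j'\<in>{0..int A}. ((0, j), (int A, j')) \<in> (arcs ({0..int A} \<times> {0..int A}) c)\<^sup>*"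
      then obtain j j' where j: "j \<in> {0..int A}"
        "((0, j), (int A, j')) \<in> (arcs ({0..int A} \<times> {0..int A}) c)\<^sup>*" by blast
      have "(int A, j') \<notin> T (0, j)" by (simp add: memT A_def)
      then have "hits (T (0, j)) (- T (0, j)) c (0, j)" using j(2) by (intro hits_of_exit)
      then have "1 \<le> ?P" using j(1) member_le_sum[of j "{0..int A}" "\<lambda>j. of_bool (hits (T (0, j)) (- T (0, j)) c (0, j)) :: real"]
        by simp
      then show ?thesis using nn by linarith
    next
      assume "\<exists>i\<in>{0..<int A}. \<exists>i'\<in>{0..<int A}.
        ((i, - 1), (i', int A)) \<in> (arcs ({0..<int A} \<times> {- 1..<int A}) (dual c))\<^sup>*"
      then obtain i i' where i: "i \<in> {0..<int A}"
        "((i, - 1), (i', int A)) \<in> (arcs ({0..<int A} \<times> {- 1..<int A}) (dual c))\<^sup>*" by blast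
      have "(i', int A) \<notin> T (i, - 1)" by (simp add: memT A_def)
      then have "hits (T (i, - 1)) (- T (i, - 1)) (dual c) (i, - 1)" using i(2) by (intro hits_of_exit)
      then have "1 \<le> ?D" using i(1) member_le_sum[of i "{0..<int A}" "\<lambda>i. of_bool (hits (T (i, - 1)) (- T (i, - 1)) (dual c) (i, - 1)) :: real"]
        by simp
      then show ?thesis using nn by linarith
    qed
  qed
  have "1 = wsum W nb uni (\<lambda>_. 1)" using tot by (simp add: wsum_const W_def)
  also have "\<dots> \<le> wsum W nb uni (\<lambda>c. (\<Sum>j\<in>{0..int A}. of_bool (hits (T (0, j)) (- T (0, j)) c (0, j))) +
      (\<Sum>i\<in>{0..<int A}. of_bool (hits (T (i, - 1)) (- T (i, - 1)) (dual c) (i, - 1))))"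
    by (intro wsum_mono cover) (simp add: uni_def)
  also have "\<dots> = (\<Sum>j\<in>{0..int A}. \<theta>) + (\<Sum>i\<in>{0..<int A}. \<theta>)"
    unfolding wsum_add wsum_sum by (intro arg_cong2[of _ _ _ _ "(+)"] sum.cong refl primal dual)
  also have "\<dots> = (4 * real n + 1) * \<theta>"
    by (simp add: A_def algebra_simps)
  finally have "1 \<le> (4 * real n + 1) * \<theta>" .
  then show ?thesis unfolding \<theta>_def[symmetric] by (simp add: field_simps)
qed

subsection \<open>The 2dp-neighbour graph\<close>

definition emb :: "int \<times> int \<Rightarrow> int ^ 2" where
  "emb x = (\<chi> i. if i = 1 then fst x else snd x)"

lemma emb_nth [simp]: "emb x $ 1 = fst x" "emb x $ 2 = snd x"
  by (simp_all add: emb_def)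

lemma bij_emb: "bij emb"
proof (rule bij_betw_byWitness[where f' = "\<lambda>v. (v $ 1, v $ 2)"])
  show "\<forall>v\<in>UNIV. emb (v $ 1, v $ 2) = v"
    by (simp add: vec_eq_iff forall_2)
qed simp_all

lemma inj_emb: "inj emb"
  using bij_emb by (simp add: bij_def)

lemma emb_zero: "emb (0, 0) = 0"
  by (simp add: vec_eq_iff forall_2)

lemma nbrs_emb: "nbrs (emb x) = emb ` nb x"
proof -
  have "emb y \<in> nbrs (emb x) \<longleftrightarrow> y \<in> nb x" for y
  proof -
    obtain a b where x: "x = (a, b)" by (cases x)
    obtain a' b' where y: "y = (a', b')" by (cases y)
    have "emb y \<in> nbrs (emb x) \<longleftrightarrow> \<bar>a - a'\<bar> + \<bar>b - b'\<bar> = 1"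
      by (simp add: nbrs_def dir_edges_def sum_2 x y)
    also have "\<dots> \<longleftrightarrow> y \<in> nb x"
      by (simp add: nb_def x y) presburger
    finally show ?thesis .
  qed
  moreover have "\<exists>y. v = emb y" for v using bij_emb by (metis bij_pointE)
  ultimately show ?thesis using inj_emb by (auto simp: image_iff) metis
qed

lemma nbrs_two: "finite (nbrs (x :: int ^ 2))" "card (nbrs (x :: int ^ 2)) = 4"
proof -
  obtain y where y: "x = emb y" using bij_emb by (metis bij_pointE)
  show "finite (nbrs x)" "card (nbrs x) = 4"
    unfolding y nbrs_emb using card_image[of emb "nb y"] inj_on_subset[OF inj_emb] by simp_all
qed

definition sub_choice :: "real \<Rightarrow> int ^ 2 \<Rightarrow> (int ^ 2) set \<Rightarrow> (int ^ 2) set pmf" where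
  "sub_choice p x S = bind_pmf (bernoulli_pmf (extra_prob TYPE(2) p)) (\<lambda>success.
       if success then map_pmf (\<lambda>y. insert y S) (pmf_of_set (nbrs x - S)) else return_pmf S)"

lemma choice_pmf_sub_choice:
  "choice_pmf p x = bind_pmf (pmf_of_set {S. S \<subseteq> nbrs x \<and> card S = base_degree TYPE(2) p}) (sub_choice p x)"
  unfolding choice_pmf_def sub_choice_def[abs_def] ..

lemma extra_prob_bounds: "0 \<le> extra_prob d p" "extra_prob d p \<le> 1"
  by (simp_all add: extra_prob_def frac_ge_0 frac_lt_1 less_imp_le)

lemma base_degree_le: "p \<le> 1 \<Longrightarrow> base_degree TYPE(2) p \<le> 4"
  unfolding base_degree_def by simp (linarith)

lemma sub_choice_supset: "S' \<in> set_pmf (sub_choice p x S) \<Longrightarrow> S \<subseteq> S'"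
  by (auto simp: sub_choice_def split: if_splits)

text \<open>A positive coin probability forces the base degree below 4. Then some neighbour is left
  and \<open>pmf_of_set\<close> is taken at a nonempty set.\<close>

lemma sub_choice_subset:
  assumes "S \<subseteq> nbrs x" "card S = base_degree TYPE(2) p" "0 \<le> p" "p \<le> 1" "S' \<in> set_pmf (sub_choice p x S)"
  shows "S' \<subseteq> nbrs x"
proof (cases "extra_prob TYPE(2) p = 0")
  case True
  then have "bernoulli_pmf (extra_prob TYPE(2) p) = return_pmf False"
    by (intro pmf_eqI) (case_tac i, simp_all)
  then show ?thesis using assms by (simp add: sub_choice_def bind_return_pmf)
next
  case False
  have "base_degree TYPE(2) p < 4"
  proof (rule ccontr)
    assume "\<not> base_degree TYPE(2) p < 4"
    then have "4 \<le> \<lfloor>4 * p\<rfloor>" unfolding base_degree_def by simp linarith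
    then have "p = 1" using assms(4) by linarith
    then show False using False by (simp add: extra_prob_def)
  qed
  then have "nbrs x - S \<noteq> {}"
    using assms(2) nbrs_two[of x] by (metis Diff_eq_empty_iff card_mono finite_subset[OF assms(1)] leD)
  then have "set_pmf (pmf_of_set (nbrs x - S)) = nbrs x - S"
    using nbrs_two by (intro set_pmf_of_set) auto
  then show ?thesis using assms(1,5) by (auto simp: sub_choice_def split: if_splits)
qed

lemma base_sets:
  fixes x :: "int ^ 2"
  assumes "p \<le> 1"
  defines "K \<equiv> {S. S \<subseteq> nbrs x \<and> card S = base_degree TYPE(2) p}"
  shows "finite K" "K \<noteq> {}" "card K = 4 choose base_degree TYPE(2) p"
proof -
  show card: "card K = 4 choose base_degree TYPE(2) p"
    using n_subsets[OF nbrs_two(1), of x "base_degree TYPE(2) p"] nbrs_two(2)[of x] by (simp add: K_def)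
  have "0 < card K" unfolding card using base_degree_le[OF assms(1)] by (simp add: zero_less_binomial)
  then show "finite K" "K \<noteq> {}" by (auto intro: card_ge_0_finite)
qed

lemma set_choice_pmf:
  assumes "0 \<le> p" "p \<le> 1"
  shows "set_pmf (choice_pmf p (x :: int ^ 2)) \<subseteq> Pow (nbrs x)"
  unfolding choice_pmf_sub_choice using sub_choice_subset[OF _ _ assms] base_sets[OF assms(2), of x]
  by auto

lemma prob_choice_pmf:
  fixes x :: "int ^ 2"
  assumes "p \<le> 1"
  shows "measure_pmf.prob (choice_pmf p x) {S. S \<inter> A = {}} =
    (\<Sum>S | S \<subseteq> nbrs x \<and> card S = base_degree TYPE(2) p. measure_pmf.prob (sub_choice p x S) {S. S \<inter> A = {}})
      / real (4 choose base_degree TYPE(2) p)"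
proof -
  have pm: "measure_pmf.prob P {S. S \<inter> A = {}} = pmf (map_pmf (\<lambda>S. S \<inter> A = {}) P) True" for P
    by (simp add: pmf_map vimage_def)
  show ?thesis
    unfolding pm choice_pmf_sub_choice map_bind_pmf pmf_bind
    using base_sets[OF assms, of x] by (simp add: integral_pmf_of_set)
qed

lemma prob_sub_choice_le:
  "measure_pmf.prob (sub_choice p x S) {S'. S' \<inter> A = {}} \<le> of_bool (S \<inter> A = {})"
proof (cases "S \<inter> A = {}")
  case False
  then have "set_pmf (sub_choice p x S) \<inter> {S'. S' \<inter> A = {}} = {}"
    using sub_choice_supset by fastforce
  then have "measure_pmf.prob (sub_choice p x S) {S'. S' \<inter> A = {}} = 0"
    by (simp add: measure_pmf_zero_iff)
  then show ?thesis by simp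
qed simp

lemma card_avoiding_sets:
  "card {S. S \<subseteq> nbrs (x :: int ^ 2) \<and> card S = k \<and> S \<inter> A = {}} = card (nbrs x - A) choose k"
proof -
  have "{S. S \<subseteq> nbrs x \<and> card S = k \<and> S \<inter> A = {}} = {S. S \<subseteq> nbrs x - A \<and> card S = k}" by blast
  then show ?thesis using n_subsets[of "nbrs x - A" k] nbrs_two(1)[of x] by simp
qed

text \<open>Discarding the additional neighbour can only raise the avoidance probability.\<close>

lemma prob_choice_le_binomial:
  fixes x :: "int ^ 2"
  assumes "p \<le> 1"
  shows "measure_pmf.prob (choice_pmf p x) {S. S \<inter> A = {}} \<le>
    real (card (nbrs x - A) choose base_degree TYPE(2) p) / real (4 choose base_degree TYPE(2) p)"
proof -
  let ?k = "base_degree TYPE(2) p"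
  have "(\<Sum>S | S \<subseteq> nbrs x \<and> card S = ?k. measure_pmf.prob (sub_choice p x S) {S. S \<inter> A = {}}) \<le>
      (\<Sum>S | S \<subseteq> nbrs x \<and> card S = ?k. of_bool (S \<inter> A = {}))"
    by (intro sum_mono prob_sub_choice_le)
  also have "\<dots> = real (card {S. S \<subseteq> nbrs x \<and> card S = ?k \<and> S \<inter> A = {}})"
    using base_sets(1)[OF assms, of x] by (simp add: Int_def conj_ac)
  finally show ?thesis
    unfolding prob_choice_pmf[OF assms] card_avoiding_sets by (simp add: divide_right_mono)
qed

text \<open>With m neighbours outside \<open>A\<close> and coin probability e, the first choice
  avoids \<open>A\<close> with probability m/4, and then the additional one does so with probability
  (m - 1)/3; the last factor is e (m - 1)/3 + 1 - e.\<close>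

lemma prob_choice_one:
  fixes x :: "int ^ 2"
  assumes "p \<le> 1" "base_degree TYPE(2) p = 1"
  shows "measure_pmf.prob (choice_pmf p x) {S. S \<inter> A = {}} \<le>
    real (card (nbrs x - A)) / 4 * (1 - extra_prob TYPE(2) p * (4 - real (card (nbrs x - A))) / 3)"
proof -
  let ?e = "extra_prob TYPE(2) p" and ?m = "card (nbrs x - A)"
  let ?h = "1 - ?e * (4 - real ?m) / 3"
  have one: "measure_pmf.prob (sub_choice p x S) {S. S \<inter> A = {}} \<le> of_bool (S \<inter> A = {}) * ?h"
    if S: "S \<subseteq> nbrs x" "card S = 1" for S
  proof (cases "S \<inter> A = {}")
    case True
    obtain y where y: "S = {y}" using S(2) by (auto simp: card_1_singleton_iff)
    have c3: "card (nbrs x - S) = 3" using S y nbrs_two[of x] by (simp add: card_Diff_subset)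
    then have "nbrs x - S \<noteq> {}" by (metis card.empty zero_neq_numeral)
    then have fin: "finite (nbrs x - S)" "nbrs x - S \<noteq> {}" using nbrs_two(1)[of x] by simp_all
    have yA: "y \<in> nbrs x - A" using S y True by auto
    have "(nbrs x - S) \<inter> {z. insert z S \<inter> A = {}} = nbrs x - A - {y}" using y True by auto
    then have c: "card ((nbrs x - S) \<inter> {z. insert z S \<inter> A = {}}) = ?m - 1"
      using yA nbrs_two(1)[of x] by simp
    have m: "1 \<le> ?m" using yA nbrs_two(1)[of x] by (metis card_0_eq empty_iff finite_Diff less_one not_less)
    have "measure_pmf.prob (sub_choice p x S) {S. S \<inter> A = {}} =
      pmf (map_pmf (\<lambda>S. S \<inter> A = {}) (sub_choice p x S)) True"
      by (simp add: pmf_map vimage_def)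
    also have "\<dots> = measure_pmf.prob (pmf_of_set (nbrs x - S)) {z. insert z S \<inter> A = {}} * ?e + (1 - ?e)"
      unfolding sub_choice_def map_bind_pmf pmf_bind
      by (subst integral_bernoulli_pmf)
         (use extra_prob_bounds True in \<open>simp_all add: pmf_map vimage_def map_pmf_comp\<close>)
    also have "\<dots> = (real ?m - 1) / 3 * ?e + (1 - ?e)"
      unfolding measure_pmf_of_set[OF fin(2,1)] c c3 using m by (simp add: of_nat_diff)
    also have "\<dots> = ?h" by (simp add: field_simps)
    finally show ?thesis using True by simp
  next
    case False
    then show ?thesis using prob_sub_choice_le[of p x S A] by simp
  qed
  have "(\<Sum>S | S \<subseteq> nbrs x \<and> card S = 1. measure_pmf.prob (sub_choice p x S) {S. S \<inter> A = {}}) \<le>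
      (\<Sum>S | S \<subseteq> nbrs x \<and> card S = 1. of_bool (S \<inter> A = {}) * ?h)"
    by (intro sum_mono one) auto
  also have "\<dots> = real (card {S. S \<subseteq> nbrs x \<and> card S = 1 \<and> S \<inter> A = {}}) * ?h"
    using base_sets(1)[OF assms(1), of x] assms(2)
    by (simp add: Int_def conj_ac flip: sum_distrib_right)
  finally have "(\<Sum>S | S \<subseteq> nbrs x \<and> card S = 1. measure_pmf.prob (sub_choice p x S) {S. S \<inter> A = {}}) \<le> real ?m * ?h"
    by (simp add: card_avoiding_sets)
  then show ?thesis
    unfolding prob_choice_pmf[OF assms(1)] assms(2) by (simp add: divide_right_mono)
qed

text \<open>A single neighbour is avoided with probability 1 - p, and \<open>mix small 1\<close>
  allows 1/2 + \<open>small / 8\<close>. This fixes the threshold for p; avoiding several neighbours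
  leaves room to spare.\<close>

lemma prob_choice_le_mix:
  fixes x :: "int ^ 2"
  assumes p: "1 / 2 - small / 8 \<le> p" "p \<le> 1"
  shows "measure_pmf.prob (choice_pmf p x) {S. S \<inter> A = {}} \<le> avoid (mix small 1) (card (nbrs x - A))"
proof -
  define m where "m = card (nbrs x - A)"
  have "m \<le> 4" using card_mono[of "nbrs x" "nbrs x - A"] nbrs_two[of x] by (auto simp: m_def)
  then have m: "m = 4 \<or> m = 3 \<or> m = 2 \<or> m = Suc 0 \<or> m = 0" by arith
  have g: "avoid (mix small 1) 4 = 1" "1 / 2 + small / 8 \<le> avoid (mix small 1) 3"
    "5 / 24 \<le> avoid (mix small 1) 2" "1 / 16 \<le> avoid (mix small 1) (Suc 0)" "0 \<le> avoid (mix small 1) 0"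
    using small_bounds by (simp_all add: avoid_mix)
  show ?thesis
  proof (cases "1 / 2 \<le> p")
    case True
    define k where "k = base_degree TYPE(2) p"
    have "2 \<le> \<lfloor>4 * p\<rfloor>" using True by linarith
    then have "nat 2 \<le> nat \<lfloor>4 * p\<rfloor>" by (rule nat_mono)
    then have "2 \<le> k" unfolding k_def base_degree_def by simp
    then have k: "k = 2 \<or> k = 3 \<or> k = 4" using base_degree_le[OF p(2)] unfolding k_def by arith
    have "measure_pmf.prob (choice_pmf p x) {S. S \<inter> A = {}} \<le> real (m choose k) / real (4 choose k)"
      using prob_choice_le_binomial[OF p(2), of x A] by (simp add: m_def k_def)
    also have "\<dots> \<le> avoid (mix small 1) m"
      using m k g small_bounds by (elim disjE) (simp_all add: eval_nat_numeral)
    finally show ?thesis by (simp add: m_def)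
  next
    case False
    define e where "e = extra_prob TYPE(2) p"
    have fl: "\<lfloor>4 * p\<rfloor> = 1" using False p small_bounds by linarith
    then have k: "base_degree TYPE(2) p = 1" by (simp add: base_degree_def)
    have e: "e = 4 * p - 1" using fl by (simp add: e_def extra_prob_def frac_def)
    have e': "1 - small / 2 \<le> e" "e \<le> 1" using p False unfolding e by linarith+
    have "measure_pmf.prob (choice_pmf p x) {S. S \<inter> A = {}} \<le> real m / 4 * (1 - e * (4 - real m) / 3)"
      using prob_choice_one[OF p(2) k, of x A] by (simp add: m_def e_def)
    also have "\<dots> \<le> avoid (mix small 1) m"
      using m g small_bounds e' by (elim disjE) (simp_all add: field_simps)
    finally show ?thesis by (simp add: m_def)
  qed
qed

lemma wsum_choice_ge:
  assumes p: "1 / 2 - small / 8 \<le> p" "p \<le> 1" and V: "finite V"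
  shows "conn small 1 V a \<le>
    wsum (emb ` V) nbrs (\<lambda>x. pmf (choice_pmf p x)) (\<lambda>c. of_bool (hits (emb ` V) (- emb ` V) c (emb a)))"
proof -
  have p0: "0 \<le> p" using p small_bounds by linarith
  have fin: "finite (nbrs x)" for x :: "int ^ 2" by (rule nbrs_two)
  have tot: "(\<Sum>s\<in>Pow (nbrs x). pmf (choice_pmf p x) s) = 1" for x :: "int ^ 2"
    using fin set_choice_pmf[OF p0 p(2), of x] by (intro sum_pmf_eq_1) auto
  have tot': "(\<Sum>s\<in>Pow (nbrs x). mix small 1 (card s)) = 1" for x :: "int ^ 2"
    by (simp add: sum_Pow_card nbrs_two avoid_mix)
  have "conn small 1 V a = wsum (emb ` V) nbrs (\<lambda>_ s. mix small 1 (card s))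
      (\<lambda>c. of_bool (hits (emb ` V) (- emb ` V) c (emb a)))"
    unfolding conn_def
  proof (rule wsum_hits_reindex[where \<pi> = emb and N' = nbrs, symmetric])
    show "finite V" "bij emb" "nbrs (emb q) = emb ` nb q" for q
      using V bij_emb nbrs_emb by auto
    show "mix small 1 (card (emb ` s)) = mix small 1 (card s)" for s
      using card_image[OF inj_on_subset[OF inj_emb], of s] by simp
  qed
  also have "\<dots> \<le> wsum (emb ` V) nbrs (\<lambda>x. pmf (choice_pmf p x))
      (\<lambda>c. of_bool (hits (emb ` V) (- emb ` V) c (emb a)))"
  proof (rule wsum_hits_mono)
    fix x :: "int ^ 2" and A
    have "(\<Sum>s | s \<subseteq> nbrs x \<and> s \<inter> A = {}. pmf (choice_pmf p x) s) =
        measure_pmf.prob (choice_pmf p x) {s. s \<subseteq> nbrs x \<and> s \<inter> A = {}}"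
      using fin[of x] by (simp add: measure_measure_pmf_finite)
    also have "\<dots> \<le> measure_pmf.prob (choice_pmf p x) {s. s \<inter> A = {}}"
      by (intro measure_pmf.finite_measure_mono) auto
    also have "\<dots> \<le> avoid (mix small 1) (card (nbrs x - A))"
      by (rule prob_choice_le_mix[OF p])
    finally have le: "(\<Sum>s | s \<subseteq> nbrs x \<and> s \<inter> A = {}. pmf (choice_pmf p x) s) \<le>
        avoid (mix small 1) (card (nbrs x - A))" .
    have "(\<Sum>s\<in>Pow (nbrs x). pmf (choice_pmf p x) s) =
        (\<Sum>s | s \<subseteq> nbrs x \<and> s \<inter> A = {}. pmf (choice_pmf p x) s) +
        (\<Sum>s | s \<subseteq> nbrs x \<and> s \<inter> A \<noteq> {}. pmf (choice_pmf p x) s)"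
      using fin[of x] by (subst sum.union_disjoint[symmetric]) (auto intro!: sum.cong)
    then show "(\<Sum>s | s \<subseteq> nbrs x \<and> s \<inter> A \<noteq> {}. mix small 1 (card s)) \<le>
        (\<Sum>s | s \<subseteq> nbrs x \<and> s \<inter> A \<noteq> {}. pmf (choice_pmf p x) s)"
      using le tot[of x] unfolding sum_Pow_card_hit[OF fin] nbrs_two(2) avoid_mix(1) by linarith
  next
    fix s :: "(int ^ 2) set"
    show "0 \<le> mix small 1 (card s)" using mix_ge[of small 1 "card s"] small_bounds by linarith
  qed (use V fin tot tot' in simp_all)
  finally show ?thesis .
qed

section \<open>From finite sums to the product measure\<close>

lemma measure_cylinder:
  fixes q :: "'i \<Rightarrow> 'a pmf"
  assumes "finite J"
  shows "measure (\<Pi>\<^sub>M x\<in>UNIV. measure_pmf (q x)) {c. \<forall>x\<in>J. c x = c0 x} = (\<Prod>x\<in>J. pmf (q x) (c0 x))"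
    "{c. \<forall>x\<in>J. c x = c0 x} \<in> sets (\<Pi>\<^sub>M x\<in>UNIV. measure_pmf (q x))"
proof -
  interpret product_prob_space "\<lambda>x. measure_pmf (q x)" UNIV
    by (intro product_prob_spaceI measure_pmf.prob_space_axioms)
  have eq: "{c. \<forall>x\<in>J. c x = c0 x} = prod_emb UNIV (\<lambda>x. measure_pmf (q x)) J (PiE J (\<lambda>x. {c0 x}))"
    by (auto simp: prod_emb_def PiE_iff)
  show "measure (\<Pi>\<^sub>M x\<in>UNIV. measure_pmf (q x)) {c. \<forall>x\<in>J. c x = c0 x} = (\<Prod>x\<in>J. pmf (q x) (c0 x))"
    unfolding eq using assms by (subst measure_PiM_emb) (simp_all add: pmf.rep_eq)
  show "{c. \<forall>x\<in>J. c x = c0 x} \<in> sets (\<Pi>\<^sub>M x\<in>UNIV. measure_pmf (q x))"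
    unfolding eq using assms by (intro sets_PiM_I) auto
qed

text \<open>The cylinders fixed by the configurations counted in the sum are disjoint and lie inside
  the event.\<close>

lemma measure_ge_wsum:
  fixes q :: "'a \<Rightarrow> 'a set pmf"
  assumes V: "finite V" "\<And>x. x \<in> V \<Longrightarrow> finite (N x)" "local_on V E"
    and meas: "{c. E c} \<in> sets (\<Pi>\<^sub>M x\<in>UNIV. measure_pmf (q x))"
  shows "wsum V N (\<lambda>x. pmf (q x)) (\<lambda>c. of_bool (E c)) \<le> measure (\<Pi>\<^sub>M x\<in>UNIV. measure_pmf (q x)) {c. E c}"
proof -
  let ?M = "\<Pi>\<^sub>M x\<in>UNIV. measure_pmf (q x)"
  interpret product_prob_space "\<lambda>x. measure_pmf (q x)" UNIV
    by (intro product_prob_spaceI measure_pmf.prob_space_axioms)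
  define C where "C = {c \<in> PiE V (\<lambda>x. Pow (N x)). E c}"
  define Z where "Z c0 = {c. \<forall>x\<in>V. c x = c0 x}" for c0 :: "'a \<Rightarrow> 'a set"
  have finP: "finite (PiE V (\<lambda>x. Pow (N x)))" using V by (intro finite_PiE) auto
  then have finC: "finite C" by (simp add: C_def)
  have "wsum V N (\<lambda>x. pmf (q x)) (\<lambda>c. of_bool (E c)) = (\<Sum>c\<in>C. \<Prod>x\<in>V. pmf (q x) (c x))"
    unfolding wsum_def C_def by (rule sum.mono_neutral_cong_right) (use finP in auto)
  also have "\<dots> = (\<Sum>c\<in>C. measure ?M (Z c))"
    unfolding Z_def measure_cylinder(1)[OF V(1)] ..
  also have "\<dots> = measure ?M (\<Union>c\<in>C. Z c)"
  proof (rule P.finite_measure_finite_Union[symmetric, OF finC])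
    show "Z ` C \<subseteq> sets ?M" unfolding Z_def using measure_cylinder(2)[OF V(1)] by auto
    show "disjoint_family_on Z C"
    proof (unfold disjoint_family_on_def, intro ballI impI)
      fix c c' assume c: "c \<in> C" "c' \<in> C" "c \<noteq> c'"
      then obtain x where "x \<in> V" "c x \<noteq> c' x"
        unfolding C_def by (metis (no_types, lifting) PiE_ext mem_Collect_eq)
      then show "Z c \<inter> Z c' = {}" by (auto simp: Z_def)
    qed
  qed
  also have "\<dots> \<le> measure ?M {c. E c}"
  proof (rule P.finite_measure_mono[OF _ meas])
    show "(\<Union>c\<in>C. Z c) \<subseteq> {c. E c}"
    proof
      fix c assume "c \<in> (\<Union>c\<in>C. Z c)"
      then obtain c0 where "E c0" "\<And>x. x \<in> V \<Longrightarrow> c x = c0 x" by (auto simp: C_def Z_def)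
      then show "c \<in> {c. E c}" using local_onD[OF V(3), of c c0] by simp
    qed
  qed
  finally show ?thesis .
qed

subsection \<open>Percolation\<close>

text \<open>Walk along arcs that increase the distance from \<open>a\<close> by one, always to a
  vertex with infinitely many descendants along such arcs. The distances make the walk
  injective.\<close>

lemma koenig:
  fixes c :: "'a \<Rightarrow> 'a set"
  assumes fin: "\<And>x. finite (c x)" and inf: "infinite {y. (a, y) \<in> (arcs UNIV c)\<^sup>*}"
  obtains \<gamma> where "\<gamma> 0 = a" "inj \<gamma>" "\<And>n::nat. \<gamma> (Suc n) \<in> c (\<gamma> n)"
proof -
  define R where "R = arcs UNIV c"
  define d where "d y = (LEAST n. (a, y) \<in> R ^^ n)" for y
  define G where "G = {(x, y). (a, x) \<in> R\<^sup>* \<and> (x, y) \<in> R \<and> d y = Suc (d x)}"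
  have dist: "(a, y) \<in> R ^^ d y" if "(a, y) \<in> R\<^sup>*" for y
    using that unfolding d_def rtrancl_power by (rule LeastI_ex)
  have d_le: "d y \<le> n" if "(a, y) \<in> R ^^ n" for y n
    unfolding d_def using that by (rule Least_le)
  have geo: "(a, y) \<in> G\<^sup>*" if "(a, y) \<in> R\<^sup>*" "d y = n" for y n
    using that
  proof (induction n arbitrary: y)
    case 0
    then have "a = y" using dist[of y] by simp
    then show ?case by simp
  next
    case (Suc n)
    then have "(a, y) \<in> R ^^ Suc n" using dist[of y] by simp
    then obtain x where x: "(a, x) \<in> R ^^ n" "(x, y) \<in> R" by auto
    have ax: "(a, x) \<in> R\<^sup>*" using x(1) by (rule relpow_imp_rtrancl)
    have "(a, y) \<in> R ^^ Suc (d x)" using dist[OF ax] x(2) by auto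
    then have "d x = n" using d_le[OF x(1)] d_le[of y "Suc (d x)"] Suc.prems(2) by simp
    then have "(a, x) \<in> G\<^sup>*" "(x, y) \<in> G" using Suc.IH[OF ax] ax x(2) Suc.prems(2) by (simp_all add: G_def)
    then show ?case by (rule rtrancl.rtrancl_into_rtrancl)
  qed
  define desc where "desc x = {u. (x, u) \<in> G\<^sup>*}" for x
  have "{y. (a, y) \<in> R\<^sup>*} \<subseteq> desc a" using geo by (auto simp: desc_def)
  then have inf_a: "infinite (desc a)" using inf unfolding R_def by (rule infinite_super)
  have d_a: "d a = 0" using d_le[of a 0] by simp
  have next_ex: "\<exists>y. (x, y) \<in> G \<and> infinite (desc y)" if "infinite (desc x)" for x
  proof (rule ccontr)
    assume no: "\<not> ?thesis"
    have "desc x \<subseteq> insert x (\<Union>y\<in>{y \<in> c x. (x, y) \<in> G}. desc y)"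
    proof
      fix u assume "u \<in> desc x"
      then have "(x, u) \<in> G\<^sup>*" by (simp add: desc_def)
      then show "u \<in> insert x (\<Union>y\<in>{y \<in> c x. (x, y) \<in> G}. desc y)"
      proof (cases rule: converse_rtranclE)
        case (step y)
        then have "y \<in> c x" by (simp add: G_def R_def arcs_def)
        then show ?thesis using step by (auto simp: desc_def)
      qed simp
    qed
    moreover have "finite (insert x (\<Union>y\<in>{y \<in> c x. (x, y) \<in> G}. desc y))"
      using fin[of x] no by auto
    ultimately show False using that finite_subset by blast
  qed
  have "\<exists>\<gamma>. \<forall>n. (d (\<gamma> n) = n \<and> infinite (desc (\<gamma> n)) \<and> (n = 0 \<longrightarrow> \<gamma> n = a)) \<and> (\<gamma> n, \<gamma> (Suc n)) \<in> G"
  proof (rule dependent_nat_choice)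
    show "\<exists>x. d x = 0 \<and> infinite (desc x) \<and> (0 = (0::nat) \<longrightarrow> x = a)" using inf_a d_a by blast
    show "\<exists>y. (d y = Suc n \<and> infinite (desc y) \<and> (Suc n = 0 \<longrightarrow> y = a)) \<and> (x, y) \<in> G"
      if x: "d x = n \<and> infinite (desc x) \<and> (n = 0 \<longrightarrow> x = a)" for x n
    proof -
      obtain y where "(x, y) \<in> G" "infinite (desc y)" using next_ex x by blast
      then show ?thesis using x by (intro exI[of _ y]) (simp add: G_def)
    qed
  qed
  then obtain \<gamma> where \<gamma>: "\<And>n. d (\<gamma> n) = n" "\<gamma> 0 = a" "\<And>n. (\<gamma> n, \<gamma> (Suc n)) \<in> G" by blast
  show thesis
  proof (rule that)
    show "\<gamma> 0 = a" by (rule \<gamma>(2))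
    show "inj \<gamma>" using \<gamma>(1) by (metis injI)
    show "\<gamma> (Suc n) \<in> c (\<gamma> n)" for n using \<gamma>(3)[of n] by (simp add: G_def R_def arcs_def)
  qed
qed

section \<open>Percolation as escape from all boxes\<close>

definition out_nbrs :: "((int ^ 2) \<times> (int ^ 2) \<Rightarrow> bool) \<Rightarrow> int ^ 2 \<Rightarrow> (int ^ 2) set" where
  "out_nbrs \<omega> x = {y \<in> nbrs x. \<omega> (x, y)}"

definition ebox :: "nat \<Rightarrow> (int ^ 2) set" where
  "ebox n = emb ` boxn n"

abbreviation law :: "real \<Rightarrow> ((int ^ 2) \<times> (int ^ 2) \<Rightarrow> bool) measure" where
  "law \<equiv> edge_law"

definition escapes :: "nat \<Rightarrow> ((int ^ 2) \<times> (int ^ 2) \<Rightarrow> bool) \<Rightarrow> bool" where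
  "escapes n \<omega> \<longleftrightarrow> hits (ebox n) (- ebox n) (out_nbrs \<omega>) 0"

lemma finite_ebox: "finite (ebox n)"
  by (simp add: ebox_def)

text \<open>An injective path leaves every finite box. Conversely, escaping from all boxes makes the
  reachable set infinite, and \<open>koenig\<close> applies because degrees are finite. Percolation
  thus becomes a countable intersection of events depending on finitely many edges.\<close>

lemma percolates_iff_escapes: "percolates_from_origin \<omega> \<longleftrightarrow> (\<forall>n. escapes n \<omega>)"
proof
  assume "percolates_from_origin \<omega>"
  then obtain \<gamma> :: "nat \<Rightarrow> int ^ 2" where \<gamma>: "\<gamma> 0 = 0" "inj \<gamma>"
    "\<And>n. (\<gamma> n, \<gamma> (Suc n)) \<in> dir_edges \<and> \<omega> (\<gamma> n, \<gamma> (Suc n))"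
    unfolding percolates_from_origin_def by blast
  have path: "(0, \<gamma> k) \<in> (arcs UNIV (out_nbrs \<omega>))\<^sup>*" for k
  proof (induction k)
    case (Suc k)
    have "(\<gamma> k, \<gamma> (Suc k)) \<in> arcs UNIV (out_nbrs \<omega>)"
      using \<gamma>(3)[of k] by (simp add: arcs_def out_nbrs_def nbrs_def)
    with Suc show ?case by (rule rtrancl.rtrancl_into_rtrancl)
  qed (simp add: \<gamma>(1))
  show "\<forall>n. escapes n \<omega>"
  proof
    fix n
    have "infinite (range \<gamma>)" using \<gamma>(2) by (rule range_inj_infinite)
    then have "\<not> range \<gamma> \<subseteq> ebox n" using finite_subset[OF _ finite_ebox] by metis
    then obtain k where "\<gamma> k \<notin> ebox n" by blast
    then show "escapes n \<omega>" unfolding escapes_def using path[of k] by (intro hits_of_exit)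
  qed
next
  assume esc: "\<forall>n. escapes n \<omega>"
  let ?S = "{y. (0, y) \<in> (arcs UNIV (out_nbrs \<omega>))\<^sup>*}"
  have inf: "infinite ?S"
  proof
    assume "finite ?S"
    then have "finite (inv emb ` ?S)" by simp
    then obtain n where "inv emb ` ?S \<subseteq> boxn n" by (rule finite_subset_boxn)
    then have "emb ` (inv emb ` ?S) \<subseteq> ebox n" unfolding ebox_def by (rule image_mono)
    then have S: "?S \<subseteq> ebox n" unfolding image_f_inv_f[OF bij_is_surj[OF bij_emb]] .
    have "escapes n \<omega>" using esc by simp
    then obtain t where t: "t \<notin> ebox n" "(0, t) \<in> (arcs (ebox n) (out_nbrs \<omega>))\<^sup>*"
      unfolding escapes_def hits_def by auto
    from t(2) have "(0, t) \<in> (arcs UNIV (out_nbrs \<omega>))\<^sup>*" by (rule arcs_rtrancl_mono) simp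
    then show False using S t(1) by blast
  qed
  have fin: "finite (out_nbrs \<omega> x)" for x
    using nbrs_two(1)[of x] by (simp add: out_nbrs_def)
  obtain \<gamma> where "\<gamma> 0 = 0" "inj \<gamma>" "\<And>n::nat. \<gamma> (Suc n) \<in> out_nbrs \<omega> (\<gamma> n)"
    by (rule koenig[OF fin inf], rule that)
  then show "percolates_from_origin \<omega>"
    unfolding percolates_from_origin_def
    by (intro exI[of _ \<gamma>]) (simp add: out_nbrs_def nbrs_def)
qed

lemma sets_PiM_local:
  fixes \<phi> :: "('i \<Rightarrow> bool) \<Rightarrow> bool"
  assumes J: "finite J" "J \<subseteq> I" and loc: "local_on J \<phi>"
  shows "{\<omega> \<in> space (\<Pi>\<^sub>M e\<in>I. count_space UNIV). \<phi> \<omega>} \<in> sets (\<Pi>\<^sub>M e\<in>I. count_space UNIV)"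
proof -
  let ?M = "\<Pi>\<^sub>M e\<in>I. count_space (UNIV :: bool set)"
  define H where "H = {\<eta> \<in> Pow J. \<phi> (\<lambda>e. e \<in> \<eta>)}"
  define Z where "Z \<eta> = prod_emb I (\<lambda>_. count_space (UNIV :: bool set)) J (PiE J (\<lambda>e. {e \<in> \<eta>}))" for \<eta>
  have "{\<omega> \<in> space ?M. \<phi> \<omega>} = (\<Union>\<eta>\<in>H. Z \<eta>)"
  proof (intro equalityI subsetI)
    fix \<omega> assume \<omega>: "\<omega> \<in> {\<omega> \<in> space ?M. \<phi> \<omega>}"
    define \<eta> where "\<eta> = {e \<in> J. \<omega> e}"
    have "\<phi> (\<lambda>e. e \<in> \<eta>) = \<phi> \<omega>" by (rule local_onD[OF loc]) (simp add: \<eta>_def)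
    then have "\<eta> \<in> H" using \<omega> by (simp add: H_def \<eta>_def)
    moreover have "\<omega> \<in> Z \<eta>"
      using \<omega> by (auto simp: Z_def prod_emb_def space_PiM \<eta>_def)
    ultimately show "\<omega> \<in> (\<Union>\<eta>\<in>H. Z \<eta>)" by blast
  next
    fix \<omega> assume "\<omega> \<in> (\<Union>\<eta>\<in>H. Z \<eta>)"
    then obtain \<eta> where \<eta>: "\<eta> \<in> H" "\<omega> \<in> Z \<eta>" by blast
    then have "\<omega> e = (e \<in> \<eta>)" if "e \<in> J" for e
      using that by (auto simp: Z_def prod_emb_def PiE_iff restrict_def split: if_splits)
    then have "\<phi> \<omega> = \<phi> (\<lambda>e. e \<in> \<eta>)" by (intro local_onD[OF loc])
    then show "\<omega> \<in> {\<omega> \<in> space ?M. \<phi> \<omega>}"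
      using \<eta> by (auto simp: H_def Z_def prod_emb_def space_PiM)
  qed
  moreover have "Z \<eta> \<in> sets ?M" for \<eta>
    unfolding Z_def using J by (intro sets_PiM_I) auto
  moreover have "finite H" using J by (simp add: H_def)
  ultimately show ?thesis by auto
qed

lemma escapes_sets:
  "{\<omega> \<in> space (law p). escapes n \<omega>} \<in> sets (law p)"
proof -
  define J where "J = Sigma (ebox n) nbrs"
  have "local_on J (escapes n)"
    unfolding local_on_def
  proof (intro allI impI)
    fix \<omega> \<omega>' :: "(int ^ 2) \<times> (int ^ 2) \<Rightarrow> bool" assume "\<forall>e\<in>J. \<omega> e = \<omega>' e"
    then have "arcs (ebox n) (out_nbrs \<omega>) = arcs (ebox n) (out_nbrs \<omega>')"
      by (intro arcs_cong) (auto simp: J_def out_nbrs_def)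
    then show "escapes n \<omega> = escapes n \<omega>'" by (simp add: escapes_def hits_def)
  qed
  moreover have "finite J" using finite_ebox nbrs_two(1) by (simp add: J_def)
  moreover have "J \<subseteq> dir_edges" by (auto simp: J_def nbrs_def)
  ultimately show ?thesis
    unfolding edge_law_def sets_distr space_distr by (intro sets_PiM_local)
qed

lemma escapes_antimono: "m \<le> n \<Longrightarrow> escapes n \<omega> \<Longrightarrow> escapes m \<omega>"
  unfolding escapes_def
  by (erule hits_subregion) (auto simp: ebox_def boxn_def intro!: image_mono)

abbreviation choices :: "real \<Rightarrow> (int ^ 2 \<Rightarrow> (int ^ 2) set) measure" where
  "choices p \<equiv> \<Pi>\<^sub>M x\<in>UNIV. measure_pmf (choice_pmf p x)"

abbreviation edges_of :: "(int ^ 2 \<Rightarrow> (int ^ 2) set) \<Rightarrow> (int ^ 2) \<times> (int ^ 2) \<Rightarrow> bool" where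
  "edges_of c \<equiv> \<lambda>(x, y)\<in>dir_edges. y \<in> c x"

lemma space_choices [simp]: "space (choices p) = UNIV"
  by (auto simp: space_PiM)

lemma measure_edge_law:
  assumes "{\<omega> \<in> space (law p). Q \<omega>} \<in> sets (law p)"
  shows "measure (law p) {\<omega> \<in> space (law p). Q \<omega>} = measure (choices p) {c. Q (edges_of c)}"
    "{c. Q (edges_of c)} \<in> sets (choices p)"
proof -
  have "edges_of c \<in> space (law p)" for c
    using measurable_space[OF edge_law_measurable, of c p] by (simp add: edge_law_def)
  then have eq: "edges_of -` {\<omega> \<in> space (law p). Q \<omega>} \<inter> space (choices p) = {c. Q (edges_of c)}"
    by auto
  have S: "{\<omega> \<in> space (law p). Q \<omega>} \<in> sets (\<Pi>\<^sub>M e\<in>dir_edges. count_space UNIV)"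
    using assms by (simp add: edge_law_def)
  show "measure (law p) {\<omega> \<in> space (law p). Q \<omega>} = measure (choices p) {c. Q (edges_of c)}"
    using measure_distr[OF edge_law_measurable S, of p] eq by (simp add: edge_law_def)
  show "{c. Q (edges_of c)} \<in> sets (choices p)"
    using measurable_sets[OF edge_law_measurable S, of p] eq by simp
qed

lemma measure_escapes_ge:
  assumes p: "1 / 2 - small / 8 \<le> p" "p \<le> 1" and n: "0 < n"
  shows "1 / (1024 * surgery_const) \<le> measure (law p) {\<omega> \<in> space (law p). escapes n \<omega>}"
proof -
  define E where "E c \<longleftrightarrow> escapes n (edges_of c)" for c
  have out: "out_nbrs (edges_of c) x = nbrs x \<inter> c x" for c x
    by (auto simp: out_nbrs_def nbrs_def)
  have loc: "local_on (ebox n) E"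
    unfolding local_on_def
  proof (intro allI impI)
    fix c c' :: "int ^ 2 \<Rightarrow> (int ^ 2) set" assume "\<forall>q\<in>ebox n. c q = c' q"
    then have "arcs (ebox n) (out_nbrs (edges_of c)) = arcs (ebox n) (out_nbrs (edges_of c'))"
      unfolding out by (intro arcs_cong) simp
    then show "E c = E c'" by (simp add: E_def escapes_def hits_def)
  qed
  have "1 / (1024 * surgery_const) \<le> conn small 1 (boxn n) (0, 0)"
    using conn_zero_ge n by (rule conn_one_ge)
  also have "\<dots> \<le> wsum (ebox n) nbrs (\<lambda>x. pmf (choice_pmf p x)) (\<lambda>c. of_bool (hits (ebox n) (- ebox n) c 0))"
    using wsum_choice_ge[OF p, of "boxn n" "(0, 0)"] by (simp add: ebox_def emb_zero)
  also have "\<dots> = wsum (ebox n) nbrs (\<lambda>x. pmf (choice_pmf p x)) (\<lambda>c. of_bool (E c))"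
  proof (rule wsum_cong)
    fix c assume "c \<in> PiE (ebox n) (\<lambda>q. Pow (nbrs q))"
    then have "arcs (ebox n) (out_nbrs (edges_of c)) = arcs (ebox n) c"
      unfolding out by (intro arcs_cong) (auto simp: PiE_iff)
    then show "of_bool (hits (ebox n) (- ebox n) c 0) = (of_bool (E c) :: real)"
      by (simp add: E_def escapes_def hits_def)
  qed
  also have "\<dots> \<le> measure (choices p) {c. E c}"
    using measure_edge_law(2)[OF escapes_sets[where p = p and n = n]]
    by (intro measure_ge_wsum finite_ebox nbrs_two loc) (simp add: E_def)
  also have "\<dots> = measure (law p) {\<omega> \<in> space (law p). escapes n \<omega>}"
    unfolding E_def by (rule measure_edge_law(1)[OF escapes_sets, symmetric])
  finally show ?thesis .
qed

lemma percolates_sets: "{\<omega> \<in> space (law p). percolates_from_origin \<omega>} \<in> sets (law p)"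
proof -
  have "{\<omega> \<in> space (law p). percolates_from_origin \<omega>} = (\<Inter>n. {\<omega> \<in> space (law p). escapes n \<omega>})"
    by (auto simp: percolates_iff_escapes)
  also have "\<dots> \<in> sets (law p)"
    using escapes_sets by (intro sets.countable_INT) auto
  finally show ?thesis .
qed

text \<open>The escape events decrease to percolation, so their uniform lower bound passes to the
  limit.\<close>

lemma theta_ge:
  assumes "1 / 2 - small / 8 \<le> p" "p \<le> 1"
  shows "1 / (1024 * surgery_const) \<le> theta TYPE(2) p"
proof -
  interpret prob_space "law p" by (rule prob_space_edge_law)
  define A where "A n = {\<omega> \<in> space (law p). escapes n \<omega>}" for n
  have "(\<lambda>n. measure (law p) (A n)) \<longlonglongrightarrow> measure (law p) (\<Inter>n. A n)"
  proof (rule finite_Lim_measure_decseq)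
    show "range A \<subseteq> sets (law p)" unfolding A_def using escapes_sets by auto
    show "decseq A" unfolding A_def decseq_def using escapes_antimono by auto
  qed
  moreover have "(\<Inter>n. A n) = {\<omega> \<in> space (law p). percolates_from_origin \<omega>}"
    by (auto simp: A_def percolates_iff_escapes)
  ultimately have lim: "(\<lambda>n. measure (law p) (A n)) \<longlonglongrightarrow> theta TYPE(2) p"
    by (simp add: theta_def Let_def)
  show ?thesis
  proof (rule LIMSEQ_le_const[OF lim], intro exI allI impI)
    fix n :: nat assume "1 \<le> n"
    then show "1 / (1024 * surgery_const) \<le> measure (law p) (A n)"
      unfolding A_def using assms by (intro measure_escapes_ge) auto
  qed
qed

lemma choice_pmf_zero: "choice_pmf 0 (x :: int ^ 2) = return_pmf {}"
proof -
  have "bernoulli_pmf 0 = return_pmf False"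
    by (rule pmf_eqI, rename_tac b, case_tac b) simp_all
  moreover have "{S. S \<subseteq> nbrs x \<and> card S = 0} = {{}}"
    using nbrs_two(1)[of x] by (auto dest: finite_subset)
  ultimately show ?thesis
    by (simp add: choice_pmf_def base_degree_def extra_prob_def pmf_of_set_singleton bind_return_pmf)
qed

text \<open>Makes the set in \<open>crit_prob\<close> nonempty, so that its supremum can be bounded.
  At p = 0 the origin almost surely chooses nothing.\<close>

lemma theta_zero: "theta TYPE(2) 0 = 0"
proof -
  interpret prob_space "choices 0"
    by (intro prob_space_PiM measure_pmf.prob_space_axioms)
  define Z where "Z = {c :: int ^ 2 \<Rightarrow> (int ^ 2) set. \<forall>x\<in>{0}. c x = {}}"
  define X where "X = {c. percolates_from_origin (edges_of c)}"
  have Z: "measure (choices 0) Z = 1" "Z \<in> sets (choices 0)"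
    unfolding Z_def using measure_cylinder[where J = "{0}" and q = "choice_pmf 0 :: int ^ 2 \<Rightarrow> _" and ?c0.0 = "\<lambda>_. {}"]
    by (simp_all add: choice_pmf_zero)
  have X: "theta TYPE(2) 0 = measure (choices 0) X" "X \<in> sets (choices 0)"
    unfolding X_def using measure_edge_law[OF percolates_sets, of 0] by (simp_all add: theta_def Let_def)
  have "Z \<inter> X = {}"
  proof -
    have False if c: "c 0 = {}" "percolates_from_origin (edges_of c)" for c :: "int ^ 2 \<Rightarrow> (int ^ 2) set"
    proof -
      obtain \<gamma> :: "nat \<Rightarrow> int ^ 2" where "\<gamma> 0 = 0" "(\<gamma> 0, \<gamma> (Suc 0)) \<in> dir_edges" "edges_of c (\<gamma> 0, \<gamma> (Suc 0))"
        using c(2) unfolding percolates_from_origin_def by blast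
      then show False using c(1) by simp
    qed
    then show ?thesis by (auto simp: Z_def X_def)
  qed
  then have "measure (choices 0) (Z \<union> X) = 1 + measure (choices 0) X"
    using Z X by (simp add: finite_measure_Union)
  then have "measure (choices 0) X \<le> 0" using prob_le_1[of "Z \<union> X"] by simp
  then show ?thesis using X(1) by (simp add: measure_le_0_iff)
qed

theorem theorem2p3:
  shows "crit_prob TYPE(2) < 1/2 \<and> theta TYPE(2) (1/2) > 0"
proof
  have pos: "0 < 1 / (1024 * surgery_const)" by (simp add: surgery_const_def)
  \<comment> \<open>By \<open>theta_ge\<close> no p between \<open>1 / 2 - small / 8\<close> and 1
    has \<open>theta\<close> equal to 0; the margin makes the final inequality strict.\<close>
  have "crit_prob TYPE(2) \<le> 1 / 2 - small / 8"
    unfolding crit_prob_def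
  proof (rule cSup_least)
    show "{p. 0 \<le> p \<and> p \<le> 1 \<and> theta TYPE(2) p = 0} \<noteq> {}"
      using theta_zero by (intro ex_in_conv[THEN iffD1] exI[of _ 0]) simp
    fix p assume p: "p \<in> {p. 0 \<le> p \<and> p \<le> 1 \<and> theta TYPE(2) p = 0}"
    show "p \<le> 1 / 2 - small / 8"
    proof (rule ccontr)
      assume "\<not> p \<le> 1 / 2 - small / 8"
      then show False using theta_ge[of p] pos p by simp
    qed
  qed
  then show "crit_prob TYPE(2) < 1 / 2" using small_bounds by linarith
  show "0 < theta TYPE(2) (1 / 2)" 
    by (rule less_le_trans[OF pos theta_ge]) (use small_bounds in auto)
qed

end
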